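(* Let $q\in(-1,1)$ and let $\mathcal{H}$ be a real separable Hilbert space. Let $\Phi=\operatorname{proj\,lim}_{\tau\in T}\mathcal{H}_\tau$ be a real nuclear space which is densely and continuously embedded into $\mathcal{H}$, where each $\mathcal{H}_\tau$ is a dense subset of $\mathcal{H}$ with $\|\cdot\|_{\mathcal{H}}\le\|\cdot\|_{\mathcal{H}_\tau}$. Let $\mathcal{H}_{-\tau}$ be the dual space of $\mathcal{H}_\tau$ with respect to the center space $\mathcal{H}$. Then the co-nuclear space $$\mathbb{F}_q(\Phi',-2):=\operatorname{ind\,lim}_{(\tau,r)\in T\times[1,\infty)}\mathbb{F}_q(\mathcal{H}_{-\tau},r^{-1},-2)$$ is an algebra under addition and tensor multiplication $\otimes$.
   Context: Nuclear space. $\Phi=\operatorname{proj\,lim}_{\tau\in T}\mathcal{H}_\tau$, where $(\mathcal{H}_\tau)_{\tau\in T}$ is a family of real separable Hilbert spaces directed by embedding: for any $\tau_1,\tau_2\in T$ there is $\tau_3\in T$ such that $\mathcal{H}_{\tau_3}$ is densely and continuously embedded into both $\mathcal{H}_{\tau_1}$ and $\mathcal{H}_{\tau_2}$; and for each $\tau_1\in T$ there is $\tau_2\in T$ such that the embedding operator of $\mathcal{H}_{\tau_2}$ into $\mathcal{H}_{\tau_1}$ is of Hilbert--Schmidt class. The dual space $\mathcal{H}_{-\tau}$ of $\mathcal{H}_\tau$ with respect to the center space $\mathcal{H}$ is the Hilbert space with $\mathcal{H}_\tau\subset\mathcal{H}\subset\mathcal{H}_{-\tau}$ (dense continuous embeddings)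 realizing the dual of $\mathcal{H}_\tau$, where the dual pairing is given by an extension of the scalar product in $\mathcal{H}$. The dual space $\Phi'$ of $\Phi$ with respect to $\mathcal{H}$ is $\operatorname{ind\,lim}_{\tau\in T}\mathcal{H}_{-\tau}$. Notation. $[n]_{|q|}:=1+|q|+\dots+|q|^{n-1}$, $[n]_{|q|}!:=[1]_{|q|}\cdots[n]_{|q|}$, $[0]_{|q|}!:=1$; convention $0^0:=1$. For a real Hilbert space $\mathcal{K}$ and $c>0$, $\mathcal{K}c$ denotes the Hilbert space equal to $\mathcal{K}$ as a set with scalar product $c(\cdot,\cdot)_{\mathcal{K}}$. For a real separable Hilbert space $\mathcal{K}$ and $n\in\mathbb{N}$ let $P_q^{(n)}$ be the bounded (strictly positive) linear operator on $\mathcal{K}^{\otimes n}$ given by $P_q^{(n)}f_1\otimes\dots\otimes f_n:=\sum_{\pi\in S_n}q^{\operatorname{inv}(\pi)}f_{\pi(1)}\otimes\dots\otimes f_{\pi(n)}$, where $\operatorname{inv}(\pi)$ is the number of pairs $i<j$ with $\pi(i)>\pi(j)$. $\mathbb{F}_q^{(n)}(\mathcal{K})$ is the Hilbert space equal to $\mathcal{K}^{\otimes n}$ as a set with scalar product $(f,g)_{\mathbb{F}_q^{(n)}(\mathcal{K})}:=(P_q^{(n)}f,P_q^{(n)}g)_{\mathcal{K}^{\otimes n}}$; $\mathbb{F}_q^{(0)}(\mathcal{K}):=\mathbb{R}$. For $r>0$ and $\alpha\in\mathbb{R}$, $\mathbb{F}_q(\mathcal{K},r,\alpha):=\bigoplus_{n=0}^\infty\mathbb{F}_q^{(n)}(\mathcal{K})\,r^n([n]_{|q|}!)^\alpha$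 (Hilbert space direct sum). The inductive limit over $(\tau,r)$ is the union of the (directed family of) Hilbert spaces with the inductive limit topology. Tensor multiplication: for $F=(f^{(n)})_{n\ge0}$ and $G=(g^{(n)})_{n\ge0}$, $F\otimes G:=\big(\sum_{i=0}^nf^{(i)}\otimes g^{(n-i)}\big)_{n\ge0}$. *)

theory Defs
  imports
    "HOL-Analysis.Analysis"
    "HOL-Library.Function_Algebras"
    "HOL-Combinatorics.Permutations"
    "HOL-Algebra.Module"
begin

section \<open>Function spaces as real vector spaces\<close>

instantiation "fun" :: (type, real_vector) real_vector
begin

definition scaleR_fun :: "real \<Rightarrow> ('a \<Rightarrow> 'b) \<Rightarrow> 'a \<Rightarrow> 'b" where
  "scaleR_fun c f = (\<lambda>x. c *\<^sub>R f x)"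

instance
  by standard (simp_all add: scaleR_fun_def fun_eq_iff scaleR_add_left scaleR_add_right)

end

section \<open>Real Hilbert spaces on a subset of a vector space\<close>

text \<open>The spaces of the family are all subsets of one space \<open>\<H>\<close>, each with its own scalar
  product; hence a Hilbert space is a carrier set together with a scalar product.\<close>

record 'v hspace =
  hcar :: "'v set"
  hip :: "'v \<Rightarrow> 'v \<Rightarrow> real"

definition hnorm :: "'v hspace \<Rightarrow> 'v \<Rightarrow> real" where
  "hnorm K x = sqrt (hip K x x)"

definition hilbert_space :: "'v::real_vector hspace \<Rightarrow> bool" where
  "hilbert_space K \<longleftrightarrow>
     subspace (hcar K) \<and>
     (\<forall>x\<in>hcar K. \<forall>y\<in>hcar K. hip K x y = hip K y x) \<and>
     (\<forall>x\<in>hcar K. \<forall>y\<in>hcar K. \<forall>z\<in>hcar K. \<forall>a.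
        hip K (a *\<^sub>R x + y) z = a * hip K x z + hip K y z) \<and>
     (\<forall>x\<in>hcar K. x \<noteq> 0 \<longrightarrow> hip K x x > 0) \<and>
     (\<forall>X. (\<forall>n. X n \<in> hcar K) \<and>
          (\<forall>e>0. \<exists>N::nat. \<forall>m\<ge>N. \<forall>n\<ge>N. hnorm K (X m - X n) < e) \<longrightarrow>
          (\<exists>x\<in>hcar K. (\<lambda>n. hnorm K (X n - x)) \<longlonglongrightarrow> 0))"

definition dense_subset :: "'v::real_vector hspace \<Rightarrow> 'v set \<Rightarrow> bool" where
  "dense_subset K D \<longleftrightarrow> D \<subseteq> hcar K \<and> (\<forall>x\<in>hcar K. \<forall>e>0. \<exists>d\<in>D. hnorm K (x - d) < e)"

definition separable_hilbert_space :: "'v::real_vector hspace \<Rightarrow> bool" where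
  "separable_hilbert_space K \<longleftrightarrow> hilbert_space K \<and> (\<exists>D. countable D \<and> dense_subset K D)"

definition is_onb :: "'v::real_vector hspace \<Rightarrow> 'v set \<Rightarrow> bool" where
  "is_onb K B \<longleftrightarrow>
     B \<subseteq> hcar K \<and> (\<forall>x\<in>B. \<forall>y\<in>B. hip K x y = (if x = y then 1 else 0)) \<and>
     dense_subset K (span B)"

text \<open>A chosen orthonormal basis; nothing defined below depends on the choice.\<close>

definition onb :: "'v::real_vector hspace \<Rightarrow> 'v set" where
  "onb K = (SOME B. is_onb K B)"

definition densely_embedded :: "'v::real_vector hspace \<Rightarrow> 'v hspace \<Rightarrow> bool" where
  "densely_embedded K L \<longleftrightarrow>
     dense_subset L (hcar K) \<and> (\<exists>C. \<forall>x\<in>hcar K. hnorm L x \<le> C * hnorm K x)"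

definition hilbert_schmidt_embedded :: "'v::real_vector hspace \<Rightarrow> 'v hspace \<Rightarrow> bool" where
  "hilbert_schmidt_embedded K L \<longleftrightarrow>
     hcar K \<subseteq> hcar L \<and> (\<exists>B. is_onb K B \<and> (\<lambda>e. (hnorm L e)\<^sup>2) summable_on B)"

definition hscale :: "real \<Rightarrow> 'v hspace \<Rightarrow> 'v hspace" where
  "hscale c K = \<lparr>hcar = hcar K, hip = (\<lambda>x y. c * hip K x y)\<rparr>"

definition hsum :: "(nat \<Rightarrow> 'v hspace) \<Rightarrow> (nat \<Rightarrow> 'v) hspace" where
  "hsum K =
     \<lparr>hcar = {F. (\<forall>n. F n \<in> hcar (K n)) \<and> summable (\<lambda>n. hip (K n) (F n) (F n))},
      hip = (\<lambda>F G. \<Sum>n. hip (K n) (F n) (G n))\<rparr>"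

section \<open>Dual spaces\<close>

text \<open>\<open>riesz K u\<close> is the functional \<open>(u, \<cdot>)\<^sub>K\<close>.  Functionals are set to \<open>0\<close> outside of
  the carrier, so that equal functionals are equal as functions.\<close>

definition riesz :: "'v hspace \<Rightarrow> 'v \<Rightarrow> 'v \<Rightarrow> real" where
  "riesz K u = (\<lambda>x. if x \<in> hcar K then hip K u x else 0)"

definition riesz_rep :: "'v hspace \<Rightarrow> ('v \<Rightarrow> real) \<Rightarrow> 'v" where
  "riesz_rep K \<omega> = (THE u. u \<in> hcar K \<and> riesz K u = \<omega>)"

text \<open>For \<open>K = \<H>\<^sub>\<tau> \<subseteq> \<H>\<close> this is \<open>\<H>\<^sub>-\<^sub>\<tau>\<close>.  The center space is contained in it through
  \<open>h \<mapsto> (h, \<cdot>)\<^sub>\<H>\<close> restricted to \<open>\<H>\<^sub>\<tau>\<close>, so the evaluation \<open>\<omega> \<phi>\<close>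
  extends the scalar product of \<open>\<H>\<close>, and for \<open>\<H>\<^sub>\<rho> \<subseteq> \<H>\<^sub>\<tau>\<close> the embedding
  \<open>\<H>\<^sub>-\<^sub>\<tau> \<subseteq> \<H>\<^sub>-\<^sub>\<rho>\<close> which is the identity on \<open>\<H>\<close> is the restriction of functionals to \<open>\<H>\<^sub>\<rho>\<close>.\<close>

definition hdual :: "'v::real_vector hspace \<Rightarrow> ('v \<Rightarrow> real) hspace" where
  "hdual K =
     \<lparr>hcar = {\<omega>. (\<forall>x. x \<notin> hcar K \<longrightarrow> \<omega> x = 0) \<and>
                 (\<forall>x\<in>hcar K. \<forall>y\<in>hcar K. \<forall>a. \<omega> (a *\<^sub>R x + y) = a * \<omega> x + \<omega> y) \<and>
                 (\<exists>C. \<forall>x\<in>hcar K. \<bar>\<omega> x\<bar> \<le> C * hnorm K x)},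
      hip = (\<lambda>\<omega> \<eta>. hip K (riesz_rep K \<omega>) (riesz_rep K \<eta>))\<rparr>"

section \<open>Tensor powers\<close>

definition tuples :: "'v set \<Rightarrow> nat \<Rightarrow> 'v list set" where
  "tuples A n = {xs. length xs = n \<and> set xs \<subseteq> A}"

text \<open>The Hilbert space tensor power \<open>K\<^sup>\<otimes>\<^sup>n\<close> is realised as the space of bounded
  \<open>n\<close>-linear Hilbert--Schmidt functionals on \<open>K\<close>, where \<open>f\<^sub>1 \<otimes> \<dots> \<otimes> f\<^sub>n\<close> is
  \<open>(x\<^sub>1, \<dots>, x\<^sub>n) \<mapsto> (f\<^sub>1, x\<^sub>1) \<cdots> (f\<^sub>n, x\<^sub>n)\<close>.  (This is the construction in Kadison and
  Ringrose, Fundamentals of the Theory of Operator Algebras I, Section 2.6.)  For \<open>n = 0\<close> it is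
  \<open>\<real>\<close>, via the value at the empty tuple.\<close>

definition tensor_power :: "'v::real_vector hspace \<Rightarrow> nat \<Rightarrow> ('v list \<Rightarrow> real) hspace" where
  "tensor_power K n =
     \<lparr>hcar = {f. (\<forall>xs. xs \<notin> tuples (hcar K) n \<longrightarrow> f xs = 0) \<and>
                 (\<forall>xs\<in>tuples (hcar K) n. \<forall>i<n. \<forall>x\<in>hcar K. \<forall>y\<in>hcar K. \<forall>a.
                    f (xs[i := a *\<^sub>R x + y]) = a * f (xs[i := x]) + f (xs[i := y])) \<and>
                 (\<exists>C. \<forall>xs\<in>tuples (hcar K) n. \<bar>f xs\<bar> \<le> C * prod_list (map (hnorm K) xs)) \<and>
                 (\<lambda>es. (f es)\<^sup>2) summable_on tuples (onb K) n},
      hip = (\<lambda>f g. \<Sum>\<^sub>\<infinity>es\<in>tuples (onb K) n. f es * g es)\<rparr>"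

definition elementary_tensor :: "'v hspace \<Rightarrow> 'v list \<Rightarrow> 'v list \<Rightarrow> real" where
  "elementary_tensor K fs =
     (\<lambda>xs. if xs \<in> tuples (hcar K) (length fs) then \<Prod>i<length fs. hip K (fs ! i) (xs ! i) else 0)"

section \<open>The \<open>q\<close>-Fock spaces\<close>

definition inversions :: "nat \<Rightarrow> (nat \<Rightarrow> nat) \<Rightarrow> nat" where
  "inversions n \<pi> = card {(i, j). i < j \<and> j < n \<and> \<pi> i > \<pi> j}"

text \<open>Evaluating \<open>f\<^sub>\<pi>\<^sub>(\<^sub>1\<^sub>) \<otimes> \<dots> \<otimes> f\<^sub>\<pi>\<^sub>(\<^sub>n\<^sub>)\<close> at a tuple is evaluating \<open>f\<^sub>1 \<otimes> \<dots> \<otimes> f\<^sub>n\<close> at the tuple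
  permuted by \<open>\<pi>\<^sup>-\<^sup>1\<close>; see the lemma following the definition.\<close>

definition Pq :: "real \<Rightarrow> nat \<Rightarrow> ('v list \<Rightarrow> real) \<Rightarrow> 'v list \<Rightarrow> real" where
  "Pq q n f = (\<lambda>xs. \<Sum>\<pi> | \<pi> permutes {..<n}.
                 q ^ inversions n \<pi> * f (permute_list (Hilbert_Choice.inv \<pi>) xs))"

lemma Pq_elementary_tensor:
  assumes "length fs = n"
  shows "Pq q n (elementary_tensor K fs) =
         (\<lambda>xs. \<Sum>\<pi> | \<pi> permutes {..<n}.
            q ^ inversions n \<pi> * elementary_tensor K (permute_list \<pi> fs) xs)"
proof -
  have "elementary_tensor K fs (permute_list (Hilbert_Choice.inv \<pi>) xs) =
        elementary_tensor K (permute_list \<pi> fs) xs" if p: "\<pi> permutes {..<n}" for \<pi> xs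
  proof (cases "length xs = n")
    case True
    have pinv: "Hilbert_Choice.inv \<pi> permutes {..<length xs}"
      using p True by (simp add: permutes_inv)
    have "(\<Prod>i<n. hip K (fs ! i) (xs ! Hilbert_Choice.inv \<pi> i)) =
          (\<Prod>i<n. hip K (fs ! \<pi> i) (xs ! i))"
      by (rule prod.reindex_bij_witness[of _ \<pi> "Hilbert_Choice.inv \<pi>"])
         (use p permutes_in_image[OF p] permutes_in_image[OF permutes_inv[OF p]]
           in \<open>auto simp: permutes_inverses\<close>)
    then show ?thesis
      using True assms p pinv
      by (simp add: elementary_tensor_def tuples_def permute_list_nth)
  qed (use assms in \<open>auto simp: elementary_tensor_def tuples_def\<close>)
  then show ?thesis
    by (auto simp: Pq_def fun_eq_iff intro!: sum.cong)
qed

definition Fqn :: "real \<Rightarrow> 'v::real_vector hspace \<Rightarrow> nat \<Rightarrow> ('v list \<Rightarrow> real) hspace" where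
  "Fqn q K n =
     \<lparr>hcar = hcar (tensor_power K n),
      hip = (\<lambda>f g. hip (tensor_power K n) (Pq q n f) (Pq q n g))\<rparr>"

definition qint :: "real \<Rightarrow> nat \<Rightarrow> real" where
  "qint p n = (\<Sum>i<n. p ^ i)"

definition qfact :: "real \<Rightarrow> nat \<Rightarrow> real" where
  "qfact p n = (\<Prod>k=1..n. qint p k)"

definition Fq ::
  "real \<Rightarrow> 'v::real_vector hspace \<Rightarrow> real \<Rightarrow> real \<Rightarrow> (nat \<Rightarrow> 'v list \<Rightarrow> real) hspace" where
  "Fq q K r \<alpha> = hsum (\<lambda>n. hscale (r ^ n * qfact \<bar>q\<bar> n powr \<alpha>) (Fqn q K n))"

text \<open>In the realisation by multilinear functionals,
  \<open>(f \<otimes> g)(x\<^sub>1, \<dots>, x\<^sub>n) = f(x\<^sub>1, \<dots>, x\<^sub>i) g(x\<^sub>i\<^sub>+\<^sub>1, \<dots>, x\<^sub>n)\<close> for \<open>f \<in> K\<^sup>\<otimes>\<^sup>i\<close>, \<open>g \<in> K\<^sup>\<otimes>\<^sup>(\<^sup>n\<^sup>-\<^sup>i\<^sup>)\<close>.\<close>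

definition tensor_mult ::
  "(nat \<Rightarrow> 'v list \<Rightarrow> real) \<Rightarrow> (nat \<Rightarrow> 'v list \<Rightarrow> real) \<Rightarrow> nat \<Rightarrow> 'v list \<Rightarrow> real" where
  "tensor_mult F G = (\<lambda>n xs. \<Sum>i\<le>n. F i (take i xs) * G (n - i) (drop i xs))"

lemma elementary_tensor_append:
  "elementary_tensor K fs (take (length fs) xs) * elementary_tensor K gs (drop (length fs) xs) =
   elementary_tensor K (fs @ gs) xs"
proof (cases "length xs = length fs + length gs")
  case True
  have "set xs = set (take (length fs) xs) \<union> set (drop (length fs) xs)"
    by (metis append_take_drop_id set_append)
  moreover have "(\<Prod>i<length fs + m. hip K ((fs @ gs) ! i) (xs ! i)) =
      (\<Prod>i<length fs. hip K (fs ! i) (xs ! i)) *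
      (\<Prod>i<m. hip K (gs ! i) (xs ! (length fs + i)))" for m
    by (induction m) (simp_all add: nth_append mult.assoc)
  ultimately show ?thesis
    using True by (simp add: elementary_tensor_def tuples_def)
qed (auto simp: elementary_tensor_def tuples_def)

definition vacuum :: "nat \<Rightarrow> 'v list \<Rightarrow> real" where
  "vacuum = (\<lambda>n xs. if n = 0 \<and> xs = [] then 1 else 0)"

section \<open>Nuclear spaces\<close>

definition nuclear_family :: "'t set \<Rightarrow> ('t \<Rightarrow> 'v::real_vector hspace) \<Rightarrow> bool" where
  "nuclear_family T H \<longleftrightarrow>
     T \<noteq> {} \<and>
     (\<forall>\<tau>\<in>T. separable_hilbert_space (H \<tau>)) \<and>
     (\<forall>\<tau>1\<in>T. \<forall>\<tau>2\<in>T. \<exists>\<tau>3\<in>T.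
        densely_embedded (H \<tau>3) (H \<tau>1) \<and> densely_embedded (H \<tau>3) (H \<tau>2)) \<and>
     (\<forall>\<tau>1\<in>T. \<exists>\<tau>2\<in>T. hilbert_schmidt_embedded (H \<tau>2) (H \<tau>1))"

definition proj_lim :: "'t set \<Rightarrow> ('t \<Rightarrow> 'v hspace) \<Rightarrow> 'v set" where
  "proj_lim T H = (\<Inter>\<tau>\<in>T. hcar (H \<tau>))"

definition proj_lim_topology :: "'t set \<Rightarrow> ('t \<Rightarrow> 'v::real_vector hspace) \<Rightarrow> 'v topology" where
  "proj_lim_topology T H = topology_generated_by
     {{\<phi> \<in> proj_lim T H. hnorm (H \<tau>) (\<phi> - a) < e} | \<tau> a e. \<tau> \<in> T \<and> a \<in> hcar (H \<tau>)}"

section \<open>The inductive limit of the spaces \<open>F\<^sub>q(\<H>\<^sub>-\<^sub>\<tau>, r\<^sup>-\<^sup>1, -2)\<close>\<close>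

text \<open>The elements of the spaces of the family, tagged with \<open>\<tau>\<close>.  (For fixed \<open>\<tau>\<close> the spaces with
  different \<open>r\<close> are subsets of the same set of sequences.)\<close>

definition fock_elements ::
  "real \<Rightarrow> 't set \<Rightarrow> ('t \<Rightarrow> 'v::real_vector hspace) \<Rightarrow>
   ('t \<times> (nat \<Rightarrow> ('v \<Rightarrow> real) list \<Rightarrow> real)) set" where
  "fock_elements q T H =
     {(\<tau>, F). \<tau> \<in> T \<and> (\<exists>r\<ge>1. F \<in> hcar (Fq q (hdual (H \<tau>)) (1 / r) (-2)))}"

text \<open>\<open>dual_pairing K F n [x\<^sub>1, \<dots>, x\<^sub>n]\<close> is the dual pairing of \<open>F\<^sup>(\<^sup>n\<^sup>) \<in> (K')\<^sup>\<otimes>\<^sup>n\<close> with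
  \<open>x\<^sub>1 \<otimes> \<dots> \<otimes> x\<^sub>n \<in> K\<^sup>\<otimes>\<^sup>n\<close>; for \<open>F\<^sup>(\<^sup>n\<^sup>) = \<omega>\<^sub>1 \<otimes> \<dots> \<otimes> \<omega>\<^sub>n\<close> it is \<open>\<omega>\<^sub>1(x\<^sub>1) \<cdots> \<omega>\<^sub>n(x\<^sub>n)\<close>,
  since \<open>(\<omega>, riesz K x)\<^sub>K\<^sub>' = \<omega>(x)\<close>.\<close>

definition dual_pairing ::
  "'v hspace \<Rightarrow> (nat \<Rightarrow> ('v \<Rightarrow> real) list \<Rightarrow> real) \<Rightarrow> nat \<Rightarrow> 'v list \<Rightarrow> real" where
  "dual_pairing K F n xs = F n (map (riesz K) xs)"

text \<open>For \<open>\<H>\<^sub>\<rho>\<close> densely embedded in \<open>\<H>\<^sub>\<sigma>\<close>, the embedding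
  \<open>\<H>\<^sub>-\<^sub>\<sigma>\<^sup>\<otimes>\<^sup>n \<subseteq> \<H>\<^sub>-\<^sub>\<rho>\<^sup>\<otimes>\<^sup>n\<close>, the tensor power of the restriction map,
  restricts the pairing to \<open>\<H>\<^sub>\<rho>\<close>.  The relation identifies elements of
  two spaces of the family which become equal in a common larger space.\<close>

definition fock_rel ::
  "real \<Rightarrow> 't set \<Rightarrow> ('t \<Rightarrow> 'v::real_vector hspace) \<Rightarrow>
   (('t \<times> (nat \<Rightarrow> ('v \<Rightarrow> real) list \<Rightarrow> real)) \<times> ('t \<times> (nat \<Rightarrow> ('v \<Rightarrow> real) list \<Rightarrow> real))) set" where
  "fock_rel q T H =
     {((\<sigma>, F), (\<tau>, G)). (\<sigma>, F) \<in> fock_elements q T H \<and> (\<tau>, G) \<in> fock_elements q T H \<and>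
        (\<exists>\<rho>\<in>T. densely_embedded (H \<rho>) (H \<sigma>) \<and> densely_embedded (H \<rho>) (H \<tau>) \<and>
           (\<forall>n. \<forall>xs\<in>tuples (hcar (H \<rho>)) n.
              dual_pairing (H \<sigma>) F n xs = dual_pairing (H \<tau>) G n xs))}"

text \<open>The union of the family with its operations: binary operations are computed on
  representatives which lie over a common \<open>\<tau>\<close>.  The inductive limit topology plays no role for
  the algebra structure and is not part of the record.\<close>

definition fock_indlim ::
  "real \<Rightarrow> 't set \<Rightarrow> ('t \<Rightarrow> 'v::real_vector hspace) \<Rightarrow>
   (real, ('t \<times> (nat \<Rightarrow> ('v \<Rightarrow> real) list \<Rightarrow> real)) set) module" where
  "fock_indlim q T H =
     (let cls = (\<lambda>\<tau> F. fock_rel q T H `` {(\<tau>, F)}) in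
      \<lparr>carrier = fock_elements q T H // fock_rel q T H,
       monoid.mult = (\<lambda>A B. \<Union>{cls \<tau> (tensor_mult F G) | \<tau> F G. (\<tau>, F) \<in> A \<and> (\<tau>, G) \<in> B}),
       one = (\<Union>\<tau>\<in>T. cls \<tau> vacuum),
       ring.zero = (\<Union>\<tau>\<in>T. cls \<tau> 0),
       add = (\<lambda>A B. \<Union>{cls \<tau> (F + G) | \<tau> F G. (\<tau>, F) \<in> A \<and> (\<tau>, G) \<in> B}),
       smult = (\<lambda>c A. \<Union>{cls \<tau> (c *\<^sub>R F) | \<tau> F. (\<tau>, F) \<in> A})\<rparr>)"

section \<open>Real algebras\<close>

text \<open>The locale \<^locale>\<open>algebra\<close> is restricted to commutative algebras.\<close>

definition real_field :: "real ring" where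
  "real_field =
     \<lparr>carrier = UNIV, monoid.mult = (*), one = 1, ring.zero = 0, add = (+)\<rparr>"

definition real_algebra :: "(real, 'a) module \<Rightarrow> bool" where
  "real_algebra A \<longleftrightarrow>
     Ring.ring A \<and> Module.module real_field A \<and>
     (\<forall>c. \<forall>x\<in>carrier A. \<forall>y\<in>carrier A.
        (c \<odot>\<^bsub>A\<^esub> x) \<otimes>\<^bsub>A\<^esub> y = c \<odot>\<^bsub>A\<^esub> (x \<otimes>\<^bsub>A\<^esub> y) \<and>
        x \<otimes>\<^bsub>A\<^esub> (c \<odot>\<^bsub>A\<^esub> y) = c \<odot>\<^bsub>A\<^esub> (x \<otimes>\<^bsub>A\<^esub> y))"

end

theory Submission
  imports Defs "HOL-Combinatorics.Multiset_Permutations"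
begin

text \<open>The ring and module axioms are identities between sequences over one index: \<^const>\<open>tensor_mult\<close>
is associative and bilinear with unit \<^const>\<open>vacuum\<close>.  What has to be shown is that
the spaces of the family can be moved to a common index without leaving the family, and that
the family is closed under the product.

Growth.  For \<open>\<bar>q\<bar> < 1\<close> the factorials satisfy \<open>1 \<le> [n]! \<le> (1 - \<bar>q\<bar>)\<^sup>-\<^sup>n\<close>, so every weight of the family
is exponential in \<open>n\<close>.  Hence the union over \<open>r\<close> of the spaces over a fixed \<open>\<tau>\<close> consists of the
sequences of tensors with \<open>\<parallel>P\<^sub>q F\<^sup>(\<^sup>n\<^sup>)\<parallel>\<^sup>2 \<le> M C\<^sup>n\<close> for some \<open>M\<close> and \<open>C\<close>
(\<open>ex_mem_Fq_iff_exp_bounded\<close>), and only exponential bounds matter.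

Product.  A permutation of \<open>i + m\<close> places amounts to the set \<open>A\<close> of places which go to the first \<open>i\<close>
positions, an ordering of \<open>A\<close> and an ordering of its complement.  Its inversions are those of the
two orderings together with a number \<open>c(A)\<close> that depends on \<open>A\<close> only.  Therefore
\<open>P\<^sub>q(f \<otimes> g)(x) = \<Sum>\<^sub>A q\<^bsup>c(A)\<^esup> (P\<^sub>q f)(x\<^sub>A) (P\<^sub>q g)(x\<^bsub>A'\<^esub>)\<close>, where \<open>A'\<close> is the complement of \<open>A\<close>
(\<open>Pq_tensor\<close>).  There are at most \<open>2\<^sup>n\<close> summands, where \<open>n = i + m\<close>, each of norm at most
\<open>\<parallel>P\<^sub>q f\<parallel> \<parallel>P\<^sub>q g\<parallel>\<close>, so \<open>\<parallel>P\<^sub>q(f \<otimes> g)\<parallel>\<^sup>2 \<le> 4\<^sup>n \<parallel>P\<^sub>q f\<parallel>\<^sup>2 \<parallel>P\<^sub>q g\<parallel>\<^sup>2\<close>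
(\<open>sqnorm_Pq_tensor_le\<close>), and exponential growth is preserved.

Change of index.  Let \<open>\<H>\<^sub>\<rho> \<subseteq> \<H>\<^sub>\<sigma>\<close>.  By the Riesz representation theorem the dual spaces are isometric
to \<open>\<H>\<^sub>\<rho>\<close> and \<open>\<H>\<^sub>\<sigma>\<close>, and the inclusion becomes a bounded map \<open>A : \<H>\<^sub>-\<^sub>\<rho> \<rightarrow> \<H>\<^sub>-\<^sub>\<sigma>\<close>, the adjoint of
the restriction of functionals.  The tensor power of the restriction is composition with \<open>A\<close> in every
argument.  For a bounded functional \<open>\<phi>\<close> and orthonormal \<open>e\<^sub>k\<close> one has
\<open>\<Sum> \<phi>(A e\<^sub>k)\<^sup>2 \<le> \<parallel>A\<parallel>\<^sup>2 \<Sum> \<phi>(b\<^sub>j)\<^sup>2\<close> over any orthonormal basis \<open>b\<^sub>j\<close>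
(\<open>nn_integral_orthonormal_le\<close>).  Used in one argument after the other, this bounds the squared
Hilbert--Schmidt norm of an \<open>n\<close>-linear functional after composition by \<open>D\<^sup>2\<^sup>n\<close> times the old one, for
any \<open>D \<ge> 1\<close> with \<open>\<parallel>A\<parallel> \<le> D\<close> (\<open>sqnorm_comp_le\<close>).  Since \<open>P\<^sub>q\<close> only permutes arguments, it
commutes with this composition, and growth stays exponential (\<open>exp_bounded_restrict\<close>).

Quotient.  Two representatives are identified when their pairings agree on tuples from a smaller
\<open>\<H>\<^sub>\<rho>\<close>.  Agreement is pointwise, so it passes to still smaller spaces and is respected by sums,
multiples and products; this makes the relation an equivalence and the operations well defined
(\<open>cls_operation\<close>).  As any three classes have representatives over one index, the
identities between sequences become the axioms.\<close>

section \<open>Inversions and the operator \<open>P\<^sub>q\<close> of a tensor product\<close>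

text \<open>Permutations are written as lists of their values, since a list can be cut into the part that is
fed to the left factor of a tensor product and the part that is fed to the right factor.\<close>

fun list_inversions :: "nat list \<Rightarrow> nat" where
  "list_inversions [] = 0"
| "list_inversions (x # l) = card {y \<in> set l. y < x} + list_inversions l"

lemma list_inversions_append:
  assumes "distinct (l1 @ l2)"
  shows "list_inversions (l1 @ l2) =
    list_inversions l1 + list_inversions l2 + (\<Sum>x\<in>set l1. card {y \<in> set l2. y < x})"
  using assms
proof (induction l1)
  case (Cons x l1)
  have "{y \<in> set (l1 @ l2). y < x} = {y \<in> set l1. y < x} \<union> {y \<in> set l2. y < x}"
    by auto
  moreover have "card ({y \<in> set l1. y < x} \<union> {y \<in> set l2. y < x}) =
      card {y \<in> set l1. y < x} + card {y \<in> set l2. y < x}"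
    using Cons.prems by (intro card_Un_disjoint) auto
  ultimately show ?case
    using Cons by simp
qed simp

lemma list_inversions_map_strict_mono:
  assumes "strict_mono_on (set l) f"
  shows "list_inversions (map f l) = list_inversions l"
  using assms
proof (induction l)
  case (Cons x l)
  have less: "f y < f x \<longleftrightarrow> y < x" if "y \<in> set l" for y
    using Cons.prems that strict_mono_on_less[OF Cons.prems, of y x] by simp
  have "{y \<in> f ` set l. y < f x} = f ` {y \<in> set l. y < x}"
    using less by auto
  moreover have "inj_on f {y \<in> set l. y < x}"
    by (rule inj_on_subset[OF strict_mono_on_imp_inj_on[OF Cons.prems]]) auto
  moreover have "list_inversions (map f l) = list_inversions l"
    using Cons by (intro Cons.IH) (auto simp: strict_mono_on_def)
  ultimately show ?case
    by (simp add: card_image)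
qed simp

lemma inversions_eq_list_inversions:
  assumes "inj_on \<pi> {..<n}"
  shows "inversions n \<pi> = list_inversions (map \<pi> [0..<n])"
  using assms
proof (induction n)
  case (Suc n)
  have inj: "inj_on \<pi> {..<n}"
    using Suc.prems by (rule inj_on_subset) auto
  let ?I = "{(i, j). i < j \<and> j < n \<and> \<pi> j < \<pi> i}"
  let ?J = "(\<lambda>i. (i, n)) ` {i \<in> {..<n}. \<pi> n < \<pi> i}"
  have "{(i, j). i < j \<and> j < Suc n \<and> \<pi> j < \<pi> i} = ?I \<union> ?J"
    by (auto simp: less_Suc_eq)
  moreover have "finite ?I"
    by (rule finite_subset[of _ "{..<n} \<times> {..<n}"]) auto
  then have "card (?I \<union> ?J) = card ?I + card ?J"
    by (intro card_Un_disjoint) auto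
  moreover have "card ?J = card {i \<in> {..<n}. \<pi> n < \<pi> i}"
    by (rule card_image) (simp add: inj_on_def)
  ultimately have "inversions (Suc n) \<pi> = inversions n \<pi> + card {i \<in> {..<n}. \<pi> n < \<pi> i}"
    by (simp add: inversions_def)
  moreover have "(\<Sum>x\<in>\<pi> ` {..<n}. card {y \<in> {\<pi> n}. y < x}) = (\<Sum>i<n. if \<pi> n < \<pi> i then 1 else 0)"
  proof (subst sum.reindex[OF inj], rule sum.cong[OF refl])
    fix i
    have "{y \<in> {\<pi> n}. y < \<pi> i} = (if \<pi> n < \<pi> i then {\<pi> n} else {})"
      by auto
    then show "((\<lambda>x. card {y \<in> {\<pi> n}. y < x}) \<circ> \<pi>) i = (if \<pi> n < \<pi> i then 1 else 0)"
      by simp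
  qed
  moreover have "(\<Sum>i<n. if \<pi> n < \<pi> i then 1 else 0) = card {i \<in> {..<n}. \<pi> n < \<pi> i}"
    by (simp add: sum.If_cases Int_def)
  moreover have "distinct (map \<pi> [0..<n] @ [\<pi> n])"
    using Suc.prems distinct_map[of \<pi> "[0..<Suc n]"] by (simp add: atLeast0LessThan lessThan_Suc)
  then have "list_inversions (map \<pi> [0..<n] @ [\<pi> n]) =
      list_inversions (map \<pi> [0..<n]) + (\<Sum>x\<in>\<pi> ` {..<n}. card {y \<in> {\<pi> n}. y < x})"
    by (subst list_inversions_append) (auto simp: atLeast0LessThan)
  ultimately show ?case
    using Suc.IH[OF inj] by simp
qed (simp add: inversions_def)

text \<open>Exchanging the roles of positions and values maps the inversions of a permutation to those of its
inverse.  It lets \<^const>\<open>Pq\<close>, whose arguments are permuted by inverses, be written as a sum over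
the permutations themselves.\<close>

lemma inversions_inv:
  assumes "\<pi> permutes {..<n}"
  shows "inversions n (Hilbert_Choice.inv \<pi>) = inversions n \<pi>"
proof -
  let ?\<rho> = "Hilbert_Choice.inv \<pi>"
  have inverse: "\<pi> (?\<rho> x) = x" "?\<rho> (\<pi> x) = x" for x
    by (rule permutes_inverses[OF assms])+
  have bound: "\<pi> x < n \<longleftrightarrow> x < n" "?\<rho> x < n \<longleftrightarrow> x < n" for x
    using permutes_in_image[OF assms, of x] permutes_in_image[OF permutes_inv[OF assms], of x] by simp_all
  have "bij_betw (\<lambda>(i, j). (\<pi> j, \<pi> i)) {(i, j). i < j \<and> j < n \<and> \<pi> j < \<pi> i}
      {(i, j). i < j \<and> j < n \<and> ?\<rho> j < ?\<rho> i}"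
  proof (rule bij_betw_byWitness[where f' = "\<lambda>(i, j). (?\<rho> j, ?\<rho> i)"])
    show "\<forall>a\<in>{(i, j). i < j \<and> j < n \<and> \<pi> j < \<pi> i}.
        (case (case a of (i, j) \<Rightarrow> (\<pi> j, \<pi> i)) of (i, j) \<Rightarrow> (?\<rho> j, ?\<rho> i)) = a"
      by (simp add: inverse split: prod.split)
    show "\<forall>a\<in>{(i, j). i < j \<and> j < n \<and> ?\<rho> j < ?\<rho> i}.
        (case (case a of (i, j) \<Rightarrow> (?\<rho> j, ?\<rho> i)) of (i, j) \<Rightarrow> (\<pi> j, \<pi> i)) = a"
      by (simp add: inverse split: prod.split)
    show "(\<lambda>(i, j). (\<pi> j, \<pi> i)) ` {(i, j). i < j \<and> j < n \<and> \<pi> j < \<pi> i} \<subseteq>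
        {(i, j). i < j \<and> j < n \<and> ?\<rho> j < ?\<rho> i}"
      by (rule image_subsetI) (clarsimp simp: inverse bound)
    show "(\<lambda>(i, j). (?\<rho> j, ?\<rho> i)) ` {(i, j). i < j \<and> j < n \<and> ?\<rho> j < ?\<rho> i} \<subseteq>
        {(i, j). i < j \<and> j < n \<and> \<pi> j < \<pi> i}"
      by (rule image_subsetI) (clarsimp simp: inverse bound)
  qed
  then show ?thesis
    unfolding inversions_def by (rule bij_betw_same_card[symmetric])
qed

lemma bij_betw_permutes_permutations_of_set:
  "bij_betw (\<lambda>\<pi>. map \<pi> [0..<n]) {\<pi>. \<pi> permutes {..<n}} (permutations_of_set {..<n})"
proof -
  have "inj_on (\<lambda>\<pi>. map \<pi> [0..<n]) {\<pi>. \<pi> permutes {..<n}}"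
  proof (rule inj_onI, rule ext)
    fix \<pi> \<rho> x
    assume "\<pi> \<in> {\<pi>. \<pi> permutes {..<n}}" "\<rho> \<in> {\<pi>. \<pi> permutes {..<n}}" "map \<pi> [0..<n] = map \<rho> [0..<n]"
    then show "\<pi> x = \<rho> x"
      by (cases "x < n") (auto simp: permutes_not_in)
  qed
  moreover have "map \<pi> [0..<n] \<in> permutations_of_set {..<n}" if "\<pi> permutes {..<n}" for \<pi>
    using permutes_image[OF that] permutes_inj_on[OF that]
    by (simp add: permutations_of_set_def distinct_map atLeast0LessThan)
  then have "(\<lambda>\<pi>. map \<pi> [0..<n]) ` {\<pi>. \<pi> permutes {..<n}} \<subseteq> permutations_of_set {..<n}"
    by blast
  moreover from calculation have "card ((\<lambda>\<pi>. map \<pi> [0..<n]) ` {\<pi>. \<pi> permutes {..<n}}) = card (permutations_of_set {..<n})"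
    by (simp add: card_image card_permutations[of "{..<n}" n])
  ultimately show ?thesis
    by (simp add: bij_betw_def card_subset_eq)
qed

lemma Pq_eq_sum_lists:
  assumes "length xs = n"
  shows "Pq q n f xs =
    (\<Sum>l\<in>permutations_of_set {..<n}. q ^ list_inversions l * f (map ((!) xs) l))"
proof -
  have "Pq q n f xs = (\<Sum>\<pi> | \<pi> permutes {..<n}. q ^ inversions n \<pi> * f (permute_list \<pi> xs))"
    unfolding Pq_def
    by (subst sum_permutations_inverse, rule sum.cong) (auto simp: inversions_inv inv_inv_eq permutes_bij)
  also have "\<dots> = (\<Sum>\<pi> | \<pi> permutes {..<n}.
      q ^ list_inversions (map \<pi> [0..<n]) * f (map ((!) xs) (map \<pi> [0..<n])))"
    by (rule sum.cong)
      (auto simp: inversions_eq_list_inversions permutes_inj_on permute_list_def assms o_def)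
  also have "\<dots> = (\<Sum>l\<in>permutations_of_set {..<n}. q ^ list_inversions l * f (map ((!) xs) l))"
    using sum.reindex_bij_betw[OF bij_betw_permutes_permutations_of_set,
        where g = "\<lambda>l. q ^ list_inversions l * f (map ((!) xs) l)"] .
  finally show ?thesis .
qed

text \<open>A list of the elements of \<open>S\<close> is determined by the set of its first \<open>i\<close> entries together with the
orders of these and of the remaining ones.\<close>

lemma sum_permutations_of_set_split:
  assumes "finite S" "i \<le> card S"
  shows "(\<Sum>l\<in>permutations_of_set S. h l) =
    (\<Sum>A | A \<subseteq> S \<and> card A = i. \<Sum>l1\<in>permutations_of_set A. \<Sum>l2\<in>permutations_of_set (S - A). h (l1 @ l2))"
proof -
  have fin: "finite {A. A \<subseteq> S \<and> card A = i}"
    using assms(1) by auto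
  have "(\<Sum>A | A \<subseteq> S \<and> card A = i. \<Sum>l1\<in>permutations_of_set A. \<Sum>l2\<in>permutations_of_set (S - A). h (l1 @ l2)) =
    (\<Sum>(A, l1, l2)\<in>Sigma {A. A \<subseteq> S \<and> card A = i}
       (\<lambda>A. permutations_of_set A \<times> permutations_of_set (S - A)). h (l1 @ l2))"
    by (simp add: sum.cartesian_product sum.Sigma[OF fin] case_prod_unfold)
  also have "\<dots> = (\<Sum>l\<in>permutations_of_set S. h l)"
  proof (rule sum.reindex_bij_witness
      [of _ "\<lambda>l. (set (take i l), take i l, drop i l)" "\<lambda>(A, l1, l2). l1 @ l2"])
    fix l assume "l \<in> permutations_of_set S"
    then have l: "set l = S" "distinct l" "length l = card S"
      by (auto simp: permutations_of_set_def distinct_card)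
    have "set (take i l) \<inter> set (drop i l) = {}"
      using l by (simp add: set_take_disj_set_drop_if_distinct)
    moreover have "set (take i l) \<union> set (drop i l) = S"
      using l by (metis append_take_drop_id set_append)
    ultimately have "S - set (take i l) = set (drop i l)"
      by auto
    moreover have "card (set (take i l)) = i"
      using l assms by (simp add: distinct_card)
    ultimately show "(set (take i l), take i l, drop i l) \<in> Sigma {A. A \<subseteq> S \<and> card A = i}
        (\<lambda>A. permutations_of_set A \<times> permutations_of_set (S - A))"
      using l by (auto simp: permutations_of_set_def dest: in_set_takeD)
  qed (use assms in \<open>auto simp: permutations_of_set_def length_finite_permutations_of_set distinct_card[symmetric]\<close>)
  finally show ?thesis ..
qed

text \<open>The increasing enumeration of \<open>A\<close> turns orderings of \<open>A\<close> into orderings of an initial segment of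
the natural numbers and preserves inversions, so a sum over the orderings of \<open>A\<close> is \<^const>\<open>Pq\<close>
evaluated at the subtuple indexed by \<open>A\<close>.\<close>

lemma sum_permutations_of_set_eq_Pq:
  assumes "finite A"
  shows "(\<Sum>l\<in>permutations_of_set A. q ^ list_inversions l * f (map ((!) xs) l)) =
    Pq q (card A) f (map ((!) xs) (sorted_list_of_set A))"
proof -
  let ?s = "sorted_list_of_set A"
  have len: "length ?s = card A"
    using assms by simp
  have mono: "strict_mono_on {..<card A} ((!) ?s)"
    using assms sorted_wrt_nth_less[OF strict_sorted_list_of_set[of A]]
    by (auto intro!: strict_mono_onI)
  have img: "(!) ?s ` {..<card A} = A"
    using assms by (metis atLeast0LessThan len map_nth set_map set_sorted_list_of_set set_upt)
  have "(\<Sum>l\<in>permutations_of_set A. q ^ list_inversions l * f (map ((!) xs) l)) =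
      (\<Sum>l\<in>map ((!) ?s) ` permutations_of_set {..<card A}. q ^ list_inversions l * f (map ((!) xs) l))"
    using permutations_of_set_image_inj[OF strict_mono_on_imp_inj_on[OF mono]] img by simp
  also have "\<dots> = (\<Sum>l\<in>permutations_of_set {..<card A}.
      q ^ list_inversions (map ((!) ?s) l) * f (map ((!) xs) (map ((!) ?s) l)))"
    by (subst sum.reindex)
      (auto simp: o_def intro!: inj_on_mapI strict_mono_on_imp_inj_on[OF mono])
  also have "\<dots> = (\<Sum>l\<in>permutations_of_set {..<card A}.
      q ^ list_inversions l * f (map ((!) (map ((!) xs) ?s)) l))"
  proof (rule sum.cong[OF refl])
    fix l assume "l \<in> permutations_of_set {..<card A}"
    then have l: "set l = {..<card A}"
      by (simp add: permutations_of_set_def)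
    have "list_inversions (map ((!) ?s) l) = list_inversions l"
      by (rule list_inversions_map_strict_mono) (simp add: l mono)
    moreover have "map ((!) xs) (map ((!) ?s) l) = map ((!) (map ((!) xs) ?s)) l"
      using l by (auto simp: len)
    ultimately show "q ^ list_inversions (map ((!) ?s) l) * f (map ((!) xs) (map ((!) ?s) l)) =
        q ^ list_inversions l * f (map ((!) (map ((!) xs) ?s)) l)"
      by (simp only:)
  qed
  also have "\<dots> = Pq q (card A) f (map ((!) xs) ?s)"
    by (subst Pq_eq_sum_lists) (simp_all add: len)
  finally show ?thesis .
qed

text \<open>The factorisation behind the product estimate: the pairs with one entry in each part of \<open>l1 @ l2\<close>
form an inversion independently of the order inside the parts, so their contribution can be taken out
of the sum over orderings, which then splits into a product.\<close>

lemma Pq_tensor: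
  assumes "length xs = i + m"
  shows "Pq q (i + m) (\<lambda>xs. f (take i xs) * g (drop i xs)) xs =
    (\<Sum>A | A \<subseteq> {..<i + m} \<and> card A = i.
       q ^ (\<Sum>x\<in>A. card {y \<in> {..<i + m} - A. y < x}) *
       (Pq q i f (map ((!) xs) (sorted_list_of_set A)) *
        Pq q m g (map ((!) xs) (sorted_list_of_set ({..<i + m} - A)))))"
proof -
  let ?S = "{..<i + m}"
  have "Pq q (i + m) (\<lambda>xs. f (take i xs) * g (drop i xs)) xs =
    (\<Sum>A | A \<subseteq> ?S \<and> card A = i. \<Sum>l1\<in>permutations_of_set A. \<Sum>l2\<in>permutations_of_set (?S - A).
      q ^ list_inversions (l1 @ l2) *
      (f (take i (map ((!) xs) (l1 @ l2))) * g (drop i (map ((!) xs) (l1 @ l2)))))"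
    unfolding Pq_eq_sum_lists[OF assms]
    by (rule sum_permutations_of_set_split) auto
  also have "\<dots> = (\<Sum>A | A \<subseteq> ?S \<and> card A = i. q ^ (\<Sum>x\<in>A. card {y \<in> ?S - A. y < x}) *
      ((\<Sum>l1\<in>permutations_of_set A. q ^ list_inversions l1 * f (map ((!) xs) l1)) *
       (\<Sum>l2\<in>permutations_of_set (?S - A). q ^ list_inversions l2 * g (map ((!) xs) l2))))"
  proof (rule sum.cong[OF refl])
    fix A assume A: "A \<in> {A. A \<subseteq> ?S \<and> card A = i}"
    have "q ^ list_inversions (l1 @ l2) *
        (f (take i (map ((!) xs) (l1 @ l2))) * g (drop i (map ((!) xs) (l1 @ l2)))) =
      q ^ (\<Sum>x\<in>A. card {y \<in> ?S - A. y < x}) *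
        ((q ^ list_inversions l1 * f (map ((!) xs) l1)) * (q ^ list_inversions l2 * g (map ((!) xs) l2)))"
      if "l1 \<in> permutations_of_set A" "l2 \<in> permutations_of_set (?S - A)" for l1 l2
    proof -
      have l: "set l1 = A" "distinct l1" "set l2 = ?S - A" "distinct l2" "length l1 = i"
        using that A by (auto simp: permutations_of_set_def distinct_card[symmetric])
      then have "list_inversions (l1 @ l2) =
          list_inversions l1 + list_inversions l2 + (\<Sum>x\<in>A. card {y \<in> ?S - A. y < x})"
        by (subst list_inversions_append) auto
      then show ?thesis
        using l by (simp add: power_add)
    qed
    then show "(\<Sum>l1\<in>permutations_of_set A. \<Sum>l2\<in>permutations_of_set (?S - A).
        q ^ list_inversions (l1 @ l2) *
        (f (take i (map ((!) xs) (l1 @ l2))) * g (drop i (map ((!) xs) (l1 @ l2))))) =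
      q ^ (\<Sum>x\<in>A. card {y \<in> ?S - A. y < x}) *
      ((\<Sum>l1\<in>permutations_of_set A. q ^ list_inversions l1 * f (map ((!) xs) l1)) *
       (\<Sum>l2\<in>permutations_of_set (?S - A). q ^ list_inversions l2 * g (map ((!) xs) l2)))"
      unfolding sum_product by (simp only: sum_distrib_left cong: sum.cong)
  qed
  also have "\<dots> = (\<Sum>A | A \<subseteq> ?S \<and> card A = i.
       q ^ (\<Sum>x\<in>A. card {y \<in> ?S - A. y < x}) *
       (Pq q i f (map ((!) xs) (sorted_list_of_set A)) *
        Pq q m g (map ((!) xs) (sorted_list_of_set (?S - A)))))"
  proof (rule sum.cong[OF refl])
    fix A assume "A \<in> {A. A \<subseteq> ?S \<and> card A = i}"
    then have "finite A" "card A = i" "card (?S - A) = m"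
      by (auto simp: card_Diff_subset finite_subset)
    then show "q ^ (\<Sum>x\<in>A. card {y \<in> ?S - A. y < x}) *
      ((\<Sum>l1\<in>permutations_of_set A. q ^ list_inversions l1 * f (map ((!) xs) l1)) *
       (\<Sum>l2\<in>permutations_of_set (?S - A). q ^ list_inversions l2 * g (map ((!) xs) l2))) =
      q ^ (\<Sum>x\<in>A. card {y \<in> ?S - A. y < x}) *
       (Pq q i f (map ((!) xs) (sorted_list_of_set A)) *
        Pq q m g (map ((!) xs) (sorted_list_of_set (?S - A))))"
      by (simp add: sum_permutations_of_set_eq_Pq)
  qed
  finally show ?thesis .
qed

section \<open>Sums of squares over tuples\<close>

lemma nn_integral_count_space_prod:
  fixes f :: "'a \<Rightarrow> 'b \<Rightarrow> ennreal"
  shows "(\<integral>\<^sup>+x. \<integral>\<^sup>+y. f x y \<partial>count_space B \<partial>count_space A) =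
    (\<integral>\<^sup>+z. f (fst z) (snd z) \<partial>count_space (A \<times> B))"
proof -
  have "(\<integral>\<^sup>+x. \<integral>\<^sup>+y. f x y \<partial>count_space B \<partial>count_space A) =
      (\<integral>\<^sup>+x. (\<integral>\<^sup>+y. f x y * indicator B y \<partial>count_space UNIV) * indicator A x \<partial>count_space UNIV)"
    by (simp only: nn_integral_count_space_indicator[of A] nn_integral_count_space_indicator[of B]
        NO_MATCH_def)
  also have "\<dots> = (\<integral>\<^sup>+x. \<integral>\<^sup>+y. f x y * indicator B y * indicator A x \<partial>count_space UNIV \<partial>count_space UNIV)"
    by (simp add: nn_integral_multc)
  also have "\<dots> = (\<integral>\<^sup>+x. \<integral>\<^sup>+y. (\<lambda>z. f (fst z) (snd z) * indicator (A \<times> B) z) (x, y)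
      \<partial>count_space UNIV \<partial>count_space UNIV)"
    by (intro nn_integral_cong) (auto split: split_indicator)
  also have "\<dots> = (\<integral>\<^sup>+z. f (fst z) (snd z) * indicator (A \<times> B) z \<partial>count_space UNIV)"
    by (rule nn_integral_fst_count_space)
  also have "\<dots> = (\<integral>\<^sup>+z. f (fst z) (snd z) \<partial>count_space (A \<times> B))"
    by (simp only: nn_integral_count_space_indicator[of "A \<times> B"] NO_MATCH_def)
  finally show ?thesis .
qed

lemma nn_integral_count_space_swap:
  fixes f :: "'a \<Rightarrow> 'b \<Rightarrow> ennreal"
  shows "(\<integral>\<^sup>+x. \<integral>\<^sup>+y. f x y \<partial>count_space B \<partial>count_space A) =
    (\<integral>\<^sup>+y. \<integral>\<^sup>+x. f x y \<partial>count_space A \<partial>count_space B)"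
proof -
  have "(\<integral>\<^sup>+z. f (snd z) (fst z) \<partial>count_space (B \<times> A)) =
      (\<integral>\<^sup>+z. f (snd (prod.swap z)) (fst (prod.swap z)) \<partial>count_space (A \<times> B))"
    by (rule nn_integral_bij_count_space[symmetric]) (auto simp: bij_betw_def)
  then show ?thesis
    by (simp add: nn_integral_count_space_prod)
qed

lemma nn_integral_count_space_inj_le:
  fixes f :: "'b \<Rightarrow> ennreal"
  assumes "inj_on g A" "g ` A \<subseteq> B"
  shows "(\<integral>\<^sup>+x. f (g x) \<partial>count_space A) \<le> (\<integral>\<^sup>+y. f y \<partial>count_space B)"
proof -
  have "(\<integral>\<^sup>+x. f (g x) \<partial>count_space A) = (\<integral>\<^sup>+y. f y \<partial>count_space (g ` A))"
    using assms(1) by (intro nn_integral_bij_count_space) (simp add: bij_betw_def)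
  also have "\<dots> = (\<integral>\<^sup>+y. f y * indicator (g ` A) y \<partial>count_space B)"
    using assms(2) by (simp add: nn_integral_restrict_space[symmetric] restrict_count_space Int_absorb2)
  also have "\<dots> \<le> (\<integral>\<^sup>+y. f y \<partial>count_space B)"
    by (intro nn_integral_mono) (simp split: split_indicator)
  finally show ?thesis .
qed

text \<open>The squared Hilbert--Schmidt norm, as an extended nonnegative number: it is defined for every function,
and sums may be exchanged and multiplied without summability conditions.\<close>

definition sqnorm :: "'v set \<Rightarrow> nat \<Rightarrow> ('v list \<Rightarrow> real) \<Rightarrow> ennreal" where
  "sqnorm B n f = (\<integral>\<^sup>+xs. ennreal ((f xs)\<^sup>2) \<partial>count_space (tuples B n))"

lemma summable_on_iff_nn_integral:
  fixes f :: "'a \<Rightarrow> real"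
  assumes "\<And>x. 0 \<le> f x"
  shows "f summable_on A \<longleftrightarrow> (\<integral>\<^sup>+x. ennreal (f x) \<partial>count_space A) < \<infinity>"
    and "f summable_on A \<Longrightarrow> (\<integral>\<^sup>+x. ennreal (f x) \<partial>count_space A) = ennreal (infsum f A)"
proof -
  have eq: "f summable_on A \<longleftrightarrow> Infinite_Set_Sum.abs_summable_on f A"
    using assms by (simp add: abs_summable_equivalent[symmetric])
  then show "f summable_on A \<longleftrightarrow> (\<integral>\<^sup>+x. ennreal (f x) \<partial>count_space A) < \<infinity>"
    using assms by (simp add: Infinite_Set_Sum.abs_summable_on_def integrable_iff_bounded)
  show "(\<integral>\<^sup>+x. ennreal (f x) \<partial>count_space A) = ennreal (infsum f A)" if "f summable_on A"
    using that assms eq by (simp add: nn_integral_conv_infsetsum infsetsum_infsum)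
qed

lemma summable_iff_sqnorm:
  "(\<lambda>xs. (f xs)\<^sup>2) summable_on tuples B n \<longleftrightarrow> sqnorm B n f < \<infinity>"
  unfolding sqnorm_def by (rule summable_on_iff_nn_integral) simp

lemma sqnorm_eq_infsum:
  assumes "sqnorm B n f < \<infinity>"
  shows "sqnorm B n f = ennreal (\<Sum>\<^sub>\<infinity>xs\<in>tuples B n. (f xs)\<^sup>2)"
proof -
  have "(\<lambda>xs. (f xs)\<^sup>2) summable_on tuples B n"
    using assms by (simp only: summable_iff_sqnorm)
  then show ?thesis
    unfolding sqnorm_def by (intro summable_on_iff_nn_integral(2)) auto
qed

lemma sqnorm_cong:
  "(\<And>xs. xs \<in> tuples B n \<Longrightarrow> f xs = g xs) \<Longrightarrow> sqnorm B n f = sqnorm B n g"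
  unfolding sqnorm_def by (rule nn_integral_cong) simp

lemma tuples_0: "tuples B 0 = {[]}"
  by (auto simp: tuples_def)

lemma sqnorm_0: "sqnorm B 0 f = ennreal ((f [])\<^sup>2)"
  by (simp add: sqnorm_def tuples_0 nn_integral_count_space_finite)

lemma sqnorm_Suc:
  "sqnorm B (Suc n) f = (\<integral>\<^sup>+b. sqnorm B n (\<lambda>xs. f (b # xs)) \<partial>count_space B)"
proof -
  have "bij_betw (\<lambda>z. fst z # snd z) (B \<times> tuples B n) (tuples B (Suc n))"
    by (rule bij_betw_byWitness[where f' = "\<lambda>xs. (hd xs, tl xs)"])
      (auto simp: tuples_def length_Suc_conv)
  then show ?thesis
    unfolding sqnorm_def nn_integral_count_space_prod
    by (rule nn_integral_bij_count_space[symmetric])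
qed

lemma sqnorm_scale: "sqnorm B n (\<lambda>xs. c * f xs) = ennreal (c\<^sup>2) * sqnorm B n f"
  by (simp add: sqnorm_def power_mult_distrib ennreal_mult nn_integral_cmult)

lemma sqnorm_sum_le:
  assumes "finite I"
  shows "sqnorm B n (\<lambda>xs. \<Sum>i\<in>I. f i xs) \<le> of_nat (card I) * (\<Sum>i\<in>I. sqnorm B n (f i))"
proof -
  have "ennreal ((\<Sum>i\<in>I. f i xs)\<^sup>2) \<le> of_nat (card I) * (\<Sum>i\<in>I. ennreal ((f i xs)\<^sup>2))" for xs
  proof -
    have "ennreal ((\<Sum>i\<in>I. f i xs)\<^sup>2) \<le> ennreal (real (card I) * (\<Sum>i\<in>I. (f i xs)\<^sup>2))"
      using sum_squared_le_sum_of_squares[of "\<lambda>i. f i xs" I]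
      by (intro ennreal_leI) (simp add: mult.commute)
    then show ?thesis
      by (simp add: ennreal_mult sum_nonneg ennreal_of_nat_eq_real_of_nat)
  qed
  then have "sqnorm B n (\<lambda>xs. \<Sum>i\<in>I. f i xs) \<le>
      (\<integral>\<^sup>+xs. of_nat (card I) * (\<Sum>i\<in>I. ennreal ((f i xs)\<^sup>2)) \<partial>count_space (tuples B n))"
    unfolding sqnorm_def by (rule nn_integral_mono)
  also have "\<dots> = of_nat (card I) * (\<Sum>i\<in>I. sqnorm B n (f i))"
    using assms by (simp add: sqnorm_def nn_integral_cmult nn_integral_sum del: sum_ennreal)
  finally show ?thesis .
qed

lemma sqnorm_add_le: "sqnorm B n (\<lambda>xs. f xs + g xs) \<le> 2 * (sqnorm B n f + sqnorm B n g)"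
  using sqnorm_sum_le[of UNIV B n "\<lambda>b. if b then f else g"] by (simp add: UNIV_bool add.commute)

lemma map_nth_mem_tuples:
  assumes "xs \<in> tuples B n" "set l \<subseteq> {..<n}"
  shows "map ((!) xs) l \<in> tuples B (length l)"
proof -
  have "xs ! j \<in> B" if "j \<in> set l" for j
  proof -
    have "j < length xs"
      using assms that by (auto simp: tuples_def)
    then show ?thesis
      using assms(1) nth_mem[of j xs] by (auto simp: tuples_def)
  qed
  then show ?thesis
    by (auto simp: tuples_def)
qed

lemma sqnorm_permute_le:
  assumes "l \<in> permutations_of_set {..<n}"
  shows "sqnorm B n (\<lambda>xs. f (map ((!) xs) l)) \<le> sqnorm B n f"
  unfolding sqnorm_def
proof (rule nn_integral_count_space_inj_le[of "\<lambda>xs. map ((!) xs) l" _ _ "\<lambda>xs. ennreal ((f xs)\<^sup>2)"])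
  have l: "set l = {..<n}" "length l = n"
    using assms by (auto simp: permutations_of_set_def distinct_card[symmetric])
  show "inj_on (\<lambda>xs. map ((!) xs) l) (tuples B n)"
    using l by (intro inj_onI nth_equalityI) (auto simp: tuples_def)
  show "(\<lambda>xs. map ((!) xs) l) ` tuples B n \<subseteq> tuples B n"
    using l map_nth_mem_tuples[of _ B n l] by auto
qed

lemma sqnorm_Pq_finite:
  assumes "sqnorm B n f < \<infinity>"
  shows "sqnorm B n (Pq q n f) < \<infinity>"
proof -
  have "sqnorm B n (Pq q n f) =
      sqnorm B n (\<lambda>xs. \<Sum>l\<in>permutations_of_set {..<n}. q ^ list_inversions l * f (map ((!) xs) l))"
    by (rule sqnorm_cong, rule Pq_eq_sum_lists) (simp add: tuples_def)
  also have "\<dots> \<le> of_nat (card (permutations_of_set {..<n})) *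
      (\<Sum>l\<in>permutations_of_set {..<n}. sqnorm B n (\<lambda>xs. q ^ list_inversions l * f (map ((!) xs) l)))"
    by (rule sqnorm_sum_le) simp
  also have "\<dots> < \<infinity>"
  proof -
    have "sqnorm B n (\<lambda>xs. q ^ list_inversions l * f (map ((!) xs) l)) < \<infinity>"
      if "l \<in> permutations_of_set {..<n}" for l
    proof -
      have "sqnorm B n (\<lambda>xs. f (map ((!) xs) l)) < \<infinity>"
        using sqnorm_permute_le[OF that, of B f] assms by (simp add: le_less_trans)
      then show ?thesis
        by (simp add: sqnorm_scale ennreal_mult_less_top)
    qed
    then show ?thesis
      by (simp add: ennreal_mult_less_top of_nat_less_top del: card_permutations_of_set)
  qed
  finally show ?thesis .
qed

text \<open>A tuple is determined by its subtuples along \<open>A\<close> and along the complement, so the sum on the left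
is a part of the product of the two sums on the right.\<close>

lemma sqnorm_split_le:
  fixes u v :: "'v list \<Rightarrow> real"
  assumes "A \<subseteq> {..<i + m}" "card A = i"
  shows "sqnorm B (i + m) (\<lambda>xs. u (map ((!) xs) (sorted_list_of_set A)) *
      v (map ((!) xs) (sorted_list_of_set ({..<i + m} - A)))) \<le> sqnorm B i u * sqnorm B m v"
proof -
  let ?C = "{..<i + m} - A"
  let ?l1 = "sorted_list_of_set A" and ?l2 = "sorted_list_of_set ?C"
  have fin: "finite A"
    using assms(1) finite_subset by blast
  have l: "set ?l1 = A" "length ?l1 = i" "set ?l2 = ?C" "length ?l2 = m"
    using assms fin by (auto simp: card_Diff_subset)
  let ?g = "\<lambda>xs::'v list. (map ((!) xs) ?l1, map ((!) xs) ?l2)"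
  let ?h = "\<lambda>z. ennreal ((u (fst z))\<^sup>2) * ennreal ((v (snd z))\<^sup>2)"
  have "(\<integral>\<^sup>+xs. ?h (?g xs) \<partial>count_space (tuples B (i + m))) \<le>
      (\<integral>\<^sup>+z. ?h z \<partial>count_space (tuples B i \<times> tuples B m))"
  proof (rule nn_integral_count_space_inj_le)
    show "inj_on ?g (tuples B (i + m))"
    proof (intro inj_onI nth_equalityI)
      fix xs ys j
      assume xs: "xs \<in> tuples B (i + m)" "ys \<in> tuples B (i + m)" "?g xs = ?g ys" "j < length xs"
      then have "j \<in> A \<or> j \<in> ?C"
        by (auto simp: tuples_def)
      then show "xs ! j = ys ! j"
        using xs(3) l by auto
    qed (auto simp: tuples_def)
    show "?g ` tuples B (i + m) \<subseteq> tuples B i \<times> tuples B m"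
      using map_nth_mem_tuples[of _ B "i + m" ?l1] map_nth_mem_tuples[of _ B "i + m" ?l2] l assms
      by auto
  qed
  also have "\<dots> = (\<integral>\<^sup>+xs. \<integral>\<^sup>+ys. ennreal ((u xs)\<^sup>2) * ennreal ((v ys)\<^sup>2)
      \<partial>count_space (tuples B m) \<partial>count_space (tuples B i))"
    by (rule nn_integral_count_space_prod[symmetric])
  also have "\<dots> = sqnorm B i u * sqnorm B m v"
    by (simp add: sqnorm_def nn_integral_cmult nn_integral_multc)
  finally show ?thesis
    by (simp add: sqnorm_def power_mult_distrib ennreal_mult)
qed

text \<open>The factors of \<open>4\<^sup>n\<close> are the number of subsets of the places, once from the square of a sum and
once from the number of its summands; the coefficients are at most \<open>1\<close> in modulus.\<close>

lemma sqnorm_Pq_tensor_le: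
  assumes "\<bar>q\<bar> \<le> 1"
  shows "sqnorm B (i + m) (Pq q (i + m) (\<lambda>xs. f (take i xs) * g (drop i xs))) \<le>
    4 ^ (i + m) * (sqnorm B i (Pq q i f) * sqnorm B m (Pq q m g))"
proof -
  let ?S = "{..<i + m}" and ?I = "{A. A \<subseteq> {..<i + m} \<and> card A = i}"
  let ?N = "sqnorm B i (Pq q i f) * sqnorm B m (Pq q m g)"
  let ?t = "\<lambda>A xs. Pq q i f (map ((!) xs) (sorted_list_of_set A)) *
        Pq q m g (map ((!) xs) (sorted_list_of_set (?S - A)))"
  let ?c = "\<lambda>A. q ^ (\<Sum>x\<in>A. card {y \<in> ?S - A. y < x})"
  have "?I \<subseteq> Pow ?S"
    by auto
  then have "card ?I \<le> card (Pow ?S)"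
    by (intro card_mono) auto
  then have cI: "card ?I \<le> 2 ^ (i + m)"
    by (simp add: card_Pow)
  have fin: "finite ?I"
    by (rule finite_subset[OF \<open>?I \<subseteq> Pow ?S\<close>]) simp
  have "sqnorm B (i + m) (Pq q (i + m) (\<lambda>xs. f (take i xs) * g (drop i xs))) =
      sqnorm B (i + m) (\<lambda>xs. \<Sum>A\<in>?I. ?c A * ?t A xs)"
    by (rule sqnorm_cong, rule Pq_tensor) (simp add: tuples_def)
  also have "\<dots> \<le> of_nat (card ?I) * (\<Sum>A\<in>?I. sqnorm B (i + m) (\<lambda>xs. ?c A * ?t A xs))"
    by (rule sqnorm_sum_le[OF fin])
  also have "\<dots> \<le> of_nat (card ?I) * (\<Sum>A\<in>?I. ?N)"
  proof (intro mult_left_mono sum_mono)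
    fix A assume A: "A \<in> ?I"
    have "\<bar>?c A\<bar> \<le> 1"
      using assms by (simp add: power_abs power_le_one)
    then have "(?c A)\<^sup>2 \<le> 1"
      by (simp add: abs_square_le_1)
    then have "ennreal ((?c A)\<^sup>2) * sqnorm B (i + m) (?t A) \<le> 1 * sqnorm B (i + m) (?t A)"
      by (intro mult_right_mono) (auto simp: ennreal_le_1)
    also have "\<dots> \<le> ?N"
      using A by (simp add: sqnorm_split_le)
    finally show "sqnorm B (i + m) (\<lambda>xs. ?c A * ?t A xs) \<le> ?N"
      by (simp add: sqnorm_scale)
  qed simp
  also have "\<dots> = of_nat (card ?I * card ?I) * ?N"
    by (simp add: mult.assoc)
  also have "\<dots> \<le> of_nat (4 ^ (i + m)) * ?N"
  proof (intro mult_right_mono of_nat_mono)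
    have "card ?I * card ?I \<le> 2 ^ (i + m) * 2 ^ (i + m)"
      by (intro mult_mono cI) auto
    then show "card ?I * card ?I \<le> 4 ^ (i + m)"
      by (simp add: power_mult_distrib[symmetric])
  qed simp
  finally show ?thesis
    by simp
qed

section \<open>Inner products on a carrier, and orthonormal bases\<close>

locale prehilbert =
  fixes K :: "'v::real_vector hspace"
  assumes subspace: "subspace (hcar K)"
    and sym: "\<And>x y. x \<in> hcar K \<Longrightarrow> y \<in> hcar K \<Longrightarrow> hip K x y = hip K y x"
    and lin: "\<And>x y z a. x \<in> hcar K \<Longrightarrow> y \<in> hcar K \<Longrightarrow> z \<in> hcar K \<Longrightarrow>
      hip K (a *\<^sub>R x + y) z = a * hip K x z + hip K y z"
    and pos: "\<And>x. x \<in> hcar K \<Longrightarrow> x \<noteq> 0 \<Longrightarrow> hip K x x > 0"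
begin

lemma zero_mem [simp]: "0 \<in> hcar K"
  and add_mem [simp]: "x \<in> hcar K \<Longrightarrow> y \<in> hcar K \<Longrightarrow> x + y \<in> hcar K"
  and scale_mem [simp]: "x \<in> hcar K \<Longrightarrow> a *\<^sub>R x \<in> hcar K"
  and diff_mem [simp]: "x \<in> hcar K \<Longrightarrow> y \<in> hcar K \<Longrightarrow> x - y \<in> hcar K"
  and sum_mem: "(\<And>i. i \<in> I \<Longrightarrow> f i \<in> hcar K) \<Longrightarrow> sum f I \<in> hcar K"
  using subspace by (auto intro: subspace_0 subspace_add subspace_scale subspace_diff subspace_sum)

lemma hip_add_left:
  "x \<in> hcar K \<Longrightarrow> y \<in> hcar K \<Longrightarrow> z \<in> hcar K \<Longrightarrow> hip K (x + y) z = hip K x z + hip K y z"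
  using lin[of x y z 1] by simp

lemma hip_zero_left: "z \<in> hcar K \<Longrightarrow> hip K 0 z = 0"
  using hip_add_left[of 0 0 z] by simp

lemma hip_scale_left: "x \<in> hcar K \<Longrightarrow> z \<in> hcar K \<Longrightarrow> hip K (a *\<^sub>R x) z = a * hip K x z"
  using lin[of x 0 z a] hip_zero_left[of z] by simp

lemma hip_diff_left:
  "x \<in> hcar K \<Longrightarrow> y \<in> hcar K \<Longrightarrow> z \<in> hcar K \<Longrightarrow> hip K (x - y) z = hip K x z - hip K y z"
  using lin[of y x z "-1"] by simp

lemma hip_add_right:
  "x \<in> hcar K \<Longrightarrow> y \<in> hcar K \<Longrightarrow> z \<in> hcar K \<Longrightarrow> hip K z (x + y) = hip K z x + hip K z y"
  using hip_add_left[of x y z] by (simp add: sym[of z])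

lemma hip_scale_right: "x \<in> hcar K \<Longrightarrow> z \<in> hcar K \<Longrightarrow> hip K z (a *\<^sub>R x) = a * hip K z x"
  using hip_scale_left[of x z a] by (simp add: sym[of z])

lemma hip_diff_right:
  "x \<in> hcar K \<Longrightarrow> y \<in> hcar K \<Longrightarrow> z \<in> hcar K \<Longrightarrow> hip K z (x - y) = hip K z x - hip K z y"
  using hip_diff_left[of x y z] by (simp add: sym[of z])

lemmas hip_simps = hip_add_left hip_scale_left hip_diff_left hip_add_right hip_scale_right
  hip_diff_right

lemma hip_sum_left:
  assumes "\<And>i. i \<in> I \<Longrightarrow> f i \<in> hcar K" "z \<in> hcar K"
  shows "hip K (sum f I) z = (\<Sum>i\<in>I. hip K (f i) z)"
  using assms by (induction I rule: infinite_finite_induct)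
    (auto simp: hip_zero_left hip_add_left sum_mem)

lemma hip_nonneg: "x \<in> hcar K \<Longrightarrow> 0 \<le> hip K x x"
  using pos[of x] hip_zero_left[of 0] by (cases "x = 0") auto

lemma hnorm_sq: "x \<in> hcar K \<Longrightarrow> (hnorm K x)\<^sup>2 = hip K x x"
  by (simp add: hnorm_def hip_nonneg)

lemma hnorm_nonneg: "x \<in> hcar K \<Longrightarrow> 0 \<le> hnorm K x"
  by (simp add: hnorm_def hip_nonneg)

lemma cauchy_schwarz:
  assumes [simp]: "x \<in> hcar K" "y \<in> hcar K"
  shows "\<bar>hip K x y\<bar> \<le> hnorm K x * hnorm K y"
proof (cases "y = 0")
  case True
  then show ?thesis
    by (simp add: sym[of x 0] hip_zero_left hnorm_def)
next
  case False
  then have p: "hip K y y > 0"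
    by (simp add: pos)
  let ?t = "hip K x y / hip K y y"
  have "0 \<le> hip K (x - ?t *\<^sub>R y) (x - ?t *\<^sub>R y)"
    by (rule hip_nonneg) simp
  also have "\<dots> = hip K x x - (hip K x y)\<^sup>2 / hip K y y"
    using p by (simp add: hip_simps sym[of y x] power2_eq_square field_simps)
  finally have "(hip K x y)\<^sup>2 \<le> hip K x x * hip K y y"
    using p by (simp add: field_simps)
  then show ?thesis
    by (metis hnorm_def real_sqrt_abs real_sqrt_le_mono real_sqrt_mult)
qed

lemma hnorm_triangle:
  assumes [simp]: "x \<in> hcar K" "y \<in> hcar K"
  shows "hnorm K (x + y) \<le> hnorm K x + hnorm K y"
proof (rule power2_le_imp_le)
  have "(hnorm K (x + y))\<^sup>2 = (hnorm K x)\<^sup>2 + (hnorm K y)\<^sup>2 + 2 * hip K x y"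
    by (simp add: hnorm_sq hip_simps sym[of y x])
  also have "\<dots> \<le> (hnorm K x + hnorm K y)\<^sup>2"
    using cauchy_schwarz[of x y] by (simp add: power2_sum)
  finally show "(hnorm K (x + y))\<^sup>2 \<le> (hnorm K x + hnorm K y)\<^sup>2" .
qed (simp add: hnorm_nonneg)

lemma hnorm_scale: "x \<in> hcar K \<Longrightarrow> hnorm K (a *\<^sub>R x) = \<bar>a\<bar> * hnorm K x"
  by (simp add: hnorm_def hip_simps real_sqrt_mult mult.assoc[symmetric])

lemma hnorm_diff_commute: "x \<in> hcar K \<Longrightarrow> y \<in> hcar K \<Longrightarrow> hnorm K (x - y) = hnorm K (y - x)"
  using hnorm_scale[of "x - y" "-1"] by simp

end

lemma hilbert_space_imp_prehilbert: "hilbert_space K \<Longrightarrow> prehilbert K"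
  unfolding hilbert_space_def by unfold_locales blast+

definition orthonormal :: "'v hspace \<Rightarrow> 'v set \<Rightarrow> bool" where
  "orthonormal K B \<longleftrightarrow> B \<subseteq> hcar K \<and> (\<forall>x\<in>B. \<forall>y\<in>B. hip K x y = (if x = y then 1 else 0))"

lemma orthonormal_subset: "orthonormal K B \<Longrightarrow> t \<subseteq> B \<Longrightarrow> orthonormal K t"
  unfolding orthonormal_def by blast

lemma is_onb_iff: "is_onb K B \<longleftrightarrow> orthonormal K B \<and> dense_subset K (span B)"
  by (auto simp: is_onb_def orthonormal_def)

context prehilbert
begin

lemma hip_orthonormal_left:
  assumes B: "orthonormal K B" "finite B" and b: "b \<in> B"
  shows "hip K (\<Sum>i\<in>B. c i *\<^sub>R i) b = c b"
proof -
  have mem: "i \<in> hcar K" if "i \<in> B" for i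
    using that B by (auto simp: orthonormal_def)
  have "hip K (\<Sum>i\<in>B. c i *\<^sub>R i) b = (\<Sum>i\<in>B. c i * hip K i b)"
    using b mem by (subst hip_sum_left) (auto simp: hip_scale_left)
  also have "\<dots> = (\<Sum>i\<in>B. if i = b then c b else 0)"
    using B b by (intro sum.cong) (auto simp: orthonormal_def)
  finally show ?thesis
    using B b by simp
qed

lemma hip_orthonormal_sum:
  assumes B: "orthonormal K B" "finite B"
  shows "hip K (\<Sum>i\<in>B. c i *\<^sub>R i) (\<Sum>i\<in>B. c i *\<^sub>R i) = (\<Sum>i\<in>B. (c i)\<^sup>2)"
proof -
  have mem: "i \<in> hcar K" if "i \<in> B" for i
    using that B by (auto simp: orthonormal_def)
  let ?x = "\<Sum>i\<in>B. c i *\<^sub>R i"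
  have x: "?x \<in> hcar K"
    using mem by (intro sum_mem) simp
  have "hip K ?x ?x = (\<Sum>i\<in>B. c i * hip K i ?x)"
    using mem x by (subst hip_sum_left) (auto simp: hip_scale_left)
  also have "\<dots> = (\<Sum>i\<in>B. (c i)\<^sup>2)"
    using hip_orthonormal_left[OF B] mem x
    by (intro sum.cong) (auto simp: sym[of _ ?x] power2_eq_square)
  finally show ?thesis .
qed

lemma linear_sum:
  assumes "\<And>x y a. x \<in> hcar K \<Longrightarrow> y \<in> hcar K \<Longrightarrow> \<phi> (a *\<^sub>R x + y) = a * \<phi> x + (\<phi> y :: real)"
    and "\<And>i. i \<in> I \<Longrightarrow> f i \<in> hcar K"
  shows "\<phi> (\<Sum>i\<in>I. c i *\<^sub>R f i) = (\<Sum>i\<in>I. c i * \<phi> (f i))"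
proof -
  have "\<phi> 0 = 0"
    using assms(1)[of 0 0 1] by simp
  then show ?thesis
    using assms(2)
    by (induction I rule: infinite_finite_induct) (auto simp: assms(1) sum_mem)
qed

text \<open>On a finite linear combination of basis vectors this is the Cauchy--Schwarz inequality for the
coefficients; the span is dense and the functional is bounded.\<close>

lemma functional_le_sum_squares:
  assumes B: "is_onb K B"
    and lin\<phi>: "\<And>x y a. x \<in> hcar K \<Longrightarrow> y \<in> hcar K \<Longrightarrow> \<phi> (a *\<^sub>R x + y) = a * \<phi> x + (\<phi> y :: real)"
    and bnd: "\<And>x. x \<in> hcar K \<Longrightarrow> \<bar>\<phi> x\<bar> \<le> C * hnorm K x"
    and s: "\<And>t. finite t \<Longrightarrow> t \<subseteq> B \<Longrightarrow> (\<Sum>b\<in>t. (\<phi> b)\<^sup>2) \<le> s"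
    and x: "x \<in> hcar K"
  shows "(\<phi> x)\<^sup>2 \<le> s * hip K x x"
proof -
  have s0: "0 \<le> s"
    using s[of "{}"] by simp
  have BK: "B \<subseteq> hcar K"
    using B by (simp add: is_onb_def)
  have span: "\<bar>\<phi> d\<bar> \<le> sqrt s * hnorm K d" if "d \<in> span B" for d
  proof -
    from that obtain t c where t: "finite t" "t \<subseteq> B" "d = (\<Sum>b\<in>t. c b *\<^sub>R b)"
      unfolding span_explicit by auto
    have on: "orthonormal K t"
      using B t(2) orthonormal_subset by (auto simp: is_onb_iff)
    have "\<phi> d = (\<Sum>b\<in>t. c b * \<phi> b)"
      unfolding t(3) using t(2) BK by (intro linear_sum lin\<phi>) auto
    then have "(\<phi> d)\<^sup>2 \<le> (\<Sum>b\<in>t. (c b)\<^sup>2) * (\<Sum>b\<in>t. (\<phi> b)\<^sup>2)"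
      by (simp add: Cauchy_Schwarz_ineq_sum)
    also have "\<dots> \<le> (\<Sum>b\<in>t. (c b)\<^sup>2) * s"
      using s[OF t(1,2)] by (intro mult_left_mono) (auto intro: sum_nonneg)
    also have "\<dots> = s * hip K d d"
      unfolding t(3) by (subst hip_orthonormal_sum[OF on t(1)]) simp
    finally show ?thesis
      by (metis hnorm_def real_sqrt_abs real_sqrt_le_mono real_sqrt_mult)
  qed
  have "\<bar>\<phi> x\<bar> \<le> sqrt s * hnorm K x + e" if e: "e > 0" for e
  proof -
    \<comment> \<open>the factor by which an error of the approximation of \<open>x\<close> enters the estimate; the \<open>1\<close> makes it positive\<close>
    define k where "k = sqrt s + \<bar>C\<bar> + 1"
    have k: "k > 0"
      using s0 by (simp add: k_def add_nonneg_pos)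
    have "e / k > 0"
      using e k by simp
    then obtain d where d: "d \<in> span B" "hnorm K (x - d) < e / k"
      using B x unfolding is_onb_def dense_subset_def by blast
    have dK [simp]: "d \<in> hcar K"
      using d(1) B by (auto simp: is_onb_def dense_subset_def)
    have "\<phi> x = \<phi> (x - d) + \<phi> d"
      using lin\<phi>[of "x - d" d 1] x by simp
    then have "\<bar>\<phi> x\<bar> \<le> \<bar>\<phi> (x - d)\<bar> + \<bar>\<phi> d\<bar>"
      by linarith
    also have "\<dots> \<le> C * hnorm K (x - d) + sqrt s * hnorm K d"
      using bnd[of "x - d"] span[OF d(1)] x by simp
    also have "\<dots> \<le> \<bar>C\<bar> * hnorm K (x - d) + sqrt s * (hnorm K (x - d) + hnorm K x)"
    proof (intro add_mono mult_mono)
      have "d = (d - x) + x"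
        by simp
      then show "hnorm K d \<le> hnorm K (x - d) + hnorm K x"
        using hnorm_triangle[of "d - x" x] x by (simp add: hnorm_diff_commute[of x d])
    qed (use x s0 in \<open>auto simp: hnorm_nonneg\<close>)
    also have "\<dots> \<le> sqrt s * hnorm K x + k * hnorm K (x - d)"
      using x by (simp add: k_def algebra_simps hnorm_nonneg)
    also have "\<dots> \<le> sqrt s * hnorm K x + e"
      using d(2) k by (simp add: field_simps)
    finally show ?thesis .
  qed
  then have "\<bar>\<phi> x\<bar> \<le> sqrt s * hnorm K x"
    by (rule field_le_epsilon)
  then have "\<bar>\<phi> x\<bar>\<^sup>2 \<le> (sqrt s * hnorm K x)\<^sup>2"
    by (intro power_mono) auto
  then show ?thesis
    using x s0 by (simp add: power_mult_distrib hnorm_sq)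
qed

text \<open>One step of the Gram--Schmidt process.\<close>

lemma orthonormal_extend:
  assumes B: "orthonormal K B" "finite B" and x: "x \<in> hcar K"
  shows "\<exists>B'. orthonormal K B' \<and> finite B' \<and> B \<subseteq> B' \<and> x \<in> span B'"
proof -
  define p where "p = (\<Sum>b\<in>B. hip K x b *\<^sub>R b)"
  define y where "y = x - p"
  have BK: "b \<in> hcar K" if "b \<in> B" for b
    using that B by (auto simp: orthonormal_def)
  have pK: "p \<in> hcar K"
    unfolding p_def using BK by (intro sum_mem) simp
  have yK: "y \<in> hcar K"
    using x pK by (simp add: y_def)
  have p_span: "p \<in> span B"
    unfolding p_def by (intro span_sum span_scale span_base)
  show ?thesis
  proof (cases "y = 0")
    case True
    then show ?thesis
      using B p_span by (auto simp: y_def)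
  next
    case False
    define e where "e = (1 / hnorm K y) *\<^sub>R y"
    have ny: "hnorm K y > 0"
      using pos[OF yK False] by (simp add: hnorm_def)
    have eK: "e \<in> hcar K"
      using yK by (simp add: e_def)
    have ee: "hip K e e = 1"
      using yK pos[OF yK False] hnorm_sq[OF yK]
      by (simp add: e_def hip_simps power2_eq_square)
    have eb: "hip K e b = 0" if "b \<in> B" for b
    proof -
      have "hip K y b = 0"
        using hip_orthonormal_left[OF B that, of "hip K x"] x pK BK[OF that]
        by (simp add: y_def hip_diff_left p_def[symmetric])
      then show ?thesis
        using yK BK[OF that] by (simp add: e_def hip_scale_left)
    qed
    have be: "hip K b e = 0" if "b \<in> B" for b
      using eb[OF that] sym[OF BK[OF that] eK] by simp
    have "e \<notin> B"
      using eb[of e] ee by auto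
    moreover have "hip K x y = (if x = y then 1 else 0)" if "x \<in> B" "y \<in> B" for x y
      using B(1) that by (simp add: orthonormal_def)
    ultimately have "orthonormal K (insert e B)"
      using eK ee eb be BK by (auto simp: orthonormal_def)
    moreover have "x \<in> span (insert e B)"
    proof -
      have "x = hnorm K y *\<^sub>R e + p"
        using ny by (simp add: e_def y_def)
      moreover have "p \<in> span (insert e B)"
        using p_span span_mono[of B "insert e B"] by auto
      ultimately show ?thesis
        by (metis insertI1 span_add span_base span_scale)
    qed
    ultimately show ?thesis
      using B(2) by blast
  qed
qed

lemma ex_onb_if_separable:
  assumes D: "countable D" "dense_subset K D"
  shows "\<exists>B. is_onb K B"
proof -
  have "D \<noteq> {}"
    using D(2) zero_mem unfolding dense_subset_def by (metis empty_iff zero_less_one)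
  let ?d = "from_nat_into D"
  have dD: "?d n \<in> D" for n
    using \<open>D \<noteq> {}\<close> by (rule from_nat_into)
  have DK: "D \<subseteq> hcar K"
    using D(2) by (simp add: dense_subset_def)
  have "\<exists>B. \<forall>n. (orthonormal K (B n) \<and> finite (B n)) \<and> (B n \<subseteq> B (Suc n) \<and> ?d n \<in> span (B (Suc n)))"
  proof (rule dependent_nat_choice)
    show "\<exists>B. orthonormal K B \<and> finite B"
      by (rule exI[of _ "{}"]) (simp add: orthonormal_def)
    show "\<exists>B'. (orthonormal K B' \<and> finite B') \<and> (B \<subseteq> B' \<and> ?d n \<in> span B')"
      if "orthonormal K B \<and> finite B" for B n
      using orthonormal_extend[of B "?d n"] that dD[of n] DK by blast
  qed
  then obtain B where B: "\<And>n. orthonormal K (B n)" "\<And>n. B n \<subseteq> B (Suc n)"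
      "\<And>n. ?d n \<in> span (B (Suc n))"
    by blast
  have mono: "B m \<subseteq> B n" if "m \<le> n" for m n
    using B(2) that by (rule lift_Suc_mono_le)
  let ?B = "\<Union>n. B n"
  have on: "orthonormal K ?B"
    unfolding orthonormal_def
  proof (intro conjI ballI)
    show "?B \<subseteq> hcar K"
      using B(1) by (auto simp: orthonormal_def)
    fix x y assume "x \<in> ?B" "y \<in> ?B"
    then obtain m n where "x \<in> B m" "y \<in> B n"
      by auto
    then have "x \<in> B (max m n)" "y \<in> B (max m n)"
      using mono[of m "max m n"] mono[of n "max m n"] by auto
    then show "hip K x y = (if x = y then 1 else 0)"
      using B(1)[of "max m n"] by (simp add: orthonormal_def)
  qed
  have "D \<subseteq> span ?B"
  proof
    fix x assume "x \<in> D"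
    then obtain n where "x = ?d n"
      using D(1) from_nat_into_surj by metis
    then show "x \<in> span ?B"
      using B(3)[of n] span_mono[of "B (Suc n)" ?B] by auto
  qed
  moreover have "span ?B \<subseteq> hcar K"
    using on subspace by (intro span_minimal) (auto simp: orthonormal_def)
  ultimately have "dense_subset K (span ?B)"
    using D(2) unfolding dense_subset_def by blast
  then show ?thesis
    using on is_onb_iff by blast
qed

end

text \<open>Duality: for finitely many \<open>e\<close> put \<open>v = \<Sum> \<phi>(A e) e\<close>.  Then \<open>S = \<Sum> \<phi>(A e)\<^sup>2\<close> is both \<open>\<phi>(A v)\<close> and
\<open>\<parallel>v\<parallel>\<^sup>2\<close>, so the bound on \<open>\<phi>\<close> at \<open>A v\<close> reads \<open>S\<^sup>2 \<le> D\<^sup>2 s S\<close> with \<open>s = \<Sum> \<phi>(b)\<^sup>2\<close>, and \<open>S\<close> cancels.\<close>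

lemma nn_integral_orthonormal_le:
  assumes L: "prehilbert L" and M: "prehilbert M"
    and E: "orthonormal L E" and B: "is_onb M B"
    and A_mem: "\<And>x. x \<in> hcar L \<Longrightarrow> A x \<in> hcar M"
    and A_lin: "\<And>x y a. x \<in> hcar L \<Longrightarrow> y \<in> hcar L \<Longrightarrow> A (a *\<^sub>R x + y) = a *\<^sub>R A x + A y"
    and A_bnd: "\<And>x. x \<in> hcar L \<Longrightarrow> hnorm M (A x) \<le> D * hnorm L x" and D: "D \<ge> 1"
    and lin\<phi>: "\<And>x y a. x \<in> hcar M \<Longrightarrow> y \<in> hcar M \<Longrightarrow> \<phi> (a *\<^sub>R x + y) = a * \<phi> x + (\<phi> y :: real)"
    and bnd: "\<And>x. x \<in> hcar M \<Longrightarrow> \<bar>\<phi> x\<bar> \<le> C * hnorm M x"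
  shows "(\<integral>\<^sup>+e. ennreal ((\<phi> (A e))\<^sup>2) \<partial>count_space E) \<le>
    ennreal (D\<^sup>2) * (\<integral>\<^sup>+b. ennreal ((\<phi> b)\<^sup>2) \<partial>count_space B)"
proof (cases "(\<lambda>b. (\<phi> b)\<^sup>2) summable_on B")
  case False
  then have "(\<integral>\<^sup>+b. ennreal ((\<phi> b)\<^sup>2) \<partial>count_space B) = \<infinity>"
    using summable_on_iff_nn_integral(1)[of "\<lambda>b. (\<phi> b)\<^sup>2" B] by (simp add: less_top[symmetric])
  then show ?thesis
    using D by (simp add: ennreal_mult_top)
next
  case True
  interpret L: prehilbert L by (rule L)
  interpret M: prehilbert M by (rule M)
  let ?s = "\<Sum>\<^sub>\<infinity>b\<in>B. (\<phi> b)\<^sup>2"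
  have fin: "(\<Sum>e\<in>t. (\<phi> (A e))\<^sup>2) \<le> D\<^sup>2 * ?s" if t: "finite t" "t \<subseteq> E" for t
  proof -
    define S where "S = (\<Sum>e\<in>t. (\<phi> (A e))\<^sup>2)"
    define v where "v = (\<Sum>e\<in>t. \<phi> (A e) *\<^sub>R e)"
    have on: "orthonormal L t"
      using E t(2) by (rule orthonormal_subset)
    have tL: "e \<in> hcar L" if "e \<in> t" for e
      using on that by (auto simp: orthonormal_def)
    have v: "v \<in> hcar L"
      unfolding v_def using tL by (intro L.sum_mem) simp
    have "\<phi> (A v) = S"
      unfolding v_def S_def power2_eq_square
      by (rule L.linear_sum) (auto simp: A_lin lin\<phi> A_mem tL)
    moreover have "(\<Sum>b\<in>u. (\<phi> b)\<^sup>2) \<le> ?s" if "finite u" "u \<subseteq> B" for u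
      using that True by (intro finite_sum_le_infsum) auto
    then have "(\<phi> (A v))\<^sup>2 \<le> ?s * hip M (A v) (A v)"
      using M.functional_le_sum_squares[OF B lin\<phi> bnd, of ?s "A v"] v A_mem by blast
    ultimately have "S\<^sup>2 \<le> ?s * hip M (A v) (A v)"
      by simp
    also have "\<dots> \<le> ?s * (D\<^sup>2 * hip L v v)"
    proof (rule mult_left_mono)
      have "(hnorm M (A v))\<^sup>2 \<le> (D * hnorm L v)\<^sup>2"
        using v A_mem by (intro power_mono A_bnd) (auto simp: M.hnorm_nonneg)
      then show "hip M (A v) (A v) \<le> D\<^sup>2 * hip L v v"
        using v A_mem by (simp add: M.hnorm_sq L.hnorm_sq power_mult_distrib)
    qed (auto intro: infsum_nonneg)
    also have "hip L v v = S"
      unfolding v_def S_def by (rule L.hip_orthonormal_sum[OF on t(1)])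
    finally have "S * S \<le> (D\<^sup>2 * ?s) * S"
      by (simp add: power2_eq_square mult_ac)
    moreover have "0 \<le> S" "0 \<le> D\<^sup>2 * ?s"
      by (auto simp: S_def intro!: sum_nonneg mult_nonneg_nonneg infsum_nonneg)
    ultimately have "S \<le> D\<^sup>2 * ?s"
      by (cases "S = 0") (auto intro: mult_right_le_imp_le)
    then show ?thesis
      by (simp add: S_def)
  qed
  have summ: "(\<lambda>e. (\<phi> (A e))\<^sup>2) summable_on E"
    using fin by (intro nonneg_bdd_above_summable_on bdd_aboveI[of _ "D\<^sup>2 * ?s"]) auto
  then have "(\<Sum>\<^sub>\<infinity>e\<in>E. (\<phi> (A e))\<^sup>2) \<le> D\<^sup>2 * ?s"
    using fin by (intro infsum_le_finite_sums)
  then show ?thesis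
    using summable_on_iff_nn_integral(2)[OF _ summ] summable_on_iff_nn_integral(2)[OF _ True]
    by (simp add: ennreal_mult[symmetric] infsum_nonneg ennreal_leI)
qed

section \<open>The Riesz representation and dual spaces\<close>

text \<open>The representing vector minimises \<open>J(x) = \<parallel>x\<parallel>\<^sup>2 - 2 \<omega>(x)\<close>.  By the parallelogram law a minimising
sequence is a Cauchy sequence; completeness gives its limit \<open>u\<close>, and the variation of \<open>J\<close> in the
direction \<open>y\<close> vanishes at \<open>u\<close>, that is, \<open>(u, y) = \<omega>(y)\<close>.\<close>

lemma riesz_representation:
  assumes K: "hilbert_space K"
    and lin\<omega>: "\<And>x y a. x \<in> hcar K \<Longrightarrow> y \<in> hcar K \<Longrightarrow> \<omega> (a *\<^sub>R x + y) = a * \<omega> x + (\<omega> y :: real)"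
    and bnd: "\<And>x. x \<in> hcar K \<Longrightarrow> \<bar>\<omega> x\<bar> \<le> C * hnorm K x"
  shows "\<exists>u\<in>hcar K. \<forall>x\<in>hcar K. \<omega> x = hip K u x"
proof -
  interpret prehilbert K
    using K by (rule hilbert_space_imp_prehilbert)
  have \<omega>0: "\<omega> 0 = 0"
    using lin\<omega>[of 0 0 1] by simp
  have \<omega>_add: "\<omega> (x + y) = \<omega> x + \<omega> y" if "x \<in> hcar K" "y \<in> hcar K" for x y
    using lin\<omega>[of x y 1] that by simp
  have \<omega>_scale: "\<omega> (a *\<^sub>R x) = a * \<omega> x" if "x \<in> hcar K" for a x
    using lin\<omega>[of x 0 a] that \<omega>0 by simp
  define J where "J x = hip K x x - 2 * \<omega> x" for x
  define m where "m = Inf (J ` hcar K)"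
  have "- (C\<^sup>2) \<le> J x" if "x \<in> hcar K" for x
  proof -
    have "2 * (C * hnorm K x) \<le> C\<^sup>2 + (hnorm K x)\<^sup>2"
      using sum_squares_bound[of C "hnorm K x"] by (simp only: mult.assoc)
    then show ?thesis
      using bnd[OF that] hnorm_sq[OF that] unfolding J_def by linarith
  qed
  then have bdd: "bdd_below (J ` hcar K)"
    by (intro bdd_belowI2)
  have m_le: "m \<le> J x" if "x \<in> hcar K" for x
    unfolding m_def using bdd that by (intro cInf_lower) auto
  have "\<exists>x\<in>hcar K. J x < m + 1 / real (Suc n)" for n
  proof -
    have "\<exists>y\<in>J ` hcar K. y < m + 1 / real (Suc n)"
      unfolding m_def
    proof (rule cInf_lessD)
      show "J ` hcar K \<noteq> {}"
        using zero_mem by blast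
    qed simp
    then show ?thesis
      by auto
  qed
  then obtain X where X [simp]: "\<And>n. X n \<in> hcar K" and JX: "\<And>n. J (X n) < m + 1 / real (Suc n)"
    by metis
  have parallelogram: "(hnorm K (x - y))\<^sup>2 \<le> 2 * (J x - m) + 2 * (J y - m)"
    if [simp]: "x \<in> hcar K" "y \<in> hcar K" for x y
  proof -
    have "(hnorm K (x - y))\<^sup>2 = 2 * J x + 2 * J y - 4 * J ((1/2) *\<^sub>R (x + y))"
      by (simp add: hnorm_sq J_def hip_simps \<omega>_add \<omega>_scale sym[of y x] algebra_simps)
    then show ?thesis
      using m_le[of "(1/2) *\<^sub>R (x + y)"] by simp
  qed
  have "\<exists>N. \<forall>i\<ge>N. \<forall>j\<ge>N. hnorm K (X i - X j) < e" if "e > 0" for e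
  proof -
    obtain N where N: "real (Suc N) > 4 / e\<^sup>2"
      using reals_Archimedean2[of "4 / e\<^sup>2"] by (metis less_Suc_eq of_nat_less_iff order_less_trans)
    have small: "J (X i) - m < e\<^sup>2 / 4" if "i \<ge> N" for i
    proof -
      have "1 / real (Suc i) \<le> 1 / real (Suc N)"
        using that by (simp add: frac_le)
      also have "\<dots> < e\<^sup>2 / 4"
        using N \<open>e > 0\<close> by (simp add: field_simps)
      finally show ?thesis
        using JX[of i] by simp
    qed
    have "hnorm K (X i - X j) < e" if "i \<ge> N" "j \<ge> N" for i j
    proof (rule power2_less_imp_less)
      show "(hnorm K (X i - X j))\<^sup>2 < e\<^sup>2"
        using parallelogram[of "X i" "X j"] small[OF that(1)] small[OF that(2)] by simp
    qed (use \<open>e > 0\<close> in simp)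
    then show ?thesis
      by blast
  qed
  then obtain u where u [simp]: "u \<in> hcar K" and lim: "(\<lambda>n. hnorm K (X n - u)) \<longlonglongrightarrow> 0"
    using K X unfolding hilbert_space_def by blast
  have "\<omega> y = hip K u y" if y [simp]: "y \<in> hcar K" for y
  proof -
    have "(\<lambda>n. hip K (X n - u) y) \<longlonglongrightarrow> 0"
    proof (rule Lim_null_comparison)
      show "\<forall>\<^sub>F n in sequentially. norm (hip K (X n - u) y) \<le> hnorm K (X n - u) * hnorm K y"
        by (simp add: cauchy_schwarz)
      show "(\<lambda>n. hnorm K (X n - u) * hnorm K y) \<longlonglongrightarrow> 0"
        using tendsto_mult_right[OF lim, of "hnorm K y"] by simp
    qed
    then have "(\<lambda>n. hip K (X n - u) y + hip K u y) \<longlonglongrightarrow> 0 + hip K u y"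
      by (intro tendsto_intros)
    then have hlim: "(\<lambda>n. hip K (X n) y) \<longlonglongrightarrow> hip K u y"
      by (simp add: hip_simps)
    define d where "d = hip K u y - \<omega> y"
    define c where "c = hip K y y"
    \<comment> \<open>near the minimiser \<open>-d / c\<close> of the quadratic polynomial \<open>2 t d + t\<^sup>2 c\<close>, and defined also for \<open>c = 0\<close>\<close>
    define t where "t = - d / (c + 1)"
    have c: "c \<ge> 0"
      by (simp add: c_def hip_nonneg)
    have "0 \<le> 1 / real (Suc n) + (2 * t * (hip K (X n) y - \<omega> y) + t\<^sup>2 * c)" for n
    proof -
      have "m \<le> J (X n + t *\<^sub>R y)"
        by (rule m_le) simp
      also have "\<dots> = J (X n) + (2 * t * (hip K (X n) y - \<omega> y) + t\<^sup>2 * c)"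
        by (simp add: J_def c_def hip_simps \<omega>_add \<omega>_scale sym[of y "X n"] power2_eq_square algebra_simps)
      finally show ?thesis
        using JX[of n] by simp
    qed
    moreover have "(\<lambda>n. 1 / real (Suc n) + (2 * t * (hip K (X n) y - \<omega> y) + t\<^sup>2 * c)) \<longlonglongrightarrow>
        0 + (2 * t * (hip K u y - \<omega> y) + t\<^sup>2 * c)"
      by (intro tendsto_intros hlim LIMSEQ_Suc[OF lim_1_over_n])
    ultimately have "0 \<le> 0 + (2 * t * (hip K u y - \<omega> y) + t\<^sup>2 * c)"
      by (intro LIMSEQ_le_const) auto
    then have "0 \<le> 2 * t * d + t\<^sup>2 * c"
      by (simp add: d_def)
    moreover have "2 * t * d + t\<^sup>2 * c = - (d\<^sup>2 * (c + 2)) / (c + 1)\<^sup>2"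
      using c by (simp add: t_def power2_eq_square divide_simps) (simp add: algebra_simps)
    ultimately have "d\<^sup>2 * (c + 2) \<le> 0"
      using c by (simp add: divide_simps split: if_splits)
    then have "d = 0"
      using c by (simp add: mult_le_0_iff)
    then show ?thesis
      by (simp add: d_def)
  qed
  then show ?thesis
    using u by blast
qed

lemma riesz_mem_hdual:
  assumes "hilbert_space K" "u \<in> hcar K"
  shows "riesz K u \<in> hcar (hdual K)"
proof -
  interpret prehilbert K
    using assms(1) by (rule hilbert_space_imp_prehilbert)
  show ?thesis
    using assms(2) cauchy_schwarz[OF assms(2)]
    by (auto simp: hdual_def riesz_def hip_simps)
qed

lemma riesz_inj:
  assumes "hilbert_space K" "u \<in> hcar K" "v \<in> hcar K" "riesz K u = riesz K v"
  shows "u = v"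
proof (rule ccontr)
  interpret prehilbert K
    using assms(1) by (rule hilbert_space_imp_prehilbert)
  assume "u \<noteq> v"
  then have "hip K (u - v) (u - v) > 0"
    using assms by (intro pos) auto
  moreover have "hip K u (u - v) = hip K v (u - v)"
    using fun_cong[OF assms(4), of "u - v"] assms by (simp add: riesz_def)
  ultimately show False
    using assms hip_diff_left[of u v "u - v"] by simp
qed

lemma riesz_rep_riesz:
  assumes "hilbert_space K" "u \<in> hcar K"
  shows "riesz_rep K (riesz K u) = u"
  unfolding riesz_rep_def using assms riesz_inj by (intro the_equality) auto

lemma hdual_mem_iff_riesz:
  assumes "hilbert_space K"
  shows "hcar (hdual K) = riesz K ` hcar K"
proof
  show "riesz K ` hcar K \<subseteq> hcar (hdual K)"
    using assms riesz_mem_hdual by blast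
  show "hcar (hdual K) \<subseteq> riesz K ` hcar K"
  proof
    fix \<omega> assume "\<omega> \<in> hcar (hdual K)"
    then obtain C where "\<forall>x. x \<notin> hcar K \<longrightarrow> \<omega> x = 0"
      "\<forall>x\<in>hcar K. \<forall>y\<in>hcar K. \<forall>a. \<omega> (a *\<^sub>R x + y) = a * \<omega> x + \<omega> y"
      "\<forall>x\<in>hcar K. \<bar>\<omega> x\<bar> \<le> C * hnorm K x"
      unfolding hdual_def by auto
    then have \<omega>: "\<And>x. x \<notin> hcar K \<Longrightarrow> \<omega> x = 0"
      "\<And>x y a. x \<in> hcar K \<Longrightarrow> y \<in> hcar K \<Longrightarrow> \<omega> (a *\<^sub>R x + y) = a * \<omega> x + \<omega> y"
      "\<And>x. x \<in> hcar K \<Longrightarrow> \<bar>\<omega> x\<bar> \<le> C * hnorm K x"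
      by blast+
    obtain u where "u \<in> hcar K" "\<forall>x\<in>hcar K. \<omega> x = hip K u x"
      using riesz_representation[OF assms \<omega>(2,3)] by blast
    then show "\<omega> \<in> riesz K ` hcar K"
      using \<omega>(1) by (intro image_eqI[of _ _ u]) (auto simp: riesz_def fun_eq_iff)
  qed
qed

lemma riesz_lin:
  assumes "hilbert_space K" "u \<in> hcar K" "v \<in> hcar K"
  shows "riesz K (a *\<^sub>R u + v) = a *\<^sub>R riesz K u + riesz K v"
proof -
  interpret prehilbert K
    using assms(1) by (rule hilbert_space_imp_prehilbert)
  show ?thesis
    using assms by (auto simp: riesz_def fun_eq_iff scaleR_fun_def hip_simps)
qed

lemma hip_hdual_riesz:
  assumes "hilbert_space K" "u \<in> hcar K" "v \<in> hcar K"
  shows "hip (hdual K) (riesz K u) (riesz K v) = hip K u v"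
  using assms by (simp add: hdual_def riesz_rep_riesz)

lemma hnorm_hdual_riesz:
  assumes "hilbert_space K" "u \<in> hcar K"
  shows "hnorm (hdual K) (riesz K u) = hnorm K u"
  using assms by (simp add: hnorm_def hip_hdual_riesz)

text \<open>The inner product of the dual space is carried over by the bijection \<^const>\<open>riesz\<close>, whose inverse is
\<^const>\<open>riesz_rep\<close>.\<close>

lemma prehilbert_hdual:
  assumes K: "hilbert_space K"
  shows "prehilbert (hdual K)"
proof -
  interpret prehilbert K
    using K by (rule hilbert_space_imp_prehilbert)
  have zero: "riesz K 0 = 0"
    using riesz_lin[OF K, of 0 0 1] by simp
  show ?thesis
  proof
    show "subspace (hcar (hdual K))"
      unfolding hdual_mem_iff_riesz[OF K]
    proof (rule subspaceI)
      show "0 \<in> riesz K ` hcar K"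
        using zero by (metis image_eqI zero_mem)
      show "\<omega> + \<eta> \<in> riesz K ` hcar K" if "\<omega> \<in> riesz K ` hcar K" "\<eta> \<in> riesz K ` hcar K" for \<omega> \<eta>
      proof -
        from that obtain u v where "\<omega> = riesz K u" "\<eta> = riesz K v" "u \<in> hcar K" "v \<in> hcar K"
          by auto
        then show ?thesis
          using riesz_lin[OF K, of u v 1] by (metis add_mem image_eqI scaleR_one)
      qed
      show "c *\<^sub>R \<omega> \<in> riesz K ` hcar K" if "\<omega> \<in> riesz K ` hcar K" for c \<omega>
      proof -
        from that obtain u where "\<omega> = riesz K u" "u \<in> hcar K"
          by auto
        then show ?thesis
          using riesz_lin[OF K, of u 0 c] zero by (metis add.right_neutral image_eqI scale_mem zero_mem)
      qed
    qed
    fix \<omega> \<eta> \<zeta> a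
    assume "\<omega> \<in> hcar (hdual K)" "\<eta> \<in> hcar (hdual K)" "\<zeta> \<in> hcar (hdual K)"
    then obtain u v w where uvw: "\<omega> = riesz K u" "\<eta> = riesz K v" "\<zeta> = riesz K w"
        "u \<in> hcar K" "v \<in> hcar K" "w \<in> hcar K"
      by (auto simp: hdual_mem_iff_riesz[OF K])
    show "hip (hdual K) (a *\<^sub>R \<omega> + \<eta>) \<zeta> = a * hip (hdual K) \<omega> \<zeta> + hip (hdual K) \<eta> \<zeta>"
      using uvw K by (simp add: riesz_lin[symmetric] hip_hdual_riesz hip_simps)
  next
    fix \<omega> \<eta>
    assume "\<omega> \<in> hcar (hdual K)" "\<eta> \<in> hcar (hdual K)"
    then show "hip (hdual K) \<omega> \<eta> = hip (hdual K) \<eta> \<omega>"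
      using K by (auto simp: hdual_mem_iff_riesz[OF K] hip_hdual_riesz sym)
  next
    fix \<omega>
    assume "\<omega> \<in> hcar (hdual K)" "\<omega> \<noteq> 0"
    then show "hip (hdual K) \<omega> \<omega> > 0"
      using K zero by (auto simp: hdual_mem_iff_riesz[OF K] hip_hdual_riesz intro!: pos)
  qed
qed

lemma is_onb_hdual_riesz:
  assumes K: "hilbert_space K" and B: "is_onb K B"
  shows "is_onb (hdual K) (riesz K ` B)"
proof -
  interpret prehilbert K
    using K by (rule hilbert_space_imp_prehilbert)
  interpret D: prehilbert "hdual K"
    using K by (rule prehilbert_hdual)
  have BK: "B \<subseteq> hcar K"
    using B by (simp add: is_onb_def)
  have zero: "riesz K 0 = 0"
    using riesz_lin[OF K, of 0 0 1] by simp
  have span: "d \<in> hcar K \<and> riesz K d \<in> span (riesz K ` B)" if "d \<in> span B" for d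
    using that
  proof (induction rule: span_induct_alt)
    case base
    then show ?case
      by (metis zero span_zero zero_mem)
  next
    case (step c x y)
    then have mem: "x \<in> hcar K" "y \<in> hcar K" and y: "riesz K y \<in> span (riesz K ` B)"
      using BK by auto
    have "riesz K x \<in> span (riesz K ` B)"
      using step by (intro span_base imageI)
    then have "c *\<^sub>R riesz K x + riesz K y \<in> span (riesz K ` B)"
      using y by (intro span_add span_scale)
    then show ?case
      using mem by (simp only: riesz_lin[OF K] scale_mem add_mem simp_thms)
  qed
  have "dense_subset (hdual K) (span (riesz K ` B))"
    unfolding dense_subset_def
  proof (intro conjI ballI allI impI)
    show "span (riesz K ` B) \<subseteq> hcar (hdual K)"
      using BK K D.subspace by (intro span_minimal) (auto intro: riesz_mem_hdual)
    fix \<omega> and e :: real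
    assume "\<omega> \<in> hcar (hdual K)" "e > 0"
    then obtain u where u: "\<omega> = riesz K u" "u \<in> hcar K"
      by (auto simp: hdual_mem_iff_riesz[OF K])
    then obtain d where d: "d \<in> span B" "hnorm K (u - d) < e"
      using B \<open>e > 0\<close> unfolding is_onb_def dense_subset_def by blast
    have "riesz K u - riesz K d = riesz K (u - d)"
      using riesz_lin[OF K, of d u "-1"] span[OF d(1)] u by simp
    then have "hnorm (hdual K) (\<omega> - riesz K d) < e"
      using u d span[OF d(1)] K by (simp add: hnorm_hdual_riesz)
    then show "\<exists>d\<in>span (riesz K ` B). hnorm (hdual K) (\<omega> - d) < e"
      using span[OF d(1)] by blast
  qed
  moreover have "orthonormal (hdual K) (riesz K ` B)"
    using B BK K riesz_mem_hdual[OF K]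
    by (auto simp: orthonormal_def is_onb_def hip_hdual_riesz subset_iff dest: riesz_inj)
  ultimately show ?thesis
    by (simp add: is_onb_iff)
qed

text \<open>The chosen basis is a basis because some basis exists: the image of one obtained by Gram--Schmidt
from a countable dense set.\<close>

lemma is_onb_onb_hdual:
  assumes "separable_hilbert_space K"
  shows "is_onb (hdual K) (onb (hdual K))"
proof -
  have K: "hilbert_space K"
    using assms by (simp add: separable_hilbert_space_def)
  obtain B where "is_onb K B"
    using assms prehilbert.ex_onb_if_separable[OF hilbert_space_imp_prehilbert[OF K]]
    unfolding separable_hilbert_space_def by blast
  then show ?thesis
    unfolding onb_def using is_onb_hdual_riesz[OF K] by (rule_tac someI)
qed

section \<open>Bounded multilinear functionals and composition with a bounded map\<close>

text \<open>The part of membership in \<^const>\<open>tensor_power\<close> that does not refer to an orthonormal basis.\<close>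

definition bounded_multilinear :: "'v::real_vector hspace \<Rightarrow> nat \<Rightarrow> ('v list \<Rightarrow> real) \<Rightarrow> bool" where
  "bounded_multilinear K n f \<longleftrightarrow>
     (\<forall>xs. xs \<notin> tuples (hcar K) n \<longrightarrow> f xs = 0) \<and>
     (\<forall>xs\<in>tuples (hcar K) n. \<forall>i<n. \<forall>x\<in>hcar K. \<forall>y\<in>hcar K. \<forall>a.
        f (xs[i := a *\<^sub>R x + y]) = a * f (xs[i := x]) + f (xs[i := y])) \<and>
     (\<exists>C. \<forall>xs\<in>tuples (hcar K) n. \<bar>f xs\<bar> \<le> C * prod_list (map (hnorm K) xs))"

lemma mem_tensor_power_iff:
  "f \<in> hcar (tensor_power K n) \<longleftrightarrow> bounded_multilinear K n f \<and> sqnorm (onb K) n f < \<infinity>"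
  unfolding summable_iff_sqnorm[symmetric] by (simp add: tensor_power_def bounded_multilinear_def)

lemma bounded_multilinear_outside:
  "bounded_multilinear K n f \<Longrightarrow> xs \<notin> tuples (hcar K) n \<Longrightarrow> f xs = 0"
  unfolding bounded_multilinear_def by blast

lemma bounded_multilinear_update:
  "bounded_multilinear K n f \<Longrightarrow> xs \<in> tuples (hcar K) n \<Longrightarrow> i < n \<Longrightarrow> x \<in> hcar K \<Longrightarrow> y \<in> hcar K \<Longrightarrow>
    f (xs[i := a *\<^sub>R x + y]) = a * f (xs[i := x]) + f (xs[i := y])"
  unfolding bounded_multilinear_def by blast

lemma prod_list_hnorm_nonneg:
  assumes "prehilbert K" "set xs \<subseteq> hcar K"
  shows "0 \<le> prod_list (map (hnorm K) xs)"
  using assms(2) by (induction xs) (auto simp: prehilbert.hnorm_nonneg[OF assms(1)])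

lemma bounded_multilinear_bound:
  assumes "prehilbert K" "bounded_multilinear K n f"
  obtains C where "C \<ge> 0" "\<And>xs. xs \<in> tuples (hcar K) n \<Longrightarrow> \<bar>f xs\<bar> \<le> C * prod_list (map (hnorm K) xs)"
proof -
  obtain C where C: "\<And>xs. xs \<in> tuples (hcar K) n \<Longrightarrow> \<bar>f xs\<bar> \<le> C * prod_list (map (hnorm K) xs)"
    using assms(2) unfolding bounded_multilinear_def by blast
  have "\<bar>f xs\<bar> \<le> \<bar>C\<bar> * prod_list (map (hnorm K) xs)" if "xs \<in> tuples (hcar K) n" for xs
  proof -
    have "0 \<le> prod_list (map (hnorm K) xs)"
      using assms(1) that by (intro prod_list_hnorm_nonneg) (auto simp: tuples_def)
    then show ?thesis
      using C[OF that] by (smt (verit) mult_right_mono)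
  qed
  then show ?thesis
    using that[of "\<bar>C\<bar>"] by simp
qed

lemma bounded_multilinearI:
  assumes "\<And>xs. xs \<notin> tuples (hcar K) n \<Longrightarrow> f xs = 0"
    and "\<And>xs i x y a. xs \<in> tuples (hcar K) n \<Longrightarrow> i < n \<Longrightarrow> x \<in> hcar K \<Longrightarrow> y \<in> hcar K \<Longrightarrow>
        f (xs[i := a *\<^sub>R x + y]) = a * f (xs[i := x]) + f (xs[i := y])"
    and "\<And>xs. xs \<in> tuples (hcar K) n \<Longrightarrow> \<bar>f xs\<bar> \<le> C * prod_list (map (hnorm K) xs)"
  shows "bounded_multilinear K n f"
  unfolding bounded_multilinear_def using assms by blast

lemma bounded_multilinear_add:
  assumes "bounded_multilinear K n f" "bounded_multilinear K n g"
  shows "bounded_multilinear K n (\<lambda>xs. f xs + g xs)"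
proof -
  obtain C where C: "\<And>xs. xs \<in> tuples (hcar K) n \<Longrightarrow> \<bar>f xs\<bar> \<le> C * prod_list (map (hnorm K) xs)"
    using assms(1) unfolding bounded_multilinear_def by blast
  obtain D where D: "\<And>xs. xs \<in> tuples (hcar K) n \<Longrightarrow> \<bar>g xs\<bar> \<le> D * prod_list (map (hnorm K) xs)"
    using assms(2) unfolding bounded_multilinear_def by blast
  show ?thesis
  proof (rule bounded_multilinearI[where C = "C + D"])
    fix xs assume "xs \<in> tuples (hcar K) n"
    then show "\<bar>f xs + g xs\<bar> \<le> (C + D) * prod_list (map (hnorm K) xs)"
      using C[of xs] D[of xs] unfolding distrib_right by linarith
  next
    fix xs i x y a
    assume "xs \<in> tuples (hcar K) n" "i < n" "x \<in> hcar K" "y \<in> hcar K"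
    then show "f (xs[i := a *\<^sub>R x + y]) + g (xs[i := a *\<^sub>R x + y]) =
        a * (f (xs[i := x]) + g (xs[i := x])) + (f (xs[i := y]) + g (xs[i := y]))"
      using assms by (simp add: bounded_multilinear_update distrib_left)
  qed (use assms in \<open>simp add: bounded_multilinear_outside\<close>)
qed

lemma bounded_multilinear_scale:
  assumes "bounded_multilinear K n f"
  shows "bounded_multilinear K n (\<lambda>xs. c * f xs)"
proof -
  obtain C where C: "\<And>xs. xs \<in> tuples (hcar K) n \<Longrightarrow> \<bar>f xs\<bar> \<le> C * prod_list (map (hnorm K) xs)"
    using assms unfolding bounded_multilinear_def by blast
  show ?thesis
  proof (rule bounded_multilinearI[where C = "\<bar>c\<bar> * C"])
    fix xs assume "xs \<in> tuples (hcar K) n"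
    then show "\<bar>c * f xs\<bar> \<le> \<bar>c\<bar> * C * prod_list (map (hnorm K) xs)"
      using mult_left_mono[OF C, of xs "\<bar>c\<bar>"] by (simp add: abs_mult mult.assoc)
  next
    fix xs i x y a
    assume "xs \<in> tuples (hcar K) n" "i < n" "x \<in> hcar K" "y \<in> hcar K"
    then show "c * f (xs[i := a *\<^sub>R x + y]) = a * (c * f (xs[i := x])) + c * f (xs[i := y])"
      using assms by (simp add: bounded_multilinear_update distrib_left)
  qed (use assms in \<open>simp add: bounded_multilinear_outside\<close>)
qed

lemma bounded_multilinear_zero: "prehilbert K \<Longrightarrow> bounded_multilinear K n (\<lambda>xs. 0)"
  by (rule bounded_multilinearI[where C = 0]) auto

lemma bounded_multilinear_sum:
  assumes "prehilbert K" "\<And>i. i \<in> I \<Longrightarrow> bounded_multilinear K n (f i)"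
  shows "bounded_multilinear K n (\<lambda>xs. \<Sum>i\<in>I. f i xs)"
  using assms(2)
  by (induction I rule: infinite_finite_induct)
    (auto simp: bounded_multilinear_zero[OF assms(1)] intro: bounded_multilinear_add)

lemma permute_list_update:
  assumes "\<pi> permutes {..<length xs}" "i < length xs"
  shows "permute_list \<pi> (xs[i := x]) = (permute_list \<pi> xs)[Hilbert_Choice.inv \<pi> i := x]"
proof (rule nth_equalityI)
  fix j assume "j < length (permute_list \<pi> (xs[i := x]))"
  then have j: "j < length xs"
    by simp
  have "\<pi> j = i \<longleftrightarrow> Hilbert_Choice.inv \<pi> i = j"
    using permutes_inv_eq[OF assms(1)] by blast
  then show "permute_list \<pi> (xs[i := x]) ! j = (permute_list \<pi> xs)[Hilbert_Choice.inv \<pi> i := x] ! j"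
    using j assms permutes_in_image[OF assms(1), of j]
    by (auto simp: permute_list_nth nth_list_update)
qed simp

lemma bounded_multilinear_permute:
  assumes f: "bounded_multilinear K n f" and \<pi>: "\<pi> permutes {..<n}"
  shows "bounded_multilinear K n (\<lambda>xs. f (permute_list \<pi> xs))"
proof -
  obtain C where C: "\<And>xs. xs \<in> tuples (hcar K) n \<Longrightarrow> \<bar>f xs\<bar> \<le> C * prod_list (map (hnorm K) xs)"
    using f unfolding bounded_multilinear_def by blast
  have mem: "permute_list \<pi> xs \<in> tuples (hcar K) n \<longleftrightarrow> xs \<in> tuples (hcar K) n" for xs
    using \<pi> by (auto simp: tuples_def)
  show ?thesis
  proof (rule bounded_multilinearI)
    fix xs assume "xs \<notin> tuples (hcar K) n"
    then show "f (permute_list \<pi> xs) = 0"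
      using bounded_multilinear_outside[OF f] mem by blast
  next
    fix xs i x y a
    assume xs: "xs \<in> tuples (hcar K) n" "i < n" "x \<in> hcar K" "y \<in> hcar K"
    then have len: "length xs = n"
      by (simp add: tuples_def)
    have upd: "permute_list \<pi> (xs[i := z]) = (permute_list \<pi> xs)[Hilbert_Choice.inv \<pi> i := z]" for z
      using len xs(2) \<pi> by (intro permute_list_update) auto
    have "Hilbert_Choice.inv \<pi> i < n"
      using permutes_in_image[OF permutes_inv[OF \<pi>], of i] xs(2) by simp
    then show "f (permute_list \<pi> (xs[i := a *\<^sub>R x + y])) =
        a * f (permute_list \<pi> (xs[i := x])) + f (permute_list \<pi> (xs[i := y]))"
      unfolding upd using xs mem by (intro bounded_multilinear_update[OF f]) auto
  next
    fix xs assume xs: "xs \<in> tuples (hcar K) n"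
    then have "mset (permute_list \<pi> xs) = mset xs"
      using \<pi> by (intro mset_permute_list) (simp add: tuples_def)
    then have "prod_list (map (hnorm K) (permute_list \<pi> xs)) = prod_list (map (hnorm K) xs)"
      by (metis mset_map prod_mset_prod_list)
    then show "\<bar>f (permute_list \<pi> xs)\<bar> \<le> C * prod_list (map (hnorm K) xs)"
      using C[of "permute_list \<pi> xs"] xs mem by simp
  qed
qed

lemma bounded_multilinear_Pq:
  assumes "prehilbert K" "bounded_multilinear K n f"
  shows "bounded_multilinear K n (Pq q n f)"
  unfolding Pq_def
  by (rule bounded_multilinear_sum[OF assms(1)], rule bounded_multilinear_scale,
      rule bounded_multilinear_permute[OF assms(2)]) (auto simp: permutes_inv)

lemma bounded_multilinear_tensor:
  assumes K: "prehilbert K" and f: "bounded_multilinear K i f" and g: "bounded_multilinear K m g"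
  shows "bounded_multilinear K (i + m) (\<lambda>xs. f (take i xs) * g (drop i xs))"
proof -
  obtain C where "C \<ge> 0" and
    C: "\<And>xs. xs \<in> tuples (hcar K) i \<Longrightarrow> \<bar>f xs\<bar> \<le> C * prod_list (map (hnorm K) xs)"
    using bounded_multilinear_bound[OF K f] by blast
  obtain D where "D \<ge> 0" and
    D: "\<And>xs. xs \<in> tuples (hcar K) m \<Longrightarrow> \<bar>g xs\<bar> \<le> D * prod_list (map (hnorm K) xs)"
    using bounded_multilinear_bound[OF K g] by blast
  have mem: "take i xs \<in> tuples (hcar K) i" "drop i xs \<in> tuples (hcar K) m"
    if "xs \<in> tuples (hcar K) (i + m)" for xs
    using that by (auto simp: tuples_def dest: in_set_takeD in_set_dropD)
  have mem_conv: "xs \<in> tuples (hcar K) (i + m)"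
    if "take i xs \<in> tuples (hcar K) i" "drop i xs \<in> tuples (hcar K) m" for xs
  proof -
    have "take i xs @ drop i xs \<in> tuples (hcar K) (i + m)"
      using that unfolding tuples_def mem_Collect_eq length_append set_append by (metis Un_least)
    then show ?thesis
      by simp
  qed
  show ?thesis
  proof (rule bounded_multilinearI)
    fix xs assume "xs \<notin> tuples (hcar K) (i + m)"
    then show "f (take i xs) * g (drop i xs) = 0"
      using mem_conv[of xs] bounded_multilinear_outside[OF f] bounded_multilinear_outside[OF g]
      by (metis mult_eq_0_iff)
  next
    fix xs j x y a
    assume xs: "xs \<in> tuples (hcar K) (i + m)" "j < i + m" "x \<in> hcar K" "y \<in> hcar K"
    show "f (take i (xs[j := a *\<^sub>R x + y])) * g (drop i (xs[j := a *\<^sub>R x + y])) =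
        a * (f (take i (xs[j := x])) * g (drop i (xs[j := x]))) +
        f (take i (xs[j := y])) * g (drop i (xs[j := y]))"
    proof (cases "j < i")
      case True
      then show ?thesis
        using bounded_multilinear_update[OF f mem(1)[OF xs(1)] True xs(3,4), of a]
        by (simp add: take_update_swap algebra_simps)
    next
      case False
      then have "j - i < m"
        using xs(2) by simp
      then show ?thesis
        using bounded_multilinear_update[OF g mem(2)[OF xs(1)] _ xs(3,4), of "j - i" a] False
        by (simp add: drop_update_swap algebra_simps)
    qed
  next
    fix xs assume xs: "xs \<in> tuples (hcar K) (i + m)"
    have "\<bar>f (take i xs) * g (drop i xs)\<bar> \<le>
        (C * prod_list (map (hnorm K) (take i xs))) * (D * prod_list (map (hnorm K) (drop i xs)))"
      unfolding abs_mult using mem[OF xs] \<open>C \<ge> 0\<close> \<open>D \<ge> 0\<close>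
      by (intro mult_mono C D mult_nonneg_nonneg prod_list_hnorm_nonneg[OF K])
        (auto simp: tuples_def)
    also have "\<dots> = (C * D) * (prod_list (map (hnorm K) (take i xs)) * prod_list (map (hnorm K) (drop i xs)))"
      by (simp add: mult_ac)
    also have "\<dots> = (C * D) * prod_list (map (hnorm K) xs)"
      by (simp flip: prod_list.append map_append)
    finally show "\<bar>f (take i xs) * g (drop i xs)\<bar> \<le> C * D * prod_list (map (hnorm K) xs)" .
  qed
qed

lemma bounded_multilinear_Cons:
  assumes K: "prehilbert K" and f: "bounded_multilinear K (Suc n) f" and x: "x \<in> hcar K"
  shows "bounded_multilinear K n (\<lambda>xs. f (x # xs))"
proof -
  obtain C where
    C: "\<And>xs. xs \<in> tuples (hcar K) (Suc n) \<Longrightarrow> \<bar>f xs\<bar> \<le> C * prod_list (map (hnorm K) xs)"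
    using f unfolding bounded_multilinear_def by blast
  have mem: "x # xs \<in> tuples (hcar K) (Suc n) \<longleftrightarrow> xs \<in> tuples (hcar K) n" for xs
    using x by (auto simp: tuples_def)
  show ?thesis
  proof (rule bounded_multilinearI)
    fix xs assume "xs \<notin> tuples (hcar K) n"
    then show "f (x # xs) = 0"
      using bounded_multilinear_outside[OF f] mem by blast
  next
    fix xs i y z a
    assume "xs \<in> tuples (hcar K) n" "i < n" "y \<in> hcar K" "z \<in> hcar K"
    then show "f (x # xs[i := a *\<^sub>R y + z]) = a * f (x # xs[i := y]) + f (x # xs[i := z])"
      using bounded_multilinear_update[OF f, of "x # xs" "Suc i" y z a] mem by simp
  next
    fix xs assume "xs \<in> tuples (hcar K) n"
    then show "\<bar>f (x # xs)\<bar> \<le> (C * hnorm K x) * prod_list (map (hnorm K) xs)"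
      using C[of "x # xs"] mem by (simp add: mult_ac)
  qed
qed

lemma bounded_multilinear_first:
  assumes "bounded_multilinear K (Suc n) f" "xs \<in> tuples (hcar K) n" "x \<in> hcar K" "y \<in> hcar K"
  shows "f ((a *\<^sub>R x + y) # xs) = a * f (x # xs) + f (y # xs)"
  using bounded_multilinear_update[OF assms(1), of "x # xs" 0 x y a] assms(2-4)
  by (simp add: tuples_def)

lemma bounded_multilinear_first_bound:
  assumes "bounded_multilinear K (Suc n) f" "xs \<in> tuples (hcar K) n"
  obtains C where "\<And>x. x \<in> hcar K \<Longrightarrow> \<bar>f (x # xs)\<bar> \<le> C * hnorm K x"
proof -
  obtain C where
    C: "\<And>xs. xs \<in> tuples (hcar K) (Suc n) \<Longrightarrow> \<bar>f xs\<bar> \<le> C * prod_list (map (hnorm K) xs)"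
    using assms(1) unfolding bounded_multilinear_def by blast
  have "\<bar>f (x # xs)\<bar> \<le> (C * prod_list (map (hnorm K) xs)) * hnorm K x" if "x \<in> hcar K" for x
    using C[of "x # xs"] assms(2) that by (simp add: mult_ac tuples_def)
  then show ?thesis
    using that by blast
qed

text \<open>The bound is taken at least \<open>1\<close>, so that it is positive and gives a base \<open>\<ge> 1\<close> of exponential
growth.\<close>

locale bounded_linear_map =
  L: prehilbert L + M: prehilbert M
  for L :: "'v::real_vector hspace" and M :: "'w::real_vector hspace" +
  fixes A :: "'v \<Rightarrow> 'w" and D :: real
  assumes A_mem: "\<And>x. x \<in> hcar L \<Longrightarrow> A x \<in> hcar M"
    and A_lin: "\<And>x y a. x \<in> hcar L \<Longrightarrow> y \<in> hcar L \<Longrightarrow> A (a *\<^sub>R x + y) = a *\<^sub>R A x + A y"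
    and A_bound: "\<And>x. x \<in> hcar L \<Longrightarrow> hnorm M (A x) \<le> D * hnorm L x"
    and D_ge_1: "D \<ge> 1"
begin

text \<open>The map is applied to the first argument by \<open>nn_integral_orthonormal_le\<close>, with the other arguments
fixed, and to these by induction; the two kinds of sums are exchanged in between.\<close>

lemma sqnorm_comp_le:
  assumes E: "orthonormal L E" and B: "is_onb M B" and f: "bounded_multilinear M n f"
  shows "sqnorm E n (\<lambda>xs. f (map A xs)) \<le> ennreal (D\<^sup>2) ^ n * sqnorm B n f"
  using f
proof (induction n arbitrary: f)
  case 0
  then show ?case
    by (simp add: sqnorm_0)
next
  case (Suc n)
  have EL: "e \<in> hcar L" if "e \<in> E" for e
    using E that by (auto simp: orthonormal_def)
  have BM: "xs \<in> tuples (hcar M) n" if "xs \<in> tuples B n" for xs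
    using B that by (auto simp: is_onb_def tuples_def)
  let ?d = "ennreal (D\<^sup>2)"
  have "(\<integral>\<^sup>+e. sqnorm B n (\<lambda>xs. f (A e # xs)) \<partial>count_space E) =
      (\<integral>\<^sup>+xs. \<integral>\<^sup>+e. ennreal ((f (A e # xs))\<^sup>2) \<partial>count_space E \<partial>count_space (tuples B n))"
    unfolding sqnorm_def by (rule nn_integral_count_space_swap)
  also have "\<dots> \<le> (\<integral>\<^sup>+xs. ?d * (\<integral>\<^sup>+b. ennreal ((f (b # xs))\<^sup>2) \<partial>count_space B) \<partial>count_space (tuples B n))"
  proof (rule nn_integral_mono)
    fix xs assume "xs \<in> space (count_space (tuples B n))"
    then have xs: "xs \<in> tuples (hcar M) n"
      using BM by simp
    obtain C where C: "\<And>x. x \<in> hcar M \<Longrightarrow> \<bar>f (x # xs)\<bar> \<le> C * hnorm M x"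
      using bounded_multilinear_first_bound[OF Suc.prems xs] by blast
    show "(\<integral>\<^sup>+e. ennreal ((f (A e # xs))\<^sup>2) \<partial>count_space E) \<le>
        ?d * (\<integral>\<^sup>+b. ennreal ((f (b # xs))\<^sup>2) \<partial>count_space B)"
      using nn_integral_orthonormal_le[OF L.prehilbert_axioms M.prehilbert_axioms E B A_mem A_lin
          A_bound D_ge_1, of "\<lambda>x. f (x # xs)" C] C bounded_multilinear_first[OF Suc.prems xs]
      by blast
  qed
  also have "\<dots> = ?d * (\<integral>\<^sup>+xs. \<integral>\<^sup>+b. ennreal ((f (b # xs))\<^sup>2) \<partial>count_space B \<partial>count_space (tuples B n))"
    by (simp add: nn_integral_cmult)
  also have "(\<integral>\<^sup>+xs. \<integral>\<^sup>+b. ennreal ((f (b # xs))\<^sup>2) \<partial>count_space B \<partial>count_space (tuples B n)) =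
      sqnorm B (Suc n) f"
    unfolding sqnorm_Suc unfolding sqnorm_def by (rule nn_integral_count_space_swap)
  finally have first: "(\<integral>\<^sup>+e. sqnorm B n (\<lambda>xs. f (A e # xs)) \<partial>count_space E) \<le>
      ?d * sqnorm B (Suc n) f" .
  have "sqnorm E (Suc n) (\<lambda>xs. f (map A xs)) =
      (\<integral>\<^sup>+e. sqnorm E n (\<lambda>xs. f (A e # map A xs)) \<partial>count_space E)"
    by (simp add: sqnorm_Suc)
  also have "\<dots> \<le> (\<integral>\<^sup>+e. ?d ^ n * sqnorm B n (\<lambda>xs. f (A e # xs)) \<partial>count_space E)"
    using EL A_mem
    by (intro nn_integral_mono Suc.IH bounded_multilinear_Cons[OF M.prehilbert_axioms Suc.prems]) simp
  also have "\<dots> = ?d ^ n * (\<integral>\<^sup>+e. sqnorm B n (\<lambda>xs. f (A e # xs)) \<partial>count_space E)"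
    by (simp add: nn_integral_cmult)
  also have "\<dots> \<le> ?d ^ n * (?d * sqnorm B (Suc n) f)"
    using first by (rule mult_left_mono) simp
  also have "\<dots> = ?d ^ Suc n * sqnorm B (Suc n) f"
    by (simp only: power_Suc2 mult.assoc)
  finally show ?case .
qed

text \<open>Cut off outside of the tuples, as the elements of \<^const>\<open>tensor_power\<close> are.\<close>

definition pullback :: "nat \<Rightarrow> ('w list \<Rightarrow> real) \<Rightarrow> 'v list \<Rightarrow> real" where
  "pullback n f xs = (if xs \<in> tuples (hcar L) n then f (map A xs) else 0)"

lemma bounded_multilinear_pullback:
  assumes f: "bounded_multilinear M n f"
  shows "bounded_multilinear L n (pullback n f)"
proof -
  obtain C where "C \<ge> 0" and
    C: "\<And>xs. xs \<in> tuples (hcar M) n \<Longrightarrow> \<bar>f xs\<bar> \<le> C * prod_list (map (hnorm M) xs)"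
    using bounded_multilinear_bound[OF M.prehilbert_axioms f] by blast
  have mem: "map A xs \<in> tuples (hcar M) n" if "xs \<in> tuples (hcar L) n" for xs
    using that A_mem by (auto simp: tuples_def)
  have upd: "xs[i := x] \<in> tuples (hcar L) n" if "xs \<in> tuples (hcar L) n" "x \<in> hcar L" for xs i x
    using that set_update_subset_insert[of xs i x] by (auto simp: tuples_def)
  have prod: "0 \<le> prod_list (map (hnorm M) (map A xs)) \<and>
      prod_list (map (hnorm M) (map A xs)) \<le> D ^ length xs * prod_list (map (hnorm L) xs)"
    if "set xs \<subseteq> hcar L" for xs
    using that
  proof (induction xs)
    case (Cons x xs)
    have "hnorm M (A x) * prod_list (map (hnorm M) (map A xs)) \<le>
        (D * hnorm L x) * (D ^ length xs * prod_list (map (hnorm L) xs))"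
      using Cons A_mem D_ge_1 by (intro mult_mono A_bound) (auto simp: L.hnorm_nonneg)
    then show ?case
      using Cons A_mem by (auto simp: M.hnorm_nonneg mult_ac)
  qed simp
  show ?thesis
  proof (rule bounded_multilinearI)
    fix xs i x y a
    assume xs: "xs \<in> tuples (hcar L) n" "i < n" "x \<in> hcar L" "y \<in> hcar L"
    then show "pullback n f (xs[i := a *\<^sub>R x + y]) =
        a * pullback n f (xs[i := x]) + pullback n f (xs[i := y])"
      using bounded_multilinear_update[OF f mem[OF xs(1)] xs(2) A_mem[OF xs(3)] A_mem[OF xs(4)], of a]
      by (simp add: pullback_def upd map_update A_lin)
  next
    fix xs assume xs: "xs \<in> tuples (hcar L) n"
    have "\<bar>f (map A xs)\<bar> \<le> C * prod_list (map (hnorm M) (map A xs))"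
      using mem[OF xs] by (rule C)
    also have "\<dots> \<le> C * (D ^ n * prod_list (map (hnorm L) xs))"
      using prod[of xs] xs \<open>C \<ge> 0\<close> by (intro mult_left_mono) (auto simp: tuples_def)
    finally show "\<bar>pullback n f xs\<bar> \<le> (C * D ^ n) * prod_list (map (hnorm L) xs)"
      using xs by (simp add: pullback_def mult.assoc)
  qed (simp add: pullback_def)
qed

lemma Pq_pullback:
  assumes "xs \<in> tuples (hcar L) n"
  shows "Pq q n (pullback n f) xs = Pq q n f (map A xs)"
  unfolding Pq_def
proof (rule sum.cong[OF refl])
  fix \<pi> assume "\<pi> \<in> {\<pi>. \<pi> permutes {..<n}}"
  then have "Hilbert_Choice.inv \<pi> permutes {..<length xs}"
    using assms by (simp add: permutes_inv tuples_def)
  then show "q ^ inversions n \<pi> * pullback n f (permute_list (Hilbert_Choice.inv \<pi>) xs) =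
      q ^ inversions n \<pi> * f (permute_list (Hilbert_Choice.inv \<pi>) (map A xs))"
    using assms by (auto simp: pullback_def permute_list_map tuples_def)
qed

lemma sqnorm_pullback_le:
  assumes E: "orthonormal L E" and B: "is_onb M B" and f: "bounded_multilinear M n f"
  shows "sqnorm E n (pullback n f) \<le> ennreal (D\<^sup>2) ^ n * sqnorm B n f"
    and "sqnorm E n (Pq q n (pullback n f)) \<le> ennreal (D\<^sup>2) ^ n * sqnorm B n (Pq q n f)"
proof -
  have EL: "xs \<in> tuples (hcar L) n" if "xs \<in> tuples E n" for xs
    using E that by (auto simp: orthonormal_def tuples_def)
  have "sqnorm E n (pullback n f) = sqnorm E n (\<lambda>xs. f (map A xs))"
    by (rule sqnorm_cong) (simp add: pullback_def EL)
  then show "sqnorm E n (pullback n f) \<le> ennreal (D\<^sup>2) ^ n * sqnorm B n f"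
    using sqnorm_comp_le[OF E B f] by simp
  have "sqnorm E n (Pq q n (pullback n f)) = sqnorm E n (\<lambda>xs. Pq q n f (map A xs))"
    by (rule sqnorm_cong) (simp add: Pq_pullback EL)
  then show "sqnorm E n (Pq q n (pullback n f)) \<le> ennreal (D\<^sup>2) ^ n * sqnorm B n (Pq q n f)"
    using sqnorm_comp_le[OF E B bounded_multilinear_Pq[OF M.prehilbert_axioms f]] by simp
qed

end

section \<open>Sequences of exponential growth\<close>

lemma qint_bounds:
  assumes "0 \<le> p" "p < 1" "n \<ge> 1"
  shows "1 \<le> qint p n" "qint p n \<le> 1 / (1 - p)"
proof -
  have "(\<Sum>i<1. p ^ i) \<le> (\<Sum>i<n. p ^ i)"
    using assms by (intro sum_mono2) auto
  then show "1 \<le> qint p n"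
    by (simp add: qint_def)
  have "(1 - p) * qint p n = 1 - p ^ n"
    by (simp add: qint_def one_diff_power_eq)
  also have "\<dots> \<le> 1"
    using assms by simp
  finally show "qint p n \<le> 1 / (1 - p)"
    using assms by (simp add: field_simps)
qed

lemma qfact_bounds:
  assumes "0 \<le> p" "p < 1"
  shows "1 \<le> qfact p n" "qfact p n \<le> (1 / (1 - p)) ^ n"
proof -
  show "1 \<le> qfact p n"
    unfolding qfact_def using qint_bounds(1)[OF assms] by (intro prod_ge_1) auto
  have "qfact p n \<le> (\<Prod>k=1..n. 1 / (1 - p))"
    unfolding qfact_def using qint_bounds[OF assms] by (intro prod_mono) (auto intro: order_trans[of 0 1])
  then show "qfact p n \<le> (1 / (1 - p)) ^ n"
    by simp
qed

text \<open>For \<open>\<bar>q\<bar> < 1\<close> the union over \<open>r \<ge> 1\<close> of the carriers of \<open>F\<^sub>q(K, r\<^sup>-\<^sup>1, -2)\<close>, described without the weights.\<close>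

definition exp_bounded :: "real \<Rightarrow> 'v::real_vector hspace \<Rightarrow> (nat \<Rightarrow> 'v list \<Rightarrow> real) \<Rightarrow> bool" where
  "exp_bounded q K F \<longleftrightarrow>
     (\<forall>n. F n \<in> hcar (tensor_power K n)) \<and>
     (\<exists>M C. 0 \<le> M \<and> 1 \<le> C \<and> (\<forall>n. sqnorm (onb K) n (Pq q n (F n)) \<le> ennreal (M * C ^ n)))"

lemma hip_Fqn_eq_sqnorm:
  assumes "f \<in> hcar (tensor_power K n)"
  shows "sqnorm (onb K) n (Pq q n f) = ennreal (hip (Fqn q K n) f f)" "0 \<le> hip (Fqn q K n) f f"
proof -
  have hip: "hip (Fqn q K n) f f = (\<Sum>\<^sub>\<infinity>es\<in>tuples (onb K) n. (Pq q n f es)\<^sup>2)"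
    by (simp add: Fqn_def tensor_power_def power2_eq_square)
  have "sqnorm (onb K) n (Pq q n f) < \<infinity>"
    using assms by (intro sqnorm_Pq_finite) (simp add: mem_tensor_power_iff)
  then show "sqnorm (onb K) n (Pq q n f) = ennreal (hip (Fqn q K n) f f)"
    unfolding hip by (rule sqnorm_eq_infsum)
  show "0 \<le> hip (Fqn q K n) f f"
    unfolding hip by (rule infsum_nonneg) simp
qed

lemma mem_Fq_iff:
  "F \<in> hcar (Fq q K r \<alpha>) \<longleftrightarrow>
    (\<forall>n. F n \<in> hcar (tensor_power K n)) \<and>
    summable (\<lambda>n. r ^ n * qfact \<bar>q\<bar> n powr \<alpha> * hip (Fqn q K n) (F n) (F n))"
  by (simp add: Fq_def hsum_def hscale_def Fqn_def)

text \<open>The terms of a convergent series are bounded, and the weight \<open>r\<^sup>-\<^sup>n [n]!\<^sup>-\<^sup>2\<close> is at least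
\<open>(r c\<^sup>2)\<^sup>-\<^sup>n\<close> with \<open>c = 1 / (1 - \<bar>q\<bar>)\<close>.  Conversely \<open>r = 2 C\<close> turns a bound \<open>M C\<^sup>n\<close> into a geometric
series.\<close>

lemma ex_mem_Fq_iff_exp_bounded:
  assumes q: "\<bar>q\<bar> < 1"
  shows "(\<exists>r\<ge>1. F \<in> hcar (Fq q K (1 / r) (-2))) \<longleftrightarrow> exp_bounded q K F"
proof
  define Q where "Q n = qfact \<bar>q\<bar> n" for n
  define N where "N n = hip (Fqn q K n) (F n) (F n)" for n
  define c where "c = 1 / (1 - \<bar>q\<bar>)"
  have Q1: "1 \<le> Q n" and Qc: "Q n \<le> c ^ n" for n
    using qfact_bounds[of "\<bar>q\<bar>" n] q by (auto simp: Q_def c_def)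
  have c1: "1 \<le> c"
    using q by (simp add: c_def)
  have powr: "Q n powr (-2) = 1 / (Q n)\<^sup>2" for n
    using Q1[of n] by (simp add: powr_minus divide_inverse)
  {
    assume "\<exists>r\<ge>1. F \<in> hcar (Fq q K (1 / r) (-2))"
    then obtain r where r: "1 \<le> r" and F: "\<And>n. F n \<in> hcar (tensor_power K n)"
      and "summable (\<lambda>n. (1 / r) ^ n * Q n powr (-2) * N n)"
      by (auto simp: mem_Fq_iff Q_def N_def)
    then have "Bseq (\<lambda>n. (1 / r) ^ n * Q n powr (-2) * N n)"
      by (intro convergent_imp_Bseq) (auto simp: convergent_def intro: summable_LIMSEQ_zero)
    then obtain M where "M > 0" and M: "\<And>n. norm ((1 / r) ^ n * Q n powr (-2) * N n) \<le> M"
      by (auto simp: Bseq_def)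
    have "N n \<le> M * (r * c\<^sup>2) ^ n" for n
    proof -
      have p: "0 < r ^ n * (Q n)\<^sup>2"
        using r Q1[of n] by (intro mult_pos_pos zero_less_power) auto
      have "N n / (r ^ n * (Q n)\<^sup>2) = (1 / r) ^ n * Q n powr (-2) * N n"
        by (simp add: powr power_divide)
      also have "\<dots> \<le> M"
        by (rule order_trans[OF _ M[of n]]) simp
      finally have "N n / (r ^ n * (Q n)\<^sup>2) \<le> M" .
      then have "N n \<le> M * (r ^ n * (Q n)\<^sup>2)"
        using p by (simp only: pos_divide_le_eq)
      also have "\<dots> \<le> M * (r ^ n * (c ^ n)\<^sup>2)"
        using \<open>M > 0\<close> r Qc[of n] Q1[of n] by (intro mult_left_mono power_mono) auto
      also have "\<dots> = M * (r * c\<^sup>2) ^ n"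
        by (simp add: power_mult_distrib flip: power_mult) (simp add: mult.commute)
      finally show ?thesis .
    qed
    moreover have "1 \<le> r * c\<^sup>2"
      using mult_mono[of 1 r 1 "c\<^sup>2"] r c1 by simp
    ultimately show "exp_bounded q K F"
      unfolding exp_bounded_def using \<open>M > 0\<close> F
      by (intro conjI exI[of _ M] exI[of _ "r * c\<^sup>2"])
        (auto simp: hip_Fqn_eq_sqnorm(1) N_def[symmetric] intro: ennreal_leI)
  }
  {
    assume "exp_bounded q K F"
    then obtain M C where F: "\<And>n. F n \<in> hcar (tensor_power K n)" and "0 \<le> M" "1 \<le> C"
      and bound: "\<And>n. sqnorm (onb K) n (Pq q n (F n)) \<le> ennreal (M * C ^ n)"
      unfolding exp_bounded_def by blast
    have N: "0 \<le> N n" "N n \<le> M * C ^ n" for n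
    proof -
      have "ennreal (N n) \<le> ennreal (M * C ^ n)"
        using bound[of n] hip_Fqn_eq_sqnorm(1)[OF F[of n], of q] by (simp add: N_def)
      moreover have "0 \<le> M * C ^ n"
        using \<open>0 \<le> M\<close> \<open>1 \<le> C\<close> by simp
      ultimately show "N n \<le> M * C ^ n"
        by (simp only: ennreal_le_iff)
      show "0 \<le> N n"
        using hip_Fqn_eq_sqnorm(2)[OF F[of n], of q] by (simp add: N_def)
    qed
    have "summable (\<lambda>n. (1 / (2 * C)) ^ n * Q n powr (-2) * N n)"
    proof (rule summable_comparison_test')
      show "summable (\<lambda>n. M * (1 / 2) ^ n)"
        by (intro summable_mult summable_geometric) simp
      show "norm ((1 / (2 * C)) ^ n * Q n powr (-2) * N n) \<le> M * (1 / 2) ^ n" if "0 \<le> n" for n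
      proof -
        have "1 / (Q n)\<^sup>2 \<le> 1"
          using Q1[of n] by (simp add: one_le_power)
        then have "(1 / (2 * C)) ^ n * (1 / (Q n)\<^sup>2) * N n \<le> (1 / (2 * C)) ^ n * 1 * (M * C ^ n)"
          using N \<open>1 \<le> C\<close> by (intro mult_mono) auto
        also have "\<dots> = M * (1 / 2) ^ n"
          using \<open>1 \<le> C\<close> by (simp add: power_divide power_mult_distrib)
        finally show ?thesis
          using N(1)[of n] \<open>1 \<le> C\<close> by (simp add: powr)
      qed
    qed
    then have "F \<in> hcar (Fq q K (1 / (2 * C)) (-2))"
      using F by (simp add: mem_Fq_iff Q_def N_def)
    then show "\<exists>r\<ge>1. F \<in> hcar (Fq q K (1 / r) (-2))"
      using \<open>1 \<le> C\<close> by (intro exI[of _ "2 * C"]) auto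
  }
qed

lemma Pq_add: "Pq q n (\<lambda>xs. f xs + g xs) = (\<lambda>xs. Pq q n f xs + Pq q n g xs)"
  by (simp add: Pq_def fun_eq_iff distrib_left sum.distrib)

lemma Pq_scale: "Pq q n (\<lambda>xs. c * f xs) = (\<lambda>xs. c * Pq q n f xs)"
  by (simp add: Pq_def fun_eq_iff sum_distrib_left mult.left_commute)

lemma Pq_sum: "Pq q n (\<lambda>xs. \<Sum>i\<in>I. f i xs) = (\<lambda>xs. \<Sum>i\<in>I. Pq q n (f i) xs)"
  unfolding Pq_def fun_eq_iff sum_distrib_left by (intro allI sum.swap)

lemma exp_bounded_vacuum:
  assumes "prehilbert K"
  shows "exp_bounded q K vacuum"
proof -
  have bm: "bounded_multilinear K n (vacuum n)" for n
    by (rule bounded_multilinearI[where C = "if n = 0 then 1 else 0"])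
      (auto simp: vacuum_def tuples_def)
  have "sqnorm (onb K) n (Pq q n (vacuum n)) \<le> ennreal (1 * 1 ^ n)
      \<and> sqnorm (onb K) n (vacuum n) < \<infinity>" for n
  proof (cases "n = 0")
    case True
    then show ?thesis
      by (simp add: sqnorm_0 Pq_def inversions_def vacuum_def)
  next
    case False
    then have vac: "vacuum n = (\<lambda>xs. 0)"
      by (simp add: vacuum_def fun_eq_iff)
    show ?thesis
      unfolding vac by (simp add: sqnorm_def Pq_def)
  qed
  then show ?thesis
    unfolding exp_bounded_def mem_tensor_power_iff using bm
    by (intro conjI allI exI[of _ 1]) auto
qed

lemma exp_bounded_scale:
  assumes "exp_bounded q K F"
  shows "exp_bounded q K (c *\<^sub>R F)"
proof -
  obtain M C where F: "\<And>n. F n \<in> hcar (tensor_power K n)" and MC: "0 \<le> M" "1 \<le> C"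
    and N: "\<And>n. sqnorm (onb K) n (Pq q n (F n)) \<le> ennreal (M * C ^ n)"
    using assms unfolding exp_bounded_def by blast
  have eq: "(c *\<^sub>R F) n = (\<lambda>xs. c * F n xs)" for n
    by (simp add: scaleR_fun_def fun_eq_iff)
  have "(c *\<^sub>R F) n \<in> hcar (tensor_power K n)" for n
    using F[of n] by (auto simp: eq mem_tensor_power_iff sqnorm_scale ennreal_mult_less_top
        intro: bounded_multilinear_scale)
  moreover have "sqnorm (onb K) n (Pq q n ((c *\<^sub>R F) n)) \<le> ennreal ((c\<^sup>2 * M) * C ^ n)" for n
  proof -
    have "ennreal (c\<^sup>2) * sqnorm (onb K) n (Pq q n (F n)) \<le> ennreal (c\<^sup>2) * ennreal (M * C ^ n)"
      using N by (rule mult_left_mono) simp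
    then show ?thesis
      using MC by (simp add: eq Pq_scale sqnorm_scale mult.assoc flip: ennreal_mult)
  qed
  ultimately show ?thesis
    unfolding exp_bounded_def using MC by (intro conjI allI exI[of _ "c\<^sup>2 * M"] exI[of _ C]) auto
qed

lemma exp_bounded_add:
  assumes "exp_bounded q K F" "exp_bounded q K G"
  shows "exp_bounded q K (F + G)"
proof -
  obtain M C where F: "\<And>n. F n \<in> hcar (tensor_power K n)" and MC: "0 \<le> M" "1 \<le> C"
    and N: "\<And>n. sqnorm (onb K) n (Pq q n (F n)) \<le> ennreal (M * C ^ n)"
    using assms(1) unfolding exp_bounded_def by blast
  obtain M' C' where G: "\<And>n. G n \<in> hcar (tensor_power K n)" and MC': "0 \<le> M'" "1 \<le> C'"
    and N': "\<And>n. sqnorm (onb K) n (Pq q n (G n)) \<le> ennreal (M' * C' ^ n)"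
    using assms(2) unfolding exp_bounded_def by blast
  have eq: "(F + G) n = (\<lambda>xs. F n xs + G n xs)" for n
    by (simp add: fun_eq_iff)
  have "(F + G) n \<in> hcar (tensor_power K n)" for n
  proof -
    have "sqnorm (onb K) n (\<lambda>xs. F n xs + G n xs) \<le>
        2 * (sqnorm (onb K) n (F n) + sqnorm (onb K) n (G n))"
      by (rule sqnorm_add_le)
    also have "\<dots> < \<infinity>"
      using F[of n] G[of n] by (simp add: mem_tensor_power_iff ennreal_mult_less_top)
    finally show ?thesis
      unfolding eq using F[of n] G[of n]
      by (auto simp: mem_tensor_power_iff intro: bounded_multilinear_add)
  qed
  moreover have "sqnorm (onb K) n (Pq q n ((F + G) n)) \<le> ennreal ((2 * (M + M')) * (max C C') ^ n)" for n
  proof -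
    have "sqnorm (onb K) n (Pq q n ((F + G) n)) \<le>
        2 * (sqnorm (onb K) n (Pq q n (F n)) + sqnorm (onb K) n (Pq q n (G n)))"
      unfolding eq Pq_add by (rule sqnorm_add_le)
    also have "\<dots> \<le> 2 * (ennreal (M * C ^ n) + ennreal (M' * C' ^ n))"
      by (intro mult_left_mono add_mono N N') simp
    also have "\<dots> = ennreal (2 * (M * C ^ n + M' * C' ^ n))"
      using MC MC' by (simp add: ennreal_mult ennreal_plus)
    also have "\<dots> \<le> ennreal (2 * (M * (max C C') ^ n + M' * (max C C') ^ n))"
      using MC MC' by (intro ennreal_leI mult_left_mono add_mono power_mono) auto
    finally show ?thesis
      by (simp add: algebra_simps)
  qed
  ultimately show ?thesis
    unfolding exp_bounded_def using MC MC'
    by (intro conjI allI exI[of _ "2 * (M + M')"] exI[of _ "max C C'"]) auto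
qed

lemma sqnorm_tensor_le:
  "sqnorm B (i + m) (\<lambda>xs. f (take i xs) * g (drop i xs)) \<le> sqnorm B i f * sqnorm B m g"
proof -
  have "{..<i + m} - {..<i} = {i..<i + m}"
    by auto
  then have "sorted_list_of_set {..<i} = [0..<i]" "sorted_list_of_set ({..<i + m} - {..<i}) = [i..<i + m]"
    by (simp_all add: lessThan_atLeast0)
  moreover have "map ((!) xs) [0..<i] = take i xs" "map ((!) xs) [i..<i + m] = drop i xs"
    if "xs \<in> tuples B (i + m)" for xs
    using that by (auto simp: tuples_def intro!: nth_equalityI)
  ultimately have "sqnorm B (i + m) (\<lambda>xs. f (take i xs) * g (drop i xs)) =
      sqnorm B (i + m) (\<lambda>xs. f (map ((!) xs) (sorted_list_of_set {..<i})) *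
        g (map ((!) xs) (sorted_list_of_set ({..<i + m} - {..<i}))))"
    by (intro sqnorm_cong) simp
  then show ?thesis
    using sqnorm_split_le[of "{..<i}" i m B f g] by simp
qed

lemma tensor_mult_mem_tensor_power:
  assumes K: "prehilbert K"
    and F: "\<And>n. F n \<in> hcar (tensor_power K n)" and G: "\<And>n. G n \<in> hcar (tensor_power K n)"
  shows "tensor_mult F G n \<in> hcar (tensor_power K n)"
proof -
  have "bounded_multilinear K n (\<lambda>xs. F i (take i xs) * G (n - i) (drop i xs))"
    and "sqnorm (onb K) n (\<lambda>xs. F i (take i xs) * G (n - i) (drop i xs)) < \<infinity>" if "i \<le> n" for i
  proof -
    have n: "i + (n - i) = n"
      using that by simp
    show "bounded_multilinear K n (\<lambda>xs. F i (take i xs) * G (n - i) (drop i xs))"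
      using bounded_multilinear_tensor[OF K, of i "F i" "n - i" "G (n - i)"] F[of i] G[of "n - i"]
      by (simp add: mem_tensor_power_iff n)
    have "sqnorm (onb K) n (\<lambda>xs. F i (take i xs) * G (n - i) (drop i xs)) \<le>
        sqnorm (onb K) i (F i) * sqnorm (onb K) (n - i) (G (n - i))"
      using sqnorm_tensor_le[of "onb K" i "n - i" "F i" "G (n - i)"] by (simp add: n)
    also have "\<dots> < \<infinity>"
      using F[of i] G[of "n - i"] by (simp add: mem_tensor_power_iff ennreal_mult_less_top)
    finally show "sqnorm (onb K) n (\<lambda>xs. F i (take i xs) * G (n - i) (drop i xs)) < \<infinity>" .
  qed
  note * = this
  have "sqnorm (onb K) n (tensor_mult F G n) \<le> of_nat (card {..n}) *
      (\<Sum>i\<le>n. sqnorm (onb K) n (\<lambda>xs. F i (take i xs) * G (n - i) (drop i xs)))"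
    unfolding tensor_mult_def by (rule sqnorm_sum_le) simp
  also have "\<dots> < \<infinity>"
    using *(2) by (simp add: ennreal_mult_less_top of_nat_less_top)
  finally have "sqnorm (onb K) n (tensor_mult F G n) < \<infinity>" .
  moreover have "bounded_multilinear K n (tensor_mult F G n)"
    unfolding tensor_mult_def using *(1) by (intro bounded_multilinear_sum[OF K]) simp
  ultimately show ?thesis
    by (simp add: mem_tensor_power_iff)
qed

text \<open>The component of degree \<open>n\<close> has \<open>n + 1 \<le> 2\<^sup>n\<close> summands.  The square of the sum contributes two
such factors and \<open>sqnorm_Pq_tensor_le\<close> a factor \<open>4\<^sup>n\<close>, which gives the \<open>16\<close>.\<close>

lemma exp_bounded_tensor_mult:
  assumes q: "\<bar>q\<bar> \<le> 1" and K: "prehilbert K"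
    and "exp_bounded q K F" "exp_bounded q K G"
  shows "exp_bounded q K (tensor_mult F G)"
proof -
  obtain M C where F: "\<And>n. F n \<in> hcar (tensor_power K n)" and MC: "0 \<le> M" "1 \<le> C"
    and N: "\<And>n. sqnorm (onb K) n (Pq q n (F n)) \<le> ennreal (M * C ^ n)"
    using assms(3) unfolding exp_bounded_def by blast
  obtain M' C' where G: "\<And>n. G n \<in> hcar (tensor_power K n)" and MC': "0 \<le> M'" "1 \<le> C'"
    and N': "\<And>n. sqnorm (onb K) n (Pq q n (G n)) \<le> ennreal (M' * C' ^ n)"
    using assms(4) unfolding exp_bounded_def by blast
  have "sqnorm (onb K) n (Pq q n (tensor_mult F G n)) \<le> ennreal ((M * M') * (16 * (C * C')) ^ n)" for n
  proof -
    let ?t = "\<lambda>i xs. F i (take i xs) * G (n - i) (drop i xs)"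
    let ?b = "4 ^ n * ((M * M') * (C * C') ^ n)"
    have summand: "sqnorm (onb K) n (Pq q n (?t i)) \<le> ennreal ?b" if "i \<le> n" for i
    proof -
      have n: "i + (n - i) = n"
        using that by simp
      have "sqnorm (onb K) n (Pq q n (?t i)) \<le> 4 ^ n *
          (sqnorm (onb K) i (Pq q i (F i)) * sqnorm (onb K) (n - i) (Pq q (n - i) (G (n - i))))"
        using sqnorm_Pq_tensor_le[OF q, of "onb K" i "n - i" "F i" "G (n - i)"] by (simp add: n)
      also have "\<dots> \<le> 4 ^ n * (ennreal (M * C ^ i) * ennreal (M' * C' ^ (n - i)))"
        by (intro mult_left_mono mult_mono N N') auto
      also have "\<dots> = ennreal (4 ^ n * ((M * C ^ i) * (M' * C' ^ (n - i))))"
        using MC MC' by (simp add: ennreal_mult flip: ennreal_power)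
      also have "\<dots> \<le> ennreal (4 ^ n * ((M * C ^ n) * (M' * C' ^ n)))"
        using MC MC' that
        by (intro ennreal_leI mult_left_mono mult_mono power_increasing) auto
      finally show ?thesis
        by (simp add: power_mult_distrib mult_ac)
    qed
    have "sqnorm (onb K) n (Pq q n (tensor_mult F G n)) \<le>
        of_nat (card {..n}) * (\<Sum>i\<le>n. sqnorm (onb K) n (Pq q n (?t i)))"
      unfolding tensor_mult_def Pq_sum by (rule sqnorm_sum_le) simp
    also have "\<dots> \<le> of_nat (card {..n}) * (\<Sum>i\<le>n. ennreal ?b)"
      using summand by (intro mult_left_mono sum_mono) auto
    also have "\<dots> = ennreal (real (Suc n) * (real (Suc n) * ?b))"
      using MC MC' by (simp add: ennreal_mult ennreal_of_nat_eq_real_of_nat del: of_nat_Suc)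
    also have "\<dots> \<le> ennreal (2 ^ n * (2 ^ n * ?b))"
    proof -
      have "real (Suc n) \<le> 2 ^ n"
        using Bernoulli_inequality[of 1 n] by simp
      then show ?thesis
        using MC MC' by (intro ennreal_leI mult_mono) auto
    qed
    also have "2 ^ n * (2 ^ n * ?b) = (M * M') * (16 * (C * C')) ^ n"
    proof -
      have "(16::real) ^ n = 2 ^ n * (2 ^ n * 4 ^ n)"
        by (simp flip: power_mult_distrib)
      then show ?thesis
        unfolding power_mult_distrib[of 16 "C * C'"] by (simp only: mult_ac)
    qed
    finally show ?thesis .
  qed
  moreover have "1 \<le> 16 * (C * C')"
    using mult_mono[of 1 C 1 C'] MC MC' by simp
  ultimately show ?thesis
    unfolding exp_bounded_def using MC MC' tensor_mult_mem_tensor_power[OF K F G]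
    by (intro conjI allI exI[of _ "M * M'"] exI[of _ "16 * (C * C')"]) auto
qed

lemma (in bounded_linear_map) exp_bounded_pullback:
  assumes L: "is_onb L (onb L)" and M: "is_onb M (onb M)" and F: "exp_bounded q M F"
  shows "exp_bounded q L (\<lambda>n. pullback n (F n))"
proof -
  obtain N C where Fm: "\<And>n. F n \<in> hcar (tensor_power M n)" and NC: "0 \<le> N" "1 \<le> C"
    and bnd: "\<And>n. sqnorm (onb M) n (Pq q n (F n)) \<le> ennreal (N * C ^ n)"
    using F unfolding exp_bounded_def by blast
  have on: "orthonormal L (onb L)"
    using L by (simp add: is_onb_iff)
  have bm: "bounded_multilinear M n (F n)" for n
    using Fm by (simp add: mem_tensor_power_iff)
  have "pullback n (F n) \<in> hcar (tensor_power L n)" for n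
  proof -
    have "sqnorm (onb L) n (pullback n (F n)) \<le> ennreal (D\<^sup>2) ^ n * sqnorm (onb M) n (F n)"
      by (rule sqnorm_pullback_le(1)[OF on M bm])
    also have "\<dots> < \<infinity>"
      using Fm[of n] by (simp add: mem_tensor_power_iff ennreal_mult_less_top ennreal_power)
    finally show ?thesis
      using bounded_multilinear_pullback[OF bm] by (simp add: mem_tensor_power_iff)
  qed
  moreover have "sqnorm (onb L) n (Pq q n (pullback n (F n))) \<le> ennreal (N * (D\<^sup>2 * C) ^ n)" for n
  proof -
    have "sqnorm (onb L) n (Pq q n (pullback n (F n))) \<le>
        ennreal (D\<^sup>2) ^ n * sqnorm (onb M) n (Pq q n (F n))"
      by (rule sqnorm_pullback_le(2)[OF on M bm])
    also have "\<dots> \<le> ennreal (D\<^sup>2) ^ n * ennreal (N * C ^ n)"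
      using bnd by (rule mult_left_mono) simp
    also have "\<dots> = ennreal (N * (D\<^sup>2 * C) ^ n)"
      using NC by (simp add: ennreal_power power_mult_distrib mult_ac flip: ennreal_mult)
    finally show ?thesis .
  qed
  moreover have "1 \<le> D\<^sup>2 * C"
    using mult_mono[of 1 "D\<^sup>2" 1 C] D_ge_1 NC by simp
  ultimately show ?thesis
    unfolding exp_bounded_def using NC by blast
qed

section \<open>Restriction to a smaller space\<close>

lemma densely_embedded_trans:
  assumes "hilbert_space K" "hilbert_space L" "densely_embedded J K" "densely_embedded K L"
  shows "densely_embedded J L"
proof -
  interpret K: prehilbert K
    using assms(1) by (rule hilbert_space_imp_prehilbert)
  interpret L: prehilbert L
    using assms(2) by (rule hilbert_space_imp_prehilbert)
  obtain C where JK: "hcar J \<subseteq> hcar K" and C: "\<And>x. x \<in> hcar J \<Longrightarrow> hnorm K x \<le> C * hnorm J x"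
    and dJK: "\<And>x e. x \<in> hcar K \<Longrightarrow> e > 0 \<Longrightarrow> \<exists>d\<in>hcar J. hnorm K (x - d) < e"
    using assms(3) unfolding densely_embedded_def dense_subset_def by blast
  obtain D where KL: "hcar K \<subseteq> hcar L" and D: "\<And>x. x \<in> hcar K \<Longrightarrow> hnorm L x \<le> D * hnorm K x"
    and dKL: "\<And>x e. x \<in> hcar L \<Longrightarrow> e > 0 \<Longrightarrow> \<exists>d\<in>hcar K. hnorm L (x - d) < e"
    using assms(4) unfolding densely_embedded_def dense_subset_def by blast
  have D': "hnorm L x \<le> \<bar>D\<bar> * hnorm K x" if "x \<in> hcar K" for x
    using D[OF that] mult_right_mono[OF abs_ge_self[of D] K.hnorm_nonneg[OF that]] by simp
  have "\<exists>d\<in>hcar J. hnorm L (x - d) < e" if x: "x \<in> hcar L" and e: "e > 0" for x e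
  proof -
    obtain k where k: "k \<in> hcar K" "hnorm L (x - k) < e / 2"
      using dKL[OF x, of "e / 2"] e by auto
    have "e / (2 * (\<bar>D\<bar> + 1)) > 0"
      using e by simp
    then obtain j where j: "j \<in> hcar J" "hnorm K (k - j) < e / (2 * (\<bar>D\<bar> + 1))"
      using dJK[OF k(1)] by blast
    have kj: "k - j \<in> hcar K"
      using k j JK by auto
    have "hnorm L (k - j) \<le> (\<bar>D\<bar> + 1) * hnorm K (k - j)"
      using D'[OF kj] K.hnorm_nonneg[OF kj] by (simp add: distrib_right)
    also have "\<dots> < e / 2"
      using j(2) by (simp add: field_simps add_pos_nonneg)
    finally have "hnorm L (k - j) < e / 2" .
    moreover have "hnorm L ((x - k) + (k - j)) \<le> hnorm L (x - k) + hnorm L (k - j)"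
      using x k(1) kj KL by (intro L.hnorm_triangle) auto
    ultimately have "hnorm L (x - j) < e"
      using k(2) by simp
    then show ?thesis
      using j(1) by blast
  qed
  moreover have "hnorm L x \<le> (\<bar>D\<bar> * C) * hnorm J x" if "x \<in> hcar J" for x
  proof -
    have "hnorm L x \<le> \<bar>D\<bar> * hnorm K x"
      using that JK by (intro D') auto
    also have "\<dots> \<le> \<bar>D\<bar> * (C * hnorm J x)"
      using C[OF that] by (rule mult_left_mono) simp
    finally show ?thesis
      by (simp add: mult.assoc)
  qed
  ultimately show ?thesis
    using JK KL unfolding densely_embedded_def dense_subset_def by blast
qed

text \<open>The map \<open>riesz K \<circ> riesz_rep L\<close> from the dual of \<open>L\<close> to that of \<open>K\<close> is the inclusion of \<open>L\<close> in \<open>K\<close> read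
through the Riesz isometries.  It sends \<open>riesz L x\<close> to \<open>riesz K x\<close>, so the pullback along it has the
same pairing with tuples from \<open>L\<close>.\<close>

lemma exp_bounded_restrict:
  assumes L: "separable_hilbert_space L" and K: "separable_hilbert_space K"
    and emb: "densely_embedded L K" and F: "exp_bounded q (hdual K) F"
  shows "\<exists>G. exp_bounded q (hdual L) G \<and>
    (\<forall>n. \<forall>xs\<in>tuples (hcar L) n. dual_pairing K F n xs = dual_pairing L G n xs)"
proof -
  have hL: "hilbert_space L" and hK: "hilbert_space K"
    using L K by (simp_all add: separable_hilbert_space_def)
  obtain C where LK: "hcar L \<subseteq> hcar K" and C: "\<And>x. x \<in> hcar L \<Longrightarrow> hnorm K x \<le> C * hnorm L x"
    using emb unfolding densely_embedded_def dense_subset_def by blast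
  interpret L: prehilbert L
    using hL by (rule hilbert_space_imp_prehilbert)
  let ?A = "\<lambda>\<eta>. riesz K (riesz_rep L \<eta>)"
  interpret bounded_linear_map "hdual L" "hdual K" ?A "max 1 C"
  proof (intro bounded_linear_map.intro prehilbert_hdual hL hK bounded_linear_map_axioms.intro)
    show "?A \<eta> \<in> hcar (hdual K)" if "\<eta> \<in> hcar (hdual L)" for \<eta>
      using that LK by (auto simp: hdual_mem_iff_riesz[OF hL] riesz_rep_riesz[OF hL] intro!: riesz_mem_hdual[OF hK])
    show "?A (a *\<^sub>R \<eta> + \<zeta>) = a *\<^sub>R ?A \<eta> + ?A \<zeta>"
      if "\<eta> \<in> hcar (hdual L)" "\<zeta> \<in> hcar (hdual L)" for \<eta> \<zeta> a
    proof -
      from that obtain u v where uv: "\<eta> = riesz L u" "\<zeta> = riesz L v" "u \<in> hcar L" "v \<in> hcar L"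
        by (auto simp: hdual_mem_iff_riesz[OF hL])
      then have "riesz_rep L (a *\<^sub>R \<eta> + \<zeta>) = a *\<^sub>R u + v"
        by (simp only: riesz_lin[OF hL, symmetric] riesz_rep_riesz[OF hL] L.scale_mem L.add_mem)
      moreover have "riesz K (a *\<^sub>R u + v) = a *\<^sub>R riesz K u + riesz K v"
        using uv LK by (intro riesz_lin[OF hK]) auto
      ultimately show ?thesis
        using uv by (simp only: riesz_rep_riesz[OF hL])
    qed
    show "hnorm (hdual K) (?A \<eta>) \<le> max 1 C * hnorm (hdual L) \<eta>" if "\<eta> \<in> hcar (hdual L)" for \<eta>
    proof -
      from that obtain u where u: "\<eta> = riesz L u" "u \<in> hcar L"
        by (auto simp: hdual_mem_iff_riesz[OF hL])
      have "hnorm K u \<le> max 1 C * hnorm L u"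
        using C[OF u(2)] mult_right_mono[of C "max 1 C" "hnorm L u"] L.hnorm_nonneg[OF u(2)] by simp
      then show ?thesis
        using u LK by (simp add: riesz_rep_riesz[OF hL] hnorm_hdual_riesz[OF hL] hnorm_hdual_riesz[OF hK] subset_iff)
    qed
  qed simp
  have "dual_pairing K F n xs = dual_pairing L (\<lambda>n. pullback n (F n)) n xs"
    if "xs \<in> tuples (hcar L) n" for n xs
  proof -
    have "map (riesz L) xs \<in> tuples (hcar (hdual L)) n"
      using that riesz_mem_hdual[OF hL] by (auto simp: tuples_def)
    moreover have "map ?A (map (riesz L) xs) = map (riesz K) xs"
      using that by (auto simp: tuples_def riesz_rep_riesz[OF hL])
    ultimately show ?thesis
      unfolding dual_pairing_def pullback_def by (simp only: if_True)
  qed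
  then show ?thesis
    using exp_bounded_pullback[OF is_onb_onb_hdual[OF L] is_onb_onb_hdual[OF K] F] by blast
qed

section \<open>Tensor multiplication of sequences\<close>

lemma tensor_mult_assoc:
  "tensor_mult (tensor_mult F G) H = tensor_mult F (tensor_mult G H)"
proof (intro ext)
  fix n xs
  have "tensor_mult (tensor_mult F G) H n xs =
      (\<Sum>i\<le>n. \<Sum>j\<le>i. F j (take j xs) * G (i - j) (take (i - j) (drop j xs)) * H (n - i) (drop i xs))"
    unfolding tensor_mult_def sum_distrib_right
    by (intro sum.cong refl) (simp add: min_def drop_take)
  also have "\<dots> = (\<Sum>(i, j)\<in>Sigma {..n} (\<lambda>i. {..i}).
      F j (take j xs) * G (i - j) (take (i - j) (drop j xs)) * H (n - i) (drop i xs))"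
    by (simp add: sum.Sigma)
  also have "\<dots> = (\<Sum>(j, k)\<in>Sigma {..n} (\<lambda>j. {..n - j}).
      F j (take j xs) * G k (take k (drop j xs)) * H (n - j - k) (drop (k + j) xs))"
    by (rule sum.reindex_bij_witness[of _ "\<lambda>(j, k). (j + k, j)" "\<lambda>(i, j). (j, i - j)"]) auto
  also have "\<dots> = (\<Sum>j\<le>n. \<Sum>k\<le>n - j.
      F j (take j xs) * G k (take k (drop j xs)) * H (n - j - k) (drop (k + j) xs))"
    by (simp add: sum.Sigma)
  also have "\<dots> = tensor_mult F (tensor_mult G H) n xs"
    unfolding tensor_mult_def sum_distrib_left by (simp add: mult.assoc)
  finally show "tensor_mult (tensor_mult F G) H n xs = tensor_mult F (tensor_mult G H) n xs" .
qed

lemma tensor_mult_add_left: "tensor_mult (F + G) H = tensor_mult F H + tensor_mult G H"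
  by (simp add: tensor_mult_def fun_eq_iff distrib_right sum.distrib)

lemma tensor_mult_add_right: "tensor_mult F (G + H) = tensor_mult F G + tensor_mult F H"
  by (simp add: tensor_mult_def fun_eq_iff distrib_left sum.distrib)

lemma tensor_mult_scale_left: "tensor_mult (c *\<^sub>R F) G = c *\<^sub>R tensor_mult F G"
  by (simp add: tensor_mult_def fun_eq_iff scaleR_fun_def sum_distrib_left mult.assoc)

lemma tensor_mult_scale_right: "tensor_mult F (c *\<^sub>R G) = c *\<^sub>R tensor_mult F G"
  by (simp add: tensor_mult_def fun_eq_iff scaleR_fun_def sum_distrib_left mult.left_commute)

lemma tensor_mult_vacuum_left: "tensor_mult vacuum F = F"
proof (intro ext)
  fix n xs
  have "tensor_mult vacuum F n xs = (\<Sum>i\<le>n. if i = 0 then F n xs else 0)"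
    unfolding tensor_mult_def by (rule sum.cong) (auto simp: vacuum_def)
  then show "tensor_mult vacuum F n xs = F n xs"
    by simp
qed

lemma tensor_mult_vacuum_right:
  assumes "\<And>n xs. length xs \<noteq> n \<Longrightarrow> F n xs = 0"
  shows "tensor_mult F vacuum = F"
proof (intro ext)
  fix n xs
  have "tensor_mult F vacuum n xs = (\<Sum>i\<le>n. if i = n then F n xs else 0)"
    unfolding tensor_mult_def using assms[of xs n] assms[of "take n xs" n]
    by (intro sum.cong) (auto simp: vacuum_def)
  then show "tensor_mult F vacuum n xs = F n xs"
    by simp
qed

lemma exp_bounded_outside:
  assumes "exp_bounded q K F" "length xs \<noteq> n"
  shows "F n xs = 0"
  using assms bounded_multilinear_outside[of K n "F n" xs]
  by (auto simp: exp_bounded_def mem_tensor_power_iff tuples_def)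

section \<open>The algebra of the inductive limit\<close>

locale q_fock_family =
  fixes q :: real and T :: "'t set" and H :: "'t \<Rightarrow> 'v::real_vector hspace"
  assumes abs_q: "\<bar>q\<bar> < 1" and nuclear: "nuclear_family T H"
begin

lemma separable: "\<tau> \<in> T \<Longrightarrow> separable_hilbert_space (H \<tau>)"
  and directed: "\<sigma> \<in> T \<Longrightarrow> \<tau> \<in> T \<Longrightarrow>
    \<exists>\<rho>\<in>T. densely_embedded (H \<rho>) (H \<sigma>) \<and> densely_embedded (H \<rho>) (H \<tau>)"
  and T_nonempty: "T \<noteq> {}"
  using nuclear unfolding nuclear_family_def by blast+

lemma hilbert: "\<tau> \<in> T \<Longrightarrow> hilbert_space (H \<tau>)"
  using separable by (simp add: separable_hilbert_space_def)

lemma prehilbert_dual: "\<tau> \<in> T \<Longrightarrow> prehilbert (hdual (H \<tau>))"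
  by (intro prehilbert_hdual hilbert)

lemma embedded_trans:
  "\<sigma> \<in> T \<Longrightarrow> \<tau> \<in> T \<Longrightarrow> densely_embedded (H \<rho>) (H \<sigma>) \<Longrightarrow> densely_embedded (H \<sigma>) (H \<tau>) \<Longrightarrow>
    densely_embedded (H \<rho>) (H \<tau>)"
  using densely_embedded_trans hilbert by blast

lemma mem_fock_elements_iff:
  "(\<tau>, F) \<in> fock_elements q T H \<longleftrightarrow> \<tau> \<in> T \<and> exp_bounded q (hdual (H \<tau>)) F"
  using ex_mem_Fq_iff_exp_bounded[OF abs_q] by (auto simp: fock_elements_def)

text \<open>The condition under which \<^const>\<open>fock_rel\<close> identifies two elements, for a fixed common smaller space.\<close>

definition agree :: "'t \<Rightarrow> 't \<Rightarrow> (nat \<Rightarrow> ('v \<Rightarrow> real) list \<Rightarrow> real) \<Rightarrow> 't \<Rightarrow>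
    (nat \<Rightarrow> ('v \<Rightarrow> real) list \<Rightarrow> real) \<Rightarrow> bool" where
  "agree \<rho> \<sigma> F \<tau> G \<longleftrightarrow> (\<forall>n. \<forall>xs\<in>tuples (hcar (H \<rho>)) n.
     dual_pairing (H \<sigma>) F n xs = dual_pairing (H \<tau>) G n xs)"

lemma fock_rel_iff:
  "((\<sigma>, F), (\<tau>, G)) \<in> fock_rel q T H \<longleftrightarrow>
    (\<sigma>, F) \<in> fock_elements q T H \<and> (\<tau>, G) \<in> fock_elements q T H \<and>
    (\<exists>\<rho>\<in>T. densely_embedded (H \<rho>) (H \<sigma>) \<and> densely_embedded (H \<rho>) (H \<tau>) \<and> agree \<rho> \<sigma> F \<tau> G)"
  by (simp add: fock_rel_def agree_def)

lemma agree_mono: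
  assumes "densely_embedded (H \<rho>') (H \<rho>)" "agree \<rho> \<sigma> F \<tau> G"
  shows "agree \<rho>' \<sigma> F \<tau> G"
proof -
  have "tuples (hcar (H \<rho>')) n \<subseteq> tuples (hcar (H \<rho>)) n" for n
    using assms(1) by (auto simp: densely_embedded_def dense_subset_def tuples_def)
  then show ?thesis
    using assms(2) unfolding agree_def by blast
qed

text \<open>Transitivity: two agreements on different small spaces hold together on a common smaller one.\<close>

lemma equiv_fock_rel: "equiv (fock_elements q T H) (fock_rel q T H)"
proof (rule equivI)
  show "fock_rel q T H \<subseteq> fock_elements q T H \<times> fock_elements q T H"
    by (auto simp: fock_rel_def)
  show "refl_on (fock_elements q T H) (fock_rel q T H)"
  proof (rule refl_onI)
    fix x assume "x \<in> fock_elements q T H"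
    moreover obtain \<tau> F where "x = (\<tau>, F)"
      by fastforce
    ultimately show "(x, x) \<in> fock_rel q T H"
      using directed[of \<tau> \<tau>] by (auto simp: fock_rel_iff mem_fock_elements_iff agree_def)
  qed
  show "sym (fock_rel q T H)"
    by (rule symI) (auto simp: fock_rel_def eq_commute)
  show "trans (fock_rel q T H)"
  proof (rule transI)
    fix x y z assume xy: "(x, y) \<in> fock_rel q T H" and yz: "(y, z) \<in> fock_rel q T H"
    obtain \<sigma> F \<tau> G \<upsilon> K where [simp]: "x = (\<sigma>, F)" "y = (\<tau>, G)" "z = (\<upsilon>, K)"
      by (cases x, cases y, cases z) auto
    from xy obtain \<rho>1 where \<rho>1: "\<rho>1 \<in> T" "densely_embedded (H \<rho>1) (H \<sigma>)" "agree \<rho>1 \<sigma> F \<tau> G"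
      by (auto simp: fock_rel_iff)
    from yz obtain \<rho>2 where \<rho>2: "\<rho>2 \<in> T" "densely_embedded (H \<rho>2) (H \<upsilon>)" "agree \<rho>2 \<tau> G \<upsilon> K"
      by (auto simp: fock_rel_iff)
    obtain \<rho> where \<rho>: "\<rho> \<in> T" "densely_embedded (H \<rho>) (H \<rho>1)" "densely_embedded (H \<rho>) (H \<rho>2)"
      using directed[OF \<rho>1(1) \<rho>2(1)] by blast
    have el: "(\<sigma>, F) \<in> fock_elements q T H" "(\<upsilon>, K) \<in> fock_elements q T H"
      using xy yz by (auto simp: fock_rel_iff)
    then have "\<sigma> \<in> T" "\<upsilon> \<in> T"
      by (simp_all add: mem_fock_elements_iff)
    then have "densely_embedded (H \<rho>) (H \<sigma>)" "densely_embedded (H \<rho>) (H \<upsilon>)"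
      using embedded_trans[OF \<rho>1(1) _ \<rho>(2) \<rho>1(2)] embedded_trans[OF \<rho>2(1) _ \<rho>(3) \<rho>2(2)]
      by blast+
    moreover have "agree \<rho> \<sigma> F \<upsilon> K"
      using agree_mono[OF \<rho>(2) \<rho>1(3)] agree_mono[OF \<rho>(3) \<rho>2(3)] by (simp add: agree_def)
    ultimately show "(x, z) \<in> fock_rel q T H"
      using el \<rho>(1) by (auto simp: fock_rel_iff)
  qed
qed

abbreviation cls :: "'t \<Rightarrow> (nat \<Rightarrow> ('v \<Rightarrow> real) list \<Rightarrow> real) \<Rightarrow>
    ('t \<times> (nat \<Rightarrow> ('v \<Rightarrow> real) list \<Rightarrow> real)) set" where
  "cls \<tau> F \<equiv> fock_rel q T H `` {(\<tau>, F)}"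

lemma cls_restrict:
  assumes F: "(\<sigma>, F) \<in> fock_elements q T H" and \<rho>: "\<rho> \<in> T" "densely_embedded (H \<rho>) (H \<sigma>)"
  obtains G where "(\<rho>, G) \<in> fock_elements q T H" "cls \<sigma> F = cls \<rho> G"
proof -
  have \<sigma>: "\<sigma> \<in> T" "exp_bounded q (hdual (H \<sigma>)) F"
    using F by (simp_all add: mem_fock_elements_iff)
  obtain G where G: "exp_bounded q (hdual (H \<rho>)) G" and ag: "agree \<rho> \<sigma> F \<rho> G"
    using exp_bounded_restrict[OF separable[OF \<rho>(1)] separable[OF \<sigma>(1)] \<rho>(2) \<sigma>(2)]
    unfolding agree_def by blast
  obtain \<rho>' where \<rho>': "\<rho>' \<in> T" "densely_embedded (H \<rho>') (H \<rho>)"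
    using directed[OF \<rho>(1) \<rho>(1)] by blast
  have GE: "(\<rho>, G) \<in> fock_elements q T H"
    using \<rho>(1) G by (simp add: mem_fock_elements_iff)
  have "((\<sigma>, F), (\<rho>, G)) \<in> fock_rel q T H"
    unfolding fock_rel_iff
    using F GE \<rho>' agree_mono[OF \<rho>'(2) ag] embedded_trans[OF \<rho>(1) \<sigma>(1) \<rho>'(2) \<rho>(2)] by blast
  then have "cls \<sigma> F = cls \<rho> G"
    using equiv_fock_rel by (intro equiv_class_eq)
  then show ?thesis
    using that GE by blast
qed

lemma carrier_indlim: "carrier (fock_indlim q T H) = fock_elements q T H // fock_rel q T H"
  by (simp add: fock_indlim_def)

lemma representative_cases:
  assumes "X \<in> carrier (fock_indlim q T H)"
  obtains \<tau> F where "\<tau> \<in> T" "(\<tau>, F) \<in> fock_elements q T H" "X = cls \<tau> F"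
  using assms by (auto elim!: quotientE simp: carrier_indlim mem_fock_elements_iff)

text \<open>Three classes are what the associative and distributive laws speak of; directedness provides a
common index.\<close>

lemma common_representatives3:
  assumes "X \<in> carrier (fock_indlim q T H)" "Y \<in> carrier (fock_indlim q T H)"
    "Z \<in> carrier (fock_indlim q T H)"
  obtains \<tau> F G K where "(\<tau>, F) \<in> fock_elements q T H" "(\<tau>, G) \<in> fock_elements q T H"
    "(\<tau>, K) \<in> fock_elements q T H" "X = cls \<tau> F" "Y = cls \<tau> G" "Z = cls \<tau> K"
proof -
  obtain \<sigma>1 F1 where 1: "\<sigma>1 \<in> T" "(\<sigma>1, F1) \<in> fock_elements q T H" "X = cls \<sigma>1 F1"
    using representative_cases[OF assms(1)] by blast
  obtain \<sigma>2 F2 where 2: "\<sigma>2 \<in> T" "(\<sigma>2, F2) \<in> fock_elements q T H" "Y = cls \<sigma>2 F2"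
    using representative_cases[OF assms(2)] by blast
  obtain \<sigma>3 F3 where 3: "\<sigma>3 \<in> T" "(\<sigma>3, F3) \<in> fock_elements q T H" "Z = cls \<sigma>3 F3"
    using representative_cases[OF assms(3)] by blast
  obtain \<rho> where \<rho>: "\<rho> \<in> T" "densely_embedded (H \<rho>) (H \<sigma>1)" "densely_embedded (H \<rho>) (H \<sigma>2)"
    using directed[OF 1(1) 2(1)] by blast
  obtain \<tau> where \<tau>: "\<tau> \<in> T" "densely_embedded (H \<tau>) (H \<rho>)" "densely_embedded (H \<tau>) (H \<sigma>3)"
    using directed[OF \<rho>(1) 3(1)] by blast
  have "densely_embedded (H \<tau>) (H \<sigma>1)" "densely_embedded (H \<tau>) (H \<sigma>2)"
    using embedded_trans[OF \<rho>(1) 1(1) \<tau>(2) \<rho>(2)] embedded_trans[OF \<rho>(1) 2(1) \<tau>(2) \<rho>(3)] by auto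
  then show ?thesis
    using that 1(3) 2(3) 3(3) cls_restrict[OF 1(2) \<tau>(1)] cls_restrict[OF 2(2) \<tau>(1)]
      cls_restrict[OF 3(2) \<tau>(1) \<tau>(3)] by metis
qed

text \<open>An operation that is closed over each index and respects agreement does not depend on the
representatives: two pairs of representatives agree on a common smaller space.  So the union that
defines the operation on classes is a union of equal classes, and it is not empty.\<close>

lemma cls_operation:
  assumes closed: "\<And>\<tau> F G. (\<tau>, F) \<in> fock_elements q T H \<Longrightarrow> (\<tau>, G) \<in> fock_elements q T H \<Longrightarrow>
      (\<tau>, f F G) \<in> fock_elements q T H"
    and agree: "\<And>\<rho> \<sigma> \<tau> F F' G G'. agree \<rho> \<sigma> F \<tau> F' \<Longrightarrow> agree \<rho> \<sigma> G \<tau> G' \<Longrightarrow>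
      agree \<rho> \<sigma> (f F G) \<tau> (f F' G')"
    and F: "(\<tau>, F) \<in> fock_elements q T H" and G: "(\<tau>, G) \<in> fock_elements q T H"
  shows "\<Union>{cls \<sigma> (f F' G') | \<sigma> F' G'. (\<sigma>, F') \<in> cls \<tau> F \<and> (\<sigma>, G') \<in> cls \<tau> G} = cls \<tau> (f F G)"
proof -
  have eq: "cls \<sigma> (f F' G') = cls \<tau> (f F G)" if "(\<sigma>, F') \<in> cls \<tau> F" "(\<sigma>, G') \<in> cls \<tau> G" for \<sigma> F' G'
  proof -
    have FF': "((\<tau>, F), (\<sigma>, F')) \<in> fock_rel q T H" and GG': "((\<tau>, G), (\<sigma>, G')) \<in> fock_rel q T H"
      using that by auto
    obtain \<rho>1 where \<rho>1: "\<rho>1 \<in> T" "densely_embedded (H \<rho>1) (H \<tau>)" "densely_embedded (H \<rho>1) (H \<sigma>)"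
        "agree \<rho>1 \<tau> F \<sigma> F'"
      using FF' unfolding fock_rel_iff by blast
    obtain \<rho>2 where \<rho>2: "\<rho>2 \<in> T" "agree \<rho>2 \<tau> G \<sigma> G'"
      using GG' unfolding fock_rel_iff by blast
    obtain \<rho> where \<rho>: "\<rho> \<in> T" "densely_embedded (H \<rho>) (H \<rho>1)" "densely_embedded (H \<rho>) (H \<rho>2)"
      using directed[OF \<rho>1(1) \<rho>2(1)] by blast
    have el: "(\<sigma>, F') \<in> fock_elements q T H" "(\<sigma>, G') \<in> fock_elements q T H"
      using FF' GG' by (simp_all add: fock_rel_iff)
    have "\<tau> \<in> T" "\<sigma> \<in> T"
      using F el by (simp_all add: mem_fock_elements_iff)
    then have "densely_embedded (H \<rho>) (H \<tau>)" "densely_embedded (H \<rho>) (H \<sigma>)"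
      using embedded_trans[OF \<rho>1(1) _ \<rho>(2)] \<rho>1 by blast+
    moreover have "agree \<rho> \<tau> (f F G) \<sigma> (f F' G')"
      by (intro agree agree_mono[OF \<rho>(2) \<rho>1(4)] agree_mono[OF \<rho>(3) \<rho>2(2)])
    ultimately have "((\<tau>, f F G), (\<sigma>, f F' G')) \<in> fock_rel q T H"
      unfolding fock_rel_iff using \<rho>(1) closed[OF F G] closed[OF el] by blast
    then show ?thesis
      using equiv_class_eq[OF equiv_fock_rel] by metis
  qed
  have "(\<tau>, F) \<in> cls \<tau> F" "(\<tau>, G) \<in> cls \<tau> G"
    using F G equiv_class_self[OF equiv_fock_rel] by blast+
  then show ?thesis
    using eq by blast
qed

lemma closed_tensor_mult:
  "(\<tau>, F) \<in> fock_elements q T H \<Longrightarrow> (\<tau>, G) \<in> fock_elements q T H \<Longrightarrow>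
    (\<tau>, tensor_mult F G) \<in> fock_elements q T H"
  using abs_q by (auto simp: mem_fock_elements_iff intro!: exp_bounded_tensor_mult prehilbert_dual)

lemma closed_add:
  "(\<tau>, F) \<in> fock_elements q T H \<Longrightarrow> (\<tau>, G) \<in> fock_elements q T H \<Longrightarrow>
    (\<tau>, F + G) \<in> fock_elements q T H"
  unfolding mem_fock_elements_iff using exp_bounded_add by blast

lemma closed_scale:
  "(\<tau>, F) \<in> fock_elements q T H \<Longrightarrow> (\<tau>, c *\<^sub>R F) \<in> fock_elements q T H"
  unfolding mem_fock_elements_iff using exp_bounded_scale by blast

lemma closed_vacuum: "\<tau> \<in> T \<Longrightarrow> (\<tau>, vacuum) \<in> fock_elements q T H"
  unfolding mem_fock_elements_iff using exp_bounded_vacuum prehilbert_dual by blast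

lemma closed_zero: "\<tau> \<in> T \<Longrightarrow> (\<tau>, 0) \<in> fock_elements q T H"
  using closed_scale[OF closed_vacuum, of \<tau> 0] by (simp only: scaleR_zero_left)

lemma agree_tensor_mult:
  assumes "agree \<rho> \<sigma> F \<tau> F'" "agree \<rho> \<sigma> G \<tau> G'"
  shows "agree \<rho> \<sigma> (tensor_mult F G) \<tau> (tensor_mult F' G')"
  unfolding agree_def
proof (intro allI ballI)
  fix n xs assume xs: "xs \<in> tuples (hcar (H \<rho>)) n"
  have "dual_pairing (H \<sigma>) F i (take i xs) = dual_pairing (H \<tau>) F' i (take i xs)"
    and "dual_pairing (H \<sigma>) G (n - i) (drop i xs) = dual_pairing (H \<tau>) G' (n - i) (drop i xs)"
    if "i \<le> n" for i
  proof -
    have "take i xs \<in> tuples (hcar (H \<rho>)) i" "drop i xs \<in> tuples (hcar (H \<rho>)) (n - i)"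
      using xs that by (auto simp: tuples_def dest: in_set_takeD in_set_dropD)
    then show "dual_pairing (H \<sigma>) F i (take i xs) = dual_pairing (H \<tau>) F' i (take i xs)"
      and "dual_pairing (H \<sigma>) G (n - i) (drop i xs) = dual_pairing (H \<tau>) G' (n - i) (drop i xs)"
      using assms unfolding agree_def by blast+
  qed
  then show "dual_pairing (H \<sigma>) (tensor_mult F G) n xs = dual_pairing (H \<tau>) (tensor_mult F' G') n xs"
    by (simp add: dual_pairing_def tensor_mult_def take_map drop_map)
qed

lemma agree_add:
  "agree \<rho> \<sigma> F \<tau> F' \<Longrightarrow> agree \<rho> \<sigma> G \<tau> G' \<Longrightarrow> agree \<rho> \<sigma> (F + G) \<tau> (F' + G')"
  by (simp add: agree_def dual_pairing_def)

lemma agree_scale: "agree \<rho> \<sigma> F \<tau> F' \<Longrightarrow> agree \<rho> \<sigma> (c *\<^sub>R F) \<tau> (c *\<^sub>R F')"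
  by (simp add: agree_def dual_pairing_def scaleR_fun_def)

text \<open>The sequences \<^const>\<open>vacuum\<close> and \<open>0\<close> have the same pairing over every index.\<close>

lemma UN_cls_eq:
  assumes el: "\<And>\<tau>. \<tau> \<in> T \<Longrightarrow> (\<tau>, F) \<in> fock_elements q T H"
    and agree: "\<And>\<rho> \<sigma> \<tau>. agree \<rho> \<sigma> F \<tau> F" and "\<tau> \<in> T"
  shows "(\<Union>\<sigma>\<in>T. cls \<sigma> F) = cls \<tau> F"
proof -
  have "cls \<sigma> F = cls \<tau> F" if "\<sigma> \<in> T" for \<sigma>
  proof (rule equiv_class_eq[OF equiv_fock_rel])
    show "((\<sigma>, F), (\<tau>, F)) \<in> fock_rel q T H"
      unfolding fock_rel_iff using that \<open>\<tau> \<in> T\<close> el agree directed by blast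
  qed
  then show ?thesis
    using \<open>\<tau> \<in> T\<close> by blast
qed

lemma cls_mem: "(\<tau>, F) \<in> fock_elements q T H \<Longrightarrow> cls \<tau> F \<in> carrier (fock_indlim q T H)"
  unfolding carrier_indlim by (rule quotientI)

lemma mult_cls:
  assumes "(\<tau>, F) \<in> fock_elements q T H" "(\<tau>, G) \<in> fock_elements q T H"
  shows "cls \<tau> F \<otimes>\<^bsub>fock_indlim q T H\<^esub> cls \<tau> G = cls \<tau> (tensor_mult F G)"
  unfolding fock_indlim_def Let_def
  using cls_operation[OF closed_tensor_mult agree_tensor_mult assms] by simp

lemma add_cls:
  assumes "(\<tau>, F) \<in> fock_elements q T H" "(\<tau>, G) \<in> fock_elements q T H"
  shows "cls \<tau> F \<oplus>\<^bsub>fock_indlim q T H\<^esub> cls \<tau> G = cls \<tau> (F + G)"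
  unfolding fock_indlim_def Let_def
  using cls_operation[OF closed_add agree_add assms] by simp

lemma smult_cls:
  assumes "(\<tau>, F) \<in> fock_elements q T H"
  shows "c \<odot>\<^bsub>fock_indlim q T H\<^esub> cls \<tau> F = cls \<tau> (c *\<^sub>R F)"
proof -
  have "{cls \<sigma> (c *\<^sub>R F') | \<sigma> F'. (\<sigma>, F') \<in> cls \<tau> F} =
      {cls \<sigma> (c *\<^sub>R F') | \<sigma> F' G'. (\<sigma>, F') \<in> cls \<tau> F \<and> (\<sigma>, G') \<in> cls \<tau> F}"
    by blast
  then show ?thesis
    unfolding fock_indlim_def Let_def
    using cls_operation[where f = "\<lambda>F G. c *\<^sub>R F", OF closed_scale agree_scale assms assms] by simp
qed

lemma one_cls: "\<tau> \<in> T \<Longrightarrow> \<one>\<^bsub>fock_indlim q T H\<^esub> = cls \<tau> vacuum"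
  unfolding fock_indlim_def Let_def
  using UN_cls_eq[OF closed_vacuum] by (simp add: agree_def dual_pairing_def vacuum_def)

lemma zero_cls: "\<tau> \<in> T \<Longrightarrow> \<zero>\<^bsub>fock_indlim q T H\<^esub> = cls \<tau> 0"
  unfolding fock_indlim_def Let_def
  using UN_cls_eq[OF closed_zero] by (simp add: agree_def dual_pairing_def)

lemma vacuum_right: "(\<tau>, F) \<in> fock_elements q T H \<Longrightarrow> tensor_mult F vacuum = F"
  unfolding mem_fock_elements_iff by (intro tensor_mult_vacuum_right) (auto dest: exp_bounded_outside)

lemma common_representatives2:
  assumes "X \<in> carrier (fock_indlim q T H)" "Y \<in> carrier (fock_indlim q T H)"
  obtains \<tau> F G where "(\<tau>, F) \<in> fock_elements q T H" "(\<tau>, G) \<in> fock_elements q T H"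
    "X = cls \<tau> F" "Y = cls \<tau> G"
  using assms common_representatives3[of X Y Y thesis] by blast

lemmas cls_simps = mult_cls add_cls smult_cls cls_mem
  closed_tensor_mult closed_add closed_scale closed_vacuum closed_zero

lemma abelian_group_indlim: "abelian_group (fock_indlim q T H)"
proof (rule abelian_groupI)
  let ?A = "fock_indlim q T H"
  obtain \<tau>0 where \<tau>0: "\<tau>0 \<in> T"
    using T_nonempty by blast
  show "\<zero>\<^bsub>?A\<^esub> \<in> carrier ?A"
    using zero_cls[OF \<tau>0] cls_mem[OF closed_zero[OF \<tau>0]] by simp
  show "X \<oplus>\<^bsub>?A\<^esub> Y \<in> carrier ?A" if "X \<in> carrier ?A" "Y \<in> carrier ?A" for X Y
    using that by (rule common_representatives2) (simp add: cls_simps)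
  show "X \<oplus>\<^bsub>?A\<^esub> Y = Y \<oplus>\<^bsub>?A\<^esub> X" if "X \<in> carrier ?A" "Y \<in> carrier ?A" for X Y
    using that by (rule common_representatives2) (simp add: cls_simps add.commute)
  show "(X \<oplus>\<^bsub>?A\<^esub> Y) \<oplus>\<^bsub>?A\<^esub> Z = X \<oplus>\<^bsub>?A\<^esub> (Y \<oplus>\<^bsub>?A\<^esub> Z)"
    if "X \<in> carrier ?A" "Y \<in> carrier ?A" "Z \<in> carrier ?A" for X Y Z
    using that
    by (rule common_representatives3) (simp add: cls_simps add.assoc)
  show "\<zero>\<^bsub>?A\<^esub> \<oplus>\<^bsub>?A\<^esub> X = X" if "X \<in> carrier ?A" for X
    using that by (rule representative_cases) (simp add: zero_cls cls_simps)
  show "\<exists>Y\<in>carrier ?A. Y \<oplus>\<^bsub>?A\<^esub> X = \<zero>\<^bsub>?A\<^esub>" if X: "X \<in> carrier ?A" for X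
  proof -
    obtain \<tau> F where F: "\<tau> \<in> T" "(\<tau>, F) \<in> fock_elements q T H" "X = cls \<tau> F"
      using X by (rule representative_cases)
    have "(- 1) *\<^sub>R F + F = 0"
      by (metis add.left_inverse scaleR_minus1_left)
    then have "cls \<tau> ((- 1) *\<^sub>R F) \<oplus>\<^bsub>?A\<^esub> X = \<zero>\<^bsub>?A\<^esub>"
      unfolding F(3) add_cls[OF closed_scale[OF F(2)] F(2)] zero_cls[OF F(1)] by (simp only:)
    then show ?thesis
      using cls_mem[OF closed_scale[OF F(2)]] by blast
  qed
qed

lemma monoid_indlim: "monoid (fock_indlim q T H)"
proof (rule monoidI)
  let ?A = "fock_indlim q T H"
  obtain \<tau>0 where \<tau>0: "\<tau>0 \<in> T"
    using T_nonempty by blast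
  show "\<one>\<^bsub>?A\<^esub> \<in> carrier ?A"
    using one_cls[OF \<tau>0] cls_mem[OF closed_vacuum[OF \<tau>0]] by simp
  show "X \<otimes>\<^bsub>?A\<^esub> Y \<in> carrier ?A" if "X \<in> carrier ?A" "Y \<in> carrier ?A" for X Y
    using that by (rule common_representatives2) (simp add: cls_simps)
  show "(X \<otimes>\<^bsub>?A\<^esub> Y) \<otimes>\<^bsub>?A\<^esub> Z = X \<otimes>\<^bsub>?A\<^esub> (Y \<otimes>\<^bsub>?A\<^esub> Z)"
    if "X \<in> carrier ?A" "Y \<in> carrier ?A" "Z \<in> carrier ?A" for X Y Z
    using that
    by (rule common_representatives3) (simp add: cls_simps tensor_mult_assoc)
  show "\<one>\<^bsub>?A\<^esub> \<otimes>\<^bsub>?A\<^esub> X = X" if "X \<in> carrier ?A" for X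
    using that by (rule representative_cases) (simp add: one_cls cls_simps tensor_mult_vacuum_left)
  show "X \<otimes>\<^bsub>?A\<^esub> \<one>\<^bsub>?A\<^esub> = X" if "X \<in> carrier ?A" for X
    using that by (rule representative_cases) (simp add: one_cls cls_simps vacuum_right)
qed

lemma ring_indlim: "Ring.ring (fock_indlim q T H)"
proof (rule ringI[OF abelian_group_indlim monoid_indlim])
  let ?A = "fock_indlim q T H"
  fix X Y Z assume "X \<in> carrier ?A" "Y \<in> carrier ?A" "Z \<in> carrier ?A"
  then obtain \<tau> F G K where FGK: "(\<tau>, F) \<in> fock_elements q T H" "(\<tau>, G) \<in> fock_elements q T H"
    "(\<tau>, K) \<in> fock_elements q T H" "X = cls \<tau> F" "Y = cls \<tau> G" "Z = cls \<tau> K"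
    by (rule common_representatives3)
  show "(X \<oplus>\<^bsub>?A\<^esub> Y) \<otimes>\<^bsub>?A\<^esub> Z = X \<otimes>\<^bsub>?A\<^esub> Z \<oplus>\<^bsub>?A\<^esub> Y \<otimes>\<^bsub>?A\<^esub> Z"
    using FGK by (simp add: cls_simps tensor_mult_add_left)
  show "Z \<otimes>\<^bsub>?A\<^esub> (X \<oplus>\<^bsub>?A\<^esub> Y) = Z \<otimes>\<^bsub>?A\<^esub> X \<oplus>\<^bsub>?A\<^esub> Z \<otimes>\<^bsub>?A\<^esub> Y"
    using FGK by (simp add: cls_simps tensor_mult_add_right)
qed

end

lemma cring_real_field: "cring real_field"
proof (rule cringI)
  show "abelian_group real_field"
  proof (rule abelian_groupI)
    fix x :: real
    show "\<exists>y\<in>carrier real_field. y \<oplus>\<^bsub>real_field\<^esub> x = \<zero>\<^bsub>real_field\<^esub>"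
      by (rule bexI[of _ "- x"]) (simp_all add: real_field_def)
  qed (simp_all add: real_field_def)
  show "comm_monoid real_field"
    by (rule comm_monoidI) (simp_all add: real_field_def)
qed (simp add: real_field_def distrib_right)

context q_fock_family
begin

lemma module_indlim: "Module.module real_field (fock_indlim q T H)"
proof (rule moduleI[OF cring_real_field abelian_group_indlim])
  let ?A = "fock_indlim q T H"
  fix X assume X: "X \<in> carrier ?A"
  fix a b :: real
  show "a \<odot>\<^bsub>?A\<^esub> X \<in> carrier ?A"
    using X by (rule representative_cases) (simp add: cls_simps)
  show "(a \<oplus>\<^bsub>real_field\<^esub> b) \<odot>\<^bsub>?A\<^esub> X = a \<odot>\<^bsub>?A\<^esub> X \<oplus>\<^bsub>?A\<^esub> b \<odot>\<^bsub>?A\<^esub> X"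
    using X by (rule representative_cases) (simp add: cls_simps real_field_def scaleR_add_left)
  show "(a \<otimes>\<^bsub>real_field\<^esub> b) \<odot>\<^bsub>?A\<^esub> X = a \<odot>\<^bsub>?A\<^esub> (b \<odot>\<^bsub>?A\<^esub> X)"
    using X by (rule representative_cases) (simp add: cls_simps real_field_def)
  show "\<one>\<^bsub>real_field\<^esub> \<odot>\<^bsub>?A\<^esub> X = X"
    using X by (rule representative_cases) (simp add: cls_simps real_field_def)
  show "a \<odot>\<^bsub>?A\<^esub> (X \<oplus>\<^bsub>?A\<^esub> Y) = a \<odot>\<^bsub>?A\<^esub> X \<oplus>\<^bsub>?A\<^esub> a \<odot>\<^bsub>?A\<^esub> Y" if "Y \<in> carrier ?A" for Y
    using X that by (rule common_representatives2) (simp add: cls_simps scaleR_add_right)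
qed

lemma real_algebra_indlim: "real_algebra (fock_indlim q T H)"
proof -
  let ?A = "fock_indlim q T H"
  have "(c \<odot>\<^bsub>?A\<^esub> X) \<otimes>\<^bsub>?A\<^esub> Y = c \<odot>\<^bsub>?A\<^esub> (X \<otimes>\<^bsub>?A\<^esub> Y) \<and>
      X \<otimes>\<^bsub>?A\<^esub> (c \<odot>\<^bsub>?A\<^esub> Y) = c \<odot>\<^bsub>?A\<^esub> (X \<otimes>\<^bsub>?A\<^esub> Y)"
    if "X \<in> carrier ?A" "Y \<in> carrier ?A" for c X Y
    using that by (rule common_representatives2)
      (simp add: cls_simps tensor_mult_scale_left tensor_mult_scale_right)
  then show ?thesis
    unfolding real_algebra_def using ring_indlim module_indlim by blast
qed

end

theorem corollary5p10:
  fixes q :: real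
    and T :: "'t set"
    and H :: "'t \<Rightarrow> 'h::{real_inner, polish_space} hspace"
  assumes "-1 < q" and "q < 1"
    and "nuclear_family T H"
    and "\<And>\<tau>. \<tau> \<in> T \<Longrightarrow> closure (hcar (H \<tau>)) = UNIV"
    and "\<And>\<tau> x. \<tau> \<in> T \<Longrightarrow> x \<in> hcar (H \<tau>) \<Longrightarrow> norm x \<le> hnorm (H \<tau>) x"
    and "closure (proj_lim T H) = UNIV"
    and "continuous_map (proj_lim_topology T H) euclidean (\<lambda>\<phi>. \<phi>)"
  shows "real_algebra (fock_indlim q T H)"
proof -
  interpret q_fock_family q T H
    using assms(1-3) by unfold_locales auto
  show ?thesis
    by (rule real_algebra_indlim)
qed

end
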